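(* Let $\Pi$ be a positive recurrent regenerative random permutation of $\mathbb{N}_{+}$, with block length distribution $p=(p_1,p_2,\ldots)$ on $\mathbb{N}_{+}$ and blocks governed by a family of probability distributions $Q_n$ on $\mathfrak{S}_n$, where $\mu:=\sum_n np_n<\infty$; let $(R_n;\,n\ge1)$ be its renewal indicators. (i) There exists a unique (in law) stationary regenerative random permutation $\Pi^*$ of $\mathbb{Z}$, with associated stationary renewal process $$\{\cdots<T_{-2}<T_{-1}<T_0<T_1<T_2<\cdots\}\subseteq\mathbb{Z},$$ with indexing defined by $T_{-1}<0\le T_0$, and renewal indicators $R^*_z$ (with $R^*_z=1$ implying that $\Pi^*$ splits at $z$), such that $$\mathbb{P}(R^*_z=1)=1/\mu\quad\text{for }z\in\mathbb{Z},$$ and, given the event $\{R^*_z=1\}$, with $\Pi^{*,z}_i:=\Pi^*_{z+i}-z$ for $i\in\mathbb{N}_{+}$, $$(\Pi^{*,z}_1,\Pi^{*,z}_2,\ldots\mid R^*_z=1)\stackrel{(d)}{=}(\Pi^n_1,\Pi^n_2,\ldots\mid R_n=1)\quad\text{for }z\in\mathbb{Z},$$ for every $n$ such that $\mathbb{P}(R_n=1)>0$. (ii) For this $\Pi^*$, with block lengths $Y_z:=T_z-T_{z-1}$, $z\in\mathbb{Z}$, the $(Y_z;\,z\in\mathbb{Z})$ are independent, the $Y_z$ with $z\ne0$ all have distribution $p$, and $Y_0$ has the size-biased distribution $$\mathbb{P}(Y_0=n)=np_n/\mu\quad\text{for }n\ge1.$$ Conditionally given all the block lengths, the delay $T_0$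 has uniform distribution on $\{0,1,\ldots,Y_0-1\}$; and conditionally on all the block lengths and on $T_0$, with given block lengths $n_i$ say, the reduced permutation of $\Pi^*$ on the block of $n_i$ integers $(T_{i-1},T_i]$ is distributed according to $Q_{n_i}$. Conversely, if $\Pi$ is a regenerative random permutation of $\mathbb{N}_{+}$, existence of such a stationary regenerative permutation of $\mathbb{Z}$ implies that $\Pi$ is positive recurrent.
   Context: $\mathbb{N}_{+}=\{1,2,\ldots\}$, $\mathbb{N}_0=\{0,1,2,\ldots\}$, $[n]=\{1,\ldots,n\}$, and $\mathfrak{S}_n$ is the set of permutations of $[n]$. A permutation of an interval of integers $I$ splits at $n\in I$ if it maps $I\cap(-\infty,n]$ onto itself. If a permutation maps a finite interval $J$ of $\ell$ integers onto itself, its reduced permutation on $J$ is the permutation of $[\ell]$ obtained by conjugating with the shift from $J$ to $[\ell]$. If $\Pi$ splits at $n$, $\Pi^n_i:=\Pi_{n+i}-n$, $i\in\mathbb{N}_{+}$. **Regeneration.** A delayed renewal process is $T_n=T_0+Y_1+\cdots+Y_n$ with $T_0\in\mathbb{N}_0$, $Y_i\in\mathbb{N}_{+}\cup\{\infty\}$ independent and the $Y_i$ identically distributed; it has zero delay if $T_0=0$. Its renewal indicators are $R_n=\sum_{k\ge0}1(T_k=n)$. A random permutation $\Pi$ of $\mathbb{N}_{+}$ is regenerative (with respect to $(T_n)$) if every finite $T_i$ is a splitting time of $\Pi$ (time $0$ being counted trivially), and for each $n>0$ with $\mathbb{P}(R_n=1)>0$, conditionally given $R_n=1$: (a) $(\Pi^n,R_{n+1},R_{n+2},\ldots)\stackrel{(d)}{=}(\Pi^0,R^0_1,R^0_2,\ldots)$,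 for some random permutation $\Pi^0$ of $\mathbb{N}_{+}$ with renewal indicators $R^0$ of a zero-delay renewal process (not depending on $n$); (b) $(R_0,\ldots,R_n)$ is independent of $(\Pi^n,R_{n+1},R_{n+2},\ldots)$. It is positive recurrent if $\mathbb{E}(Y_1)<\infty$. **Block length distribution $p$ and blocks governed by $(Q_n)$.** $\Pi$ is a concatenation of blocks Block$_0$, Block$_1$, Block$_2,\ldots$ such that the lengths $Y_i$ of Block$_i$, $i\ge1$, are i.i.d. with distribution $p$, independent of the almost surely finite length $T_0$ of Block$_0$; and conditionally given the block lengths, the reduced blocks are independent, with the reduced block of Block$_i$, $i\ge1$, having distribution $Q_{n_i}$ when $Y_i=n_i$. The renewal times are $T_n=T_0+Y_1+\cdots+Y_n$. **Stationary regenerative permutation of $\mathbb{Z}$ associated with $\Pi$.** A random permutation $\Pi^*$ of $\mathbb{Z}$ with $\{0,1\}$-valued renewal indicators $(R^*_z)_{z\in\mathbb{Z}}$ such that $R^*_z=1$ implies $\Pi^*$ splits at $z$; the process $(\Pi^*_z-z,R^*_z)_{z\in\mathbb{Z}}$ is stationary; $\mathbb{P}(R^*_0=1)>0$; and conditionally given $R^*_z=1$, $\big((\Pi^*_{z+i}-z)_{i\ge1},(R^*_{z+i})_{i\ge1}\big)$ has the law of $(\Pi^0,(R^0_i)_{i\ge1})$. The times $T_k$, $k\in\mathbb{Z}$, are the $z$ with $R^*_z=1$, listed in increasing order. *)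

theory Defs
  imports "HOL-Probability.Probability"
begin

text \<open>
  All permutations are functions on the integers. A permutation of \<open>I\<close> is a function that restricts
  to a bijection of \<open>I\<close>; its values outside \<open>I\<close> are ignored, except for finite permutations, which
  are the identity outside \<open>{1..n}\<close> as in \<^const>\<open>permutes\<close>.
\<close>

abbreviation path_space :: "'i set \<Rightarrow> ('i \<Rightarrow> 'v) measure" where
  "path_space I \<equiv> PiM I (\<lambda>_. count_space UNIV)"

definition splits_at :: "int set \<Rightarrow> (int \<Rightarrow> int) \<Rightarrow> int \<Rightarrow> bool" where
  "splits_at I \<pi> n \<longleftrightarrow> \<pi> ` (I \<inter> {..n}) = I \<inter> {..n}"

text \<open>For \<open>\<pi>\<close> mapping \<open>(a, b]\<close> onto itself, the permutation of \<open>[b - a]\<close> obtained by shifting.\<close>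

definition reduced_perm :: "int \<Rightarrow> int \<Rightarrow> (int \<Rightarrow> int) \<Rightarrow> (int \<Rightarrow> int)" where
  "reduced_perm a b \<pi> = (\<lambda>i. if i \<in> {1..b - a} then \<pi> (a + i) - a else i)"

definition perm_after :: "(int \<Rightarrow> int) \<Rightarrow> int \<Rightarrow> (int \<Rightarrow> int)" where
  "perm_after \<pi> z = (\<lambda>i\<in>{1..}. \<pi> (z + i) - z)"

definition ind_after :: "(int \<Rightarrow> bool) \<Rightarrow> int \<Rightarrow> (int \<Rightarrow> bool)" where
  "ind_after r z = (\<lambda>i\<in>{1..}. r (z + i))"

definition random_perm :: "'a measure \<Rightarrow> int set \<Rightarrow> ('a \<Rightarrow> int \<Rightarrow> int) \<Rightarrow> bool" where
  "random_perm M I X \<longleftrightarrow>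
     (\<forall>i\<in>I. (\<lambda>\<omega>. X \<omega> i) \<in> M \<rightarrow>\<^sub>M count_space UNIV) \<and> (AE \<omega> in M. bij_betw (X \<omega>) I I)"

definition given :: "'a measure \<Rightarrow> ('a \<Rightarrow> bool) \<Rightarrow> 'a measure" where
  "given M A = uniform_measure M {\<omega> \<in> space M. A \<omega>}"


subsection \<open>Regenerative permutations of the positive integers\<close>

text \<open>
  A delayed renewal process is given by the sequence \<open>Y\<close> whose entry \<open>Y 0\<close> is the delay \<open>T\<^sub>0\<close> and whose
  entries \<open>Y i\<close> with \<open>i \<ge> 1\<close> are the block lengths; these may be infinite.
\<close>

definition delayed_renewal :: "'a measure \<Rightarrow> (nat \<Rightarrow> 'a \<Rightarrow> enat) \<Rightarrow> bool" where
  "delayed_renewal M Y \<longleftrightarrow>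
     prob_space M \<and>
     prob_space.indep_vars M (\<lambda>_. count_space UNIV) Y UNIV \<and>
     (AE \<omega> in M. Y 0 \<omega> < \<infinity>) \<and>
     (\<forall>i\<ge>1. (AE \<omega> in M. 1 \<le> Y i \<omega>) \<and>
        distr M (count_space UNIV) (Y i) = distr M (count_space UNIV) (Y 1))"

definition renewal_time :: "(nat \<Rightarrow> 'a \<Rightarrow> enat) \<Rightarrow> nat \<Rightarrow> 'a \<Rightarrow> enat" where
  "renewal_time Y n \<omega> = (\<Sum>i\<le>n. Y i \<omega>)"

text \<open>
  The finite renewal times are almost surely distinct, so that \<open>R\<^sub>n = (\<Sum>k. 1(T\<^sub>k = n))\<close> takes values
  in \<open>{0, 1}\<close>; it is represented as a truth value.
\<close>

definition renewal_ind :: "(nat \<Rightarrow> 'a \<Rightarrow> enat) \<Rightarrow> 'a \<Rightarrow> int \<Rightarrow> bool" where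
  "renewal_ind Y \<omega> z \<longleftrightarrow> 0 \<le> z \<and> (\<exists>k. renewal_time Y k \<omega> = enat (nat z))"

definition positive_recurrent :: "'a measure \<Rightarrow> (nat \<Rightarrow> 'a \<Rightarrow> enat) \<Rightarrow> bool" where
  "positive_recurrent M Y \<longleftrightarrow> (\<integral>\<^sup>+\<omega>. ennreal_of_enat (Y 1 \<omega>) \<partial>M) < \<infinity>"

text \<open>
  \<open>L\<close> is the joint law of \<open>(\<Pi>\<^sup>0, (R\<^sup>0\<^sub>i)\<^sub>i\<^sub>\<ge>\<^sub>1)\<close>. Its second marginal is the law of the renewal indicators
  of the zero-delay process with the block lengths of \<open>Y\<close>. That the block length distribution of
  \<open>R\<^sup>0\<close> is that of \<open>Y\<close> follows from the regeneration condition as soon as some \<open>R\<^sub>n\<close>, \<open>n \<ge> 1\<close>, has positive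
  probability of being 1; requiring it also ties \<open>L\<close> to the process if there is no such \<open>n\<close>
  (that is, \<open>T\<^sub>0 = 0\<close> and \<open>Y\<^sub>1 = \<infinity>\<close> almost surely), without excluding any process.
\<close>

definition regenerative ::
  "'a measure \<Rightarrow> ('a \<Rightarrow> int \<Rightarrow> int) \<Rightarrow> (nat \<Rightarrow> 'a \<Rightarrow> enat) \<Rightarrow> ((int \<Rightarrow> int) \<times> (int \<Rightarrow> bool)) measure \<Rightarrow> bool"
where
  "regenerative M X Y L \<longleftrightarrow>
     delayed_renewal M Y \<and>
     random_perm M {1..} X \<and>
     (AE \<omega> in M. \<forall>k n. renewal_time Y k \<omega> = enat n \<longrightarrow> splits_at {1..} (X \<omega>) (int n)) \<and>
     prob_space L \<and>
     sets L = sets (path_space {1..} \<Otimes>\<^sub>M path_space {1..}) \<and>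
     random_perm L {1..} fst \<and>
     distr L (path_space {1..}) snd =
       distr M (path_space {1..}) (\<lambda>\<omega>. \<lambda>i\<in>{1..}. renewal_ind (Y(0 := \<lambda>_. 0)) \<omega> i) \<and>
     (\<forall>n\<ge>1. \<P>(\<omega> in M. renewal_ind Y \<omega> n) > 0 \<longrightarrow>
        distr (given M (\<lambda>\<omega>. renewal_ind Y \<omega> n)) (path_space {1..} \<Otimes>\<^sub>M path_space {1..})
          (\<lambda>\<omega>. (perm_after (X \<omega>) n, ind_after (renewal_ind Y \<omega>) n)) = L \<and>
        prob_space.indep_set (given M (\<lambda>\<omega>. renewal_ind Y \<omega> n))
          (sets (vimage_algebra (space M) (\<lambda>\<omega>. \<lambda>i\<in>{0..n}. renewal_ind Y \<omega> i) (path_space {0..n})))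
          (sets (vimage_algebra (space M)
             (\<lambda>\<omega>. (perm_after (X \<omega>) n, ind_after (renewal_ind Y \<omega>) n))
             (path_space {1..} \<Otimes>\<^sub>M path_space {1..}))))"

definition reduced_block :: "('a \<Rightarrow> int \<Rightarrow> int) \<Rightarrow> (nat \<Rightarrow> 'a \<Rightarrow> enat) \<Rightarrow> nat \<Rightarrow> 'a \<Rightarrow> (int \<Rightarrow> int)" where
  "reduced_block X Y i \<omega> =
     reduced_perm (if i = 0 then 0 else int (the_enat (renewal_time Y (i - 1) \<omega>)))
       (int (the_enat (renewal_time Y i \<omega>))) (X \<omega>)"

text \<open>
  Reduced blocks take countably many values, so conditional laws and conditional independence are
  expressed by the conditional probabilities of single values given the \<open>\<sigma>\<close>-algebra generated by all
  block lengths \<open>T\<^sub>0, Y\<^sub>1, Y\<^sub>2, \<dots>\<close>.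
\<close>

definition governed_by ::
  "'a measure \<Rightarrow> ('a \<Rightarrow> int \<Rightarrow> int) \<Rightarrow> (nat \<Rightarrow> 'a \<Rightarrow> enat) \<Rightarrow> nat pmf \<Rightarrow> (nat \<Rightarrow> (int \<Rightarrow> int) pmf) \<Rightarrow> bool"
where
  "governed_by M X Y p Q \<longleftrightarrow>
     pmf p 0 = 0 \<and>
     (\<forall>n\<ge>1. set_pmf (Q n) \<subseteq> {\<sigma>. \<sigma> permutes {1..int n}}) \<and>
     (\<forall>i\<ge>1. \<forall>n. \<P>(\<omega> in M. Y i \<omega> = enat n) = pmf p n) \<and>
     (let F = vimage_algebra (space M) (\<lambda>\<omega> i. Y i \<omega>) (path_space UNIV) in
       (\<forall>J \<sigma>. finite J \<longrightarrow> (AE \<omega> in M.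
          real_cond_exp M F (indicator {\<omega> \<in> space M. \<forall>i\<in>J. reduced_block X Y i \<omega> = \<sigma> i}) \<omega> =
          (\<Prod>i\<in>J. real_cond_exp M F (indicator {\<omega> \<in> space M. reduced_block X Y i \<omega> = \<sigma> i}) \<omega>))) \<and>
       (\<forall>i\<ge>1. \<forall>\<sigma>. AE \<omega> in M.
          real_cond_exp M F (indicator {\<omega> \<in> space M. reduced_block X Y i \<omega> = \<sigma>}) \<omega> =
          pmf (Q (the_enat (Y i \<omega>))) \<sigma>))"


subsection \<open>Stationary regenerative permutations of the integers\<close>

definition stationary_regenerative ::
  "'b measure \<Rightarrow> ('b \<Rightarrow> int \<Rightarrow> int) \<Rightarrow> ('b \<Rightarrow> int \<Rightarrow> bool) \<Rightarrow> ((int \<Rightarrow> int) \<times> (int \<Rightarrow> bool)) measure \<Rightarrow> bool"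
where
  "stationary_regenerative N X R L \<longleftrightarrow>
     prob_space N \<and>
     random_perm N UNIV X \<and>
     (\<forall>z. (\<lambda>\<omega>. R \<omega> z) \<in> N \<rightarrow>\<^sub>M count_space UNIV) \<and>
     (AE \<omega> in N. \<forall>z. R \<omega> z \<longrightarrow> splits_at UNIV (X \<omega>) z) \<and>
     (\<forall>h. distr N (path_space UNIV) (\<lambda>\<omega> z. (X \<omega> (z + h) - (z + h), R \<omega> (z + h))) =
          distr N (path_space UNIV) (\<lambda>\<omega> z. (X \<omega> z - z, R \<omega> z))) \<and>
     \<P>(\<omega> in N. R \<omega> 0) > 0 \<and>
     (\<forall>z. distr (given N (\<lambda>\<omega>. R \<omega> z)) (path_space {1..} \<Otimes>\<^sub>M path_space {1..})
            (\<lambda>\<omega>. (perm_after (X \<omega>) z, ind_after (R \<omega>) z)) = L)"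

definition stationary_version ::
  "'a measure \<Rightarrow> ('a \<Rightarrow> int \<Rightarrow> int) \<Rightarrow> (nat \<Rightarrow> 'a \<Rightarrow> enat) \<Rightarrow> ((int \<Rightarrow> int) \<times> (int \<Rightarrow> bool)) measure \<Rightarrow> real \<Rightarrow>
   'b measure \<Rightarrow> ('b \<Rightarrow> int \<Rightarrow> int) \<Rightarrow> ('b \<Rightarrow> int \<Rightarrow> bool) \<Rightarrow> bool"
where
  "stationary_version M X Y L \<mu> N X' R' \<longleftrightarrow>
     stationary_regenerative N X' R' L \<and>
     (\<forall>z. \<P>(\<omega> in N. R' \<omega> z) = 1 / \<mu>) \<and>
     (\<forall>z. \<forall>n\<ge>1. \<P>(\<omega> in M. renewal_ind Y \<omega> n) > 0 \<longrightarrow>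
        distr (given N (\<lambda>\<omega>. R' \<omega> z)) (path_space {1..}) (\<lambda>\<omega>. perm_after (X' \<omega>) z) =
        distr (given M (\<lambda>\<omega>. renewal_ind Y \<omega> n)) (path_space {1..}) (\<lambda>\<omega>. perm_after (X \<omega>) n))"

definition enumerates_times :: "(int \<Rightarrow> bool) \<Rightarrow> (int \<Rightarrow> int) \<Rightarrow> bool" where
  "enumerates_times r T \<longleftrightarrow> strict_mono T \<and> range T = {z. r z} \<and> T (-1) < 0 \<and> 0 \<le> T 0"

text \<open>
  There is at most one enumeration, and there is one iff the set of times is unbounded
  in both directions.
\<close>

definition star_time :: "('b \<Rightarrow> int \<Rightarrow> bool) \<Rightarrow> int \<Rightarrow> 'b \<Rightarrow> int" where
  "star_time R z \<omega> = (THE T. enumerates_times (R \<omega>) T) z"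

definition star_length :: "('b \<Rightarrow> int \<Rightarrow> bool) \<Rightarrow> int \<Rightarrow> 'b \<Rightarrow> int" where
  "star_length R z \<omega> = star_time R z \<omega> - star_time R (z - 1) \<omega>"

definition star_block :: "('b \<Rightarrow> int \<Rightarrow> int) \<Rightarrow> ('b \<Rightarrow> int \<Rightarrow> bool) \<Rightarrow> int \<Rightarrow> 'b \<Rightarrow> (int \<Rightarrow> int)" where
  "star_block X R i \<omega> = reduced_perm (star_time R (i - 1) \<omega>) (star_time R i \<omega>) (X \<omega>)"

definition lengths_algebra :: "'b measure \<Rightarrow> ('b \<Rightarrow> int \<Rightarrow> bool) \<Rightarrow> 'b measure" where
  "lengths_algebra N R = vimage_algebra (space N) (\<lambda>\<omega> z. star_length R z \<omega>) (path_space UNIV)"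

definition lengths_delay_algebra :: "'b measure \<Rightarrow> ('b \<Rightarrow> int \<Rightarrow> bool) \<Rightarrow> 'b measure" where
  "lengths_delay_algebra N R =
     vimage_algebra (space N) (\<lambda>\<omega>. (\<lambda>z. star_length R z \<omega>, star_time R 0 \<omega>))
       (path_space UNIV \<Otimes>\<^sub>M count_space UNIV)"

end

theory Submission
  imports Defs
begin

text \<open>
  Let \<open>L\<close> be the joint law of the future permutation and the future renewal indicators after a renewal,
  and let \<open>\<tau>\<close> be the first renewal time under \<open>L\<close>. The regeneration property passes to \<open>L\<close>: the
  future after \<open>\<tau>\<close> is independent of \<open>\<tau>\<close> and has law \<open>L\<close> (lemma \<open>regeneration_L\<close>). Moreover \<open>\<tau>\<close> has the law of
  the block length \<open>Y\<^sub>1\<close>, so that the mean of \<open>Y\<^sub>1\<close> is the sum over \<open>k\<close> of the probabilities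
  of \<open>\<tau> > k\<close> (lemma \<open>suminf_no_renewal\<close>).

  Consider a stationary process such that given a renewal at \<open>z\<close>, which has probability \<open>c\<close>, the future after \<open>z\<close>
  has law \<open>L\<close>. The last renewal up to time \<open>z\<close> is at \<open>z - k\<close> and the future after \<open>z\<close> lies in \<open>A\<close> with
  probability \<open>c\<close> times the probability under \<open>L\<close> that \<open>\<tau> > k\<close> and that the future after \<open>k\<close> lies in \<open>A\<close> (lemma
  \<open>last_renewal_law\<close>). These events are disjoint for different \<open>k\<close>; hence \<open>c\<close> times the mean
  of \<open>\<tau>\<close> is at most 1, which is the converse. If \<open>c = 1 / \<mu>\<close>, these events exhaust the space, and
  the law of the future after \<open>z\<close> is a measure \<open>stationary_future\<close> defined from \<open>L\<close>
  alone. As \<open>z\<close> tends to \<open>-\<infinity>\<close> this proves uniqueness.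

  For existence, \<open>stationary_future\<close> is invariant under the shift (lemma \<open>distr_stationary_future\<close>), so by Kolmogorov's
  extension theorem it is the law of the futures of a two-sided stationary process (lemma
  \<open>two_sided_extension\<close>), which satisfies the Palm formula with rate \<open>1 / \<mu>\<close>. It is a permutation of the integers
  since it maps \<open>(z, \<infinity>)\<close> onto itself for each renewal \<open>z\<close> and there are renewals arbitrarily far to the left.

  Finally, fix a delay \<open>t\<close> and lengths \<open>y\<^sub>i\<close> for the blocks from \<open>-m\<close> to \<open>m\<close>, with \<open>0 \<le> t < y\<^sub>0\<close>. The
  event that these occur says that there is a renewal at a certain time \<open>s\<close> and that the next gaps have these
  lengths, so it has probability \<open>1 / \<mu>\<close> times the product of the \<open>p\<close>-weights of the \<open>y\<^sub>i\<close>. Prescribing in addition one reduced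
  block multiplies this by the corresponding weight of \<open>Q\<close> (lemmas \<open>prob_window\<close> and
  \<open>prob_window_block\<close>). All the laws in the second part are read off from these formulas.
\<close>

section \<open>Generalities on measures on path spaces\<close>

lemma space_path_space_UNIV [simp]: "space (path_space UNIV) = UNIV"
  by (simp add: space_PiM PiE_UNIV_domain)

text \<open>
  Suppose that the elements of \<open>K\<close> can be encoded (by \<open>h\<close>, decoded by \<open>g\<close>) as paths with
  countably many values. A finite measure on \<open>K\<close> is then determined by the masses of the cylinders
  that fix the values of the path at all the times of a finite set, for sufficiently large finite sets of times.
\<close>

lemma measure_eqI_cylinders:
  fixes h :: "'k \<Rightarrow> 'i \<Rightarrow> 'v::countable"
  assumes P: "sets P = sets K" "finite_measure P" and Q: "sets Q = sets K"
    and h: "h \<in> K \<rightarrow>\<^sub>M path_space I" and g: "g \<in> path_space I \<rightarrow>\<^sub>M K"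
    and gh: "\<And>x. x \<in> space K \<Longrightarrow> g (h x) = x"
    and cyl: "\<And>J. finite J \<Longrightarrow> J \<subseteq> I \<Longrightarrow> \<exists>J'. finite J' \<and> J \<subseteq> J' \<and> J' \<subseteq> I \<and>
      (\<forall>y. emeasure P {x \<in> space K. \<forall>i\<in>J'. h x i = y i} = emeasure Q {x \<in> space K. \<forall>i\<in>J'. h x i = y i})"
  shows "P = Q"
proof -
  have spP: "space P = space K" and spQ: "space Q = space K"
    using P Q by (auto dest: sets_eq_imp_space_eq)
  have hP[measurable]: "h \<in> P \<rightarrow>\<^sub>M path_space I" and hQ[measurable]: "h \<in> Q \<rightarrow>\<^sub>M path_space I"
    using h P(1) Q by (auto cong: measurable_cong_sets)
  note h[measurable]
  have "distr P (path_space I) h = distr Q (path_space I) h"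
  proof (rule measure_eqI_PiM_infinite)
    fix A :: "'i \<Rightarrow> 'v set" and J assume J: "finite J" "J \<subseteq> I"
    obtain J' where J': "finite J'" "J \<subseteq> J'" "J' \<subseteq> I"
      and eq: "\<And>y. emeasure P {x \<in> space K. \<forall>i\<in>J'. h x i = y i} = emeasure Q {x \<in> space K. \<forall>i\<in>J'. h x i = y i}"
      using cyl[OF J] by blast
    let ?c = "\<lambda>v. {x \<in> space K. \<forall>i\<in>J'. h x i = v i}"
    \<comment> \<open>The cylinder over \<open>J\<close> is a countable disjoint union of cylinders that fix all values on \<open>J'\<close>.\<close>
    define B where "B = {v \<in> PiE J' (\<lambda>_. UNIV::'v set). \<forall>i\<in>J. v i \<in> A i}"
    have cB: "countable B"
      unfolding B_def by (rule countable_subset[OF _ countable_PiE[OF J'(1)]]) auto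
    have "h -` prod_emb I (\<lambda>_. count_space UNIV) J (PiE J A) \<inter> space K = (\<Union>v\<in>B. ?c v)"
    proof (intro equalityI subsetI)
      fix x assume "x \<in> h -` prod_emb I (\<lambda>_. count_space UNIV) J (PiE J A) \<inter> space K"
      then have x: "x \<in> space K" "h x \<in> prod_emb I (\<lambda>_. count_space UNIV) J (PiE J A)" by auto
      have "restrict (h x) J' \<in> B" "x \<in> ?c (restrict (h x) J')"
        using x J' by (auto simp: B_def prod_emb_def PiE_iff)
      then show "x \<in> (\<Union>v\<in>B. ?c v)" by blast
    next
      fix x assume "x \<in> (\<Union>v\<in>B. ?c v)"
      then obtain v where v: "v \<in> B" and x: "x \<in> space K" "\<forall>i\<in>J'. h x i = v i" by blast
      have "h x \<in> space (path_space I)" using measurable_space[OF h x(1)] .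
      then show "x \<in> h -` prod_emb I (\<lambda>_. count_space UNIV) J (PiE J A) \<inter> space K"
        using x v J J' by (auto simp: B_def prod_emb_def space_PiM PiE_def Pi_def subset_iff)
    qed
    moreover have "?c v \<in> sets K" for v
    proof -
      have "(\<lambda>x. h x i) \<in> K \<rightarrow>\<^sub>M count_space UNIV" if "i \<in> J'" for i
        using that J' by (intro measurable_compose[OF h measurable_component_singleton]) auto
      then show ?thesis using J'(1) by measurable
    qed
    moreover have "disjoint_family_on ?c B"
    proof -
      have "v = w" if "v \<in> B" "w \<in> B" "\<forall>i\<in>J'. h x i = v i" "\<forall>i\<in>J'. h x i = w i" for v w x
        using that by (auto simp: B_def intro!: PiE_ext[of v J' "\<lambda>_. UNIV" w])
      then show ?thesis unfolding disjoint_family_on_def by blast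
    qed
    ultimately have *: "emeasure R (h -` prod_emb I (\<lambda>_. count_space UNIV) J (PiE J A) \<inter> space K)
        = (\<integral>\<^sup>+v. emeasure R (?c v) \<partial>count_space B)" if "sets R = sets K" for R
      using that cB by (simp add: emeasure_UN_countable)
    have s: "prod_emb I (\<lambda>_. count_space UNIV) J (PiE J A) \<in> sets (path_space I)"
      using J by (intro sets_PiM_I) auto
    show "emeasure (distr P (path_space I) h) (prod_emb I (\<lambda>_. count_space UNIV) J (PiE J A))
        = emeasure (distr Q (path_space I) h) (prod_emb I (\<lambda>_. count_space UNIV) J (PiE J A))"
      by (simp add: emeasure_distr[OF hP s] emeasure_distr[OF hQ s] spP spQ * P Q eq)
  qed (use P in \<open>auto intro!: finite_measure.finite_measure_distr\<close>)
  then have "distr (distr P (path_space I) h) K g = distr (distr Q (path_space I) h) K g" by simp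
  then have "distr P K (g \<circ> h) = distr Q K (g \<circ> h)"
    by (simp add: distr_distr[OF g hP] distr_distr[OF g hQ])
  moreover have "distr R K (g \<circ> h) = R" if "sets R = sets K" for R
  proof -
    have "distr R K (g \<circ> h) = distr R R (\<lambda>x. x)"
      using that by (intro distr_cong) (auto simp: gh dest: sets_eq_imp_space_eq)
    then show ?thesis by (simp add: distr_id)
  qed
  ultimately show ?thesis using P Q by simp
qed

text \<open>The case of pairs of paths, which are encoded as single paths of pairs.\<close>

lemma measure_eqI_pair_cylinders:
  fixes P :: "(('i \<Rightarrow> 'v::countable) \<times> ('i \<Rightarrow> 'w::countable)) measure" and I :: "'i set"
  defines "K \<equiv> path_space I \<Otimes>\<^sub>M path_space I"
  assumes "sets P = sets K" "finite_measure P" "sets Q = sets K"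
    and cyl: "\<And>J. finite J \<Longrightarrow> J \<subseteq> I \<Longrightarrow> \<exists>J'. finite J' \<and> J \<subseteq> J' \<and> J' \<subseteq> I \<and>
      (\<forall>a b. emeasure P {w \<in> space K. \<forall>i\<in>J'. fst w i = a i \<and> snd w i = b i} =
             emeasure Q {w \<in> space K. \<forall>i\<in>J'. fst w i = a i \<and> snd w i = b i})"
  shows "P = Q"
proof (rule measure_eqI_cylinders[where K = K and I = I
      and h = "\<lambda>w. \<lambda>i\<in>I. (fst w i, snd w i)" and g = "\<lambda>v. (\<lambda>i\<in>I. fst (v i), \<lambda>i\<in>I. snd (v i))"])
  show "(\<lambda>w. \<lambda>i\<in>I. (fst w i, snd w i)) \<in> K \<rightarrow>\<^sub>M path_space I"
    unfolding K_def
  proof (rule measurable_restrict)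
    fix i assume "i \<in> I"
    then have [measurable]: "(\<lambda>w. fst w i) \<in> path_space I \<Otimes>\<^sub>M path_space I \<rightarrow>\<^sub>M count_space UNIV" 
      "(\<lambda>w. snd w i) \<in> path_space I \<Otimes>\<^sub>M path_space I \<rightarrow>\<^sub>M count_space UNIV" by measurable
    show "(\<lambda>w. (fst w i, snd w i)) \<in> path_space I \<Otimes>\<^sub>M path_space I \<rightarrow>\<^sub>M count_space (UNIV::('v\<times>'w) set)"
      by (rule measurable_compose_countable[where f="\<lambda>a w. (a, snd w i)" and g="\<lambda>w. fst w i"]) measurable
  qed
  show "(\<lambda>v. (\<lambda>i\<in>I. fst (v i), \<lambda>i\<in>I. snd (v i))) \<in> path_space I \<rightarrow>\<^sub>M K"
    unfolding K_def
    by (intro measurable_Pair measurable_restrict measurable_compose[OF measurable_component_singleton]) auto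
  show "(\<lambda>i\<in>I. fst ((\<lambda>i\<in>I. (fst x i, snd x i)) i), \<lambda>i\<in>I. snd ((\<lambda>i\<in>I. (fst x i, snd x i)) i)) = x"
    if "x \<in> space K" for x
    using that by (cases x) (auto simp: K_def space_pair_measure space_PiM PiE_def extensional_def fun_eq_iff)
next
  fix J assume "finite J" "J \<subseteq> I"
  from cyl[OF this] obtain J' where J': "finite J'" "J \<subseteq> J'" "J' \<subseteq> I" and
    eq: "\<And>a b. emeasure P {w \<in> space K. \<forall>i\<in>J'. fst w i = a i \<and> snd w i = b i} =
             emeasure Q {w \<in> space K. \<forall>i\<in>J'. fst w i = a i \<and> snd w i = b i}" by blast
  have "{x \<in> space K. \<forall>i\<in>J'. (\<lambda>i\<in>I. (fst x i, snd x i)) i = y i} =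
      {w \<in> space K. \<forall>i\<in>J'. fst w i = fst (y i) \<and> snd w i = snd (y i)}" for y
    using J' by (auto simp: prod_eq_iff subset_iff)
  then show "\<exists>J'. finite J' \<and> J \<subseteq> J' \<and> J' \<subseteq> I \<and>
      (\<forall>y. emeasure P {x \<in> space K. \<forall>i\<in>J'. (\<lambda>i\<in>I. (fst x i, snd x i)) i = y i} =
           emeasure Q {x \<in> space K. \<forall>i\<in>J'. (\<lambda>i\<in>I. (fst x i, snd x i)) i = y i})"
    using J' eq by (intro exI[of _ J']) simp
qed (use assms in auto)

section \<open>Gaps between renewals\<close>

text \<open>
  The permutation \<open>\<pi>\<close> and the renewal indicators \<open>r\<close> after time \<open>z\<close>, both shifted back by \<open>z\<close>. Such
  futures are points of \<open>half_paths\<close>: pairs of paths on the positive integers.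
\<close>

abbreviation future :: "(int \<Rightarrow> int) \<Rightarrow> (int \<Rightarrow> bool) \<Rightarrow> int \<Rightarrow> (int \<Rightarrow> int) \<times> (int \<Rightarrow> bool)" where
  "future \<pi> r z \<equiv> (perm_after \<pi> z, ind_after r z)"

abbreviation half_paths :: "((int \<Rightarrow> int) \<times> (int \<Rightarrow> bool)) measure" where
  "half_paths \<equiv> path_space {1..} \<Otimes>\<^sub>M path_space {1..}"

text \<open>No renewal at the times \<open>1, \<dots>, k\<close>: the first renewal comes later than \<open>k\<close>.\<close>

definition no_renewal :: "(int \<Rightarrow> bool) \<Rightarrow> nat \<Rightarrow> bool" where
  "no_renewal r k \<longleftrightarrow> (\<forall>x\<in>{1..int k}. \<not> r x)"

text \<open>
  Counting from a renewal at time 0, the first \<open>n\<close> gaps between renewals are \<open>y 0, \<dots>, y (n - 1)\<close>.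
  Only the indicators at the positive times up to the sum of these gaps are inspected.
\<close>

definition gaps :: "(int \<Rightarrow> bool) \<Rightarrow> nat \<Rightarrow> (nat \<Rightarrow> int) \<Rightarrow> bool" where
  "gaps r n y \<longleftrightarrow> (\<forall>x\<in>{1..\<Sum>i<n. y i}. r x \<longleftrightarrow> (\<exists>j\<in>{1..n}. x = (\<Sum>i<j. y i)))"

lemma perm_after_perm_after: "0 \<le> b \<Longrightarrow> perm_after (perm_after \<pi> a) b = perm_after \<pi> (a + b)"
  by (auto simp: perm_after_def fun_eq_iff algebra_simps)

lemma ind_after_ind_after: "0 \<le> b \<Longrightarrow> ind_after (ind_after r a) b = ind_after r (a + b)"
  by (auto simp: ind_after_def fun_eq_iff algebra_simps)

lemma ind_after_apply: "1 \<le> i \<Longrightarrow> ind_after r z i = r (z + i)"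
  by (simp add: ind_after_def)

lemma future_zero: "w \<in> space half_paths \<Longrightarrow> future (fst w) (snd w) 0 = w"
  by (cases w) (auto simp: space_pair_measure space_PiM PiE_def perm_after_def ind_after_def extensional_def fun_eq_iff)

lemma no_renewal_0 [simp]: "no_renewal r 0"
  by (simp add: no_renewal_def)

lemma no_renewal_Suc: "no_renewal r (Suc k) \<longleftrightarrow> no_renewal r k \<and> \<not> r (int (Suc k))"
proof -
  have "{1..int (Suc k)} = insert (int (Suc k)) {1..int k}" by auto
  then show ?thesis unfolding no_renewal_def by auto
qed

lemma no_renewal_ind_after: "no_renewal (ind_after r z) k \<longleftrightarrow> (\<forall>x\<in>{z<..z + int k}. \<not> r x)"
proof -
  have "(\<lambda>x. z + x) ` {1..int k} = {z<..z + int k}"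
    by (auto simp: image_iff intro!: bexI[of _ "_ - z"])
  then have "(\<forall>x\<in>{z<..z + int k}. \<not> r x) \<longleftrightarrow> (\<forall>x\<in>{1..int k}. \<not> r (z + x))"
    by (metis (no_types, lifting) image_iff)
  then show ?thesis by (simp add: no_renewal_def ind_after_def)
qed

lemma measurable_future:
  assumes "\<And>x. z < x \<Longrightarrow> (\<lambda>\<omega>. X \<omega> x) \<in> N \<rightarrow>\<^sub>M count_space UNIV"
    and "\<And>x. z < x \<Longrightarrow> (\<lambda>\<omega>. R \<omega> x) \<in> N \<rightarrow>\<^sub>M count_space UNIV"
  shows "(\<lambda>\<omega>. future (X \<omega>) (R \<omega>) z) \<in> N \<rightarrow>\<^sub>M half_paths"
proof (rule measurable_Pair)
  show "(\<lambda>\<omega>. perm_after (X \<omega>) z) \<in> N \<rightarrow>\<^sub>M path_space {1..}"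
    unfolding perm_after_def
  proof (rule measurable_restrict)
    fix i :: int assume "i \<in> {1..}"
    then have "(\<lambda>\<omega>. X \<omega> (z + i)) \<in> N \<rightarrow>\<^sub>M count_space UNIV" by (intro assms) auto
    then show "(\<lambda>\<omega>. X \<omega> (z + i) - z) \<in> N \<rightarrow>\<^sub>M count_space UNIV" by measurable
  qed
  show "(\<lambda>\<omega>. ind_after (R \<omega>) z) \<in> N \<rightarrow>\<^sub>M path_space {1..}"
    unfolding ind_after_def by (rule measurable_restrict) (auto intro: assms)
qed

lemma measurable_half_paths_component [measurable]:
  assumes "1 \<le> i"
  shows "(\<lambda>w. fst w i) \<in> half_paths \<rightarrow>\<^sub>M count_space UNIV" "(\<lambda>w. snd w i) \<in> half_paths \<rightarrow>\<^sub>M count_space UNIV"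
proof -
  have i: "i \<in> {1..}" using assms by simp
  show "(\<lambda>w. fst w i) \<in> half_paths \<rightarrow>\<^sub>M count_space UNIV"
    by (rule measurable_compose[OF measurable_fst measurable_component_singleton[OF i]])
  show "(\<lambda>w. snd w i) \<in> half_paths \<rightarrow>\<^sub>M count_space UNIV"
    by (rule measurable_compose[OF measurable_snd measurable_component_singleton[OF i]])
qed

lemma measurable_future_half_paths:
  "0 \<le> k \<Longrightarrow> (\<lambda>w. future (fst w) (snd w) k) \<in> half_paths \<rightarrow>\<^sub>M half_paths"
  by (rule measurable_future) (auto intro: measurable_half_paths_component)

lemma pred_no_renewal [measurable]: "Measurable.pred half_paths (\<lambda>w. no_renewal (snd w) k)"
  unfolding no_renewal_def
  by (intro pred_intros_finite(3)) (auto intro!: pred_intros_logic measurable_half_paths_component(2))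

lemma pred_gaps [measurable]: "Measurable.pred half_paths (\<lambda>w. gaps (snd w) n y)"
  unfolding gaps_def
  by (intro pred_intros_finite(3) pred_intros_logic) (auto intro!: measurable_half_paths_component(2))

lemma partial_sums_strict_mono:
  fixes y :: "nat \<Rightarrow> int"
  assumes "\<forall>i<n. 1 \<le> y i" "j < k" "k \<le> n"
  shows "(\<Sum>i<j. y i) < (\<Sum>i<k. y i)"
proof -
  have "(\<Sum>i<k. y i) = (\<Sum>i<j. y i) + (\<Sum>i=j..<k. y i)"
    using assms by (metis lessThan_atLeast0 less_imp_le_nat sum.atLeastLessThan_concat zero_le)
  moreover have "0 < (\<Sum>i=j..<k. y i)"
    using assms by (intro sum_pos) (auto intro: less_le_trans[of 0 1])
  ultimately show ?thesis by simp
qed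

text \<open>If \<open>T\<close> enumerates the renewals from time \<open>T 0\<close> on, the gaps are the increments of \<open>T\<close>.\<close>

lemma gaps_iff:
  fixes T :: "nat \<Rightarrow> int"
  assumes T: "strict_mono T" and r: "\<And>x. T 0 < x \<Longrightarrow> r x \<longleftrightarrow> x \<in> range T"
    and y: "\<forall>i<n. 1 \<le> y i"
  shows "gaps (ind_after r (T 0)) n y \<longleftrightarrow> (\<forall>i<n. T (Suc i) - T i = y i)"
    (is "?L \<longleftrightarrow> ?R")
proof
  let ?s = "\<lambda>j. \<Sum>i<j. y i"
  have pos: "0 < ?s j" if "1 \<le> j" "j \<le> n" for j
    using partial_sums_strict_mono[OF y, of 0 j] that by simp
  have le: "?s j \<le> ?s n" if "j \<le> n" for j
    using partial_sums_strict_mono[OF y, of j n] that by (cases "j = n") auto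
  { assume ?R
    then have Tj: "T j = T 0 + ?s j" if "j \<le> n" for j
      using that
    proof (induction j)
      case (Suc j)
      then have "T j = T 0 + ?s j" by simp
      moreover have "T (Suc j) - T j = y j" using \<open>?R\<close> Suc.prems by simp
      ultimately have "T (Suc j) = (T 0 + ?s j) + y j" by linarith
      then show ?case by simp
    qed simp
    show ?L unfolding gaps_def
    proof
      fix x assume x: "x \<in> {1..?s n}"
      have "r (T 0 + x) \<longleftrightarrow> (\<exists>j\<in>{1..n}. x = ?s j)"
      proof
        assume "r (T 0 + x)"
        then obtain j where j: "T 0 + x = T j" using r[of "T 0 + x"] x by auto
        then have "T 0 < T j" "T j \<le> T n" using x Tj[of n] by auto
        then have "0 < j" "j \<le> n" using T by (simp_all add: strict_mono_less strict_mono_less_eq)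
        then show "\<exists>j\<in>{1..n}. x = ?s j" using Tj[of j] j by (intro bexI[of _ j]) auto
      next
        assume "\<exists>j\<in>{1..n}. x = ?s j"
        then obtain j where "j \<in> {1..n}" "x = ?s j" by blast
        then have "T 0 + x = T j" using Tj[of j] by simp
        then show "r (T 0 + x)" using r[of "T 0 + x"] x by auto
      qed
      then show "ind_after r (T 0) x \<longleftrightarrow> (\<exists>j\<in>{1..n}. x = ?s j)"
        using x by (auto simp: ind_after_def)
    qed }
  assume L: ?L
  have L': "r (T 0 + x) \<longleftrightarrow> (\<exists>j\<in>{1..n}. x = ?s j)" if "1 \<le> x" "x \<le> ?s n" for x
    using L that by (auto simp: gaps_def ind_after_def)
  have Tj: "T j = T 0 + ?s j" if "j \<le> n" for j
    using that
  proof (induction j)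
    case (Suc j)
    then have IH: "T j = T 0 + ?s j" by simp
    have "r (T 0 + ?s (Suc j))"
      using L'[of "?s (Suc j)"] pos[of "Suc j"] le[of "Suc j"] Suc.prems
      by (metis One_nat_def atLeastAtMost_iff int_one_le_iff_zero_less le_add1 plus_1_eq_Suc)
    then obtain k where k: "T 0 + ?s (Suc j) = T k"
      using r[of "T 0 + ?s (Suc j)"] pos[of "Suc j"] Suc.prems by auto
    have "T j < T k"
      using k IH partial_sums_strict_mono[OF y, of j "Suc j"] Suc.prems by simp
    then have "Suc j \<le> k" using T by (simp add: strict_mono_less)
    then have up: "T (Suc j) \<le> T 0 + ?s (Suc j)" using T k by (simp add: strict_mono_less_eq)
    have lo: "T j < T (Suc j)" "T 0 < T (Suc j)" using T by (simp_all add: strict_mono_less)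
    have "r (T 0 + (T (Suc j) - T 0))" using r[of "T (Suc j)"] lo by auto
    then obtain l where l: "l \<in> {1..n}" "T (Suc j) - T 0 = ?s l"
      using L'[of "T (Suc j) - T 0"] lo up le[of "Suc j"] Suc.prems by auto
    have "\<not> l \<le> j"
    proof
      assume "l \<le> j"
      then have "?s l \<le> ?s j"
        using partial_sums_strict_mono[OF y, of l j] Suc.prems by (cases "l = j") auto
      with l lo IH show False by simp
    qed
    then have "?s (Suc j) \<le> ?s l"
      using partial_sums_strict_mono[OF y, of "Suc j" l] l by (cases "l = Suc j") auto
    with l up show ?case by simp
  qed simp
  show ?R
  proof (intro allI impI)
    fix i assume "i < n"
    then show "T (Suc i) - T i = y i" using Tj[of i] Tj[of "Suc i"] by simp
  qed
qed

lemma pred_reduced_perm: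
  assumes "\<And>x. a < x \<Longrightarrow> (\<lambda>\<omega>. X \<omega> x) \<in> N \<rightarrow>\<^sub>M count_space UNIV"
  shows "Measurable.pred N (\<lambda>\<omega>. reduced_perm a b (X \<omega>) = \<sigma>)"
proof -
  have "(reduced_perm a b \<pi> = \<sigma>) \<longleftrightarrow> (\<forall>i\<in>{1..b - a}. \<pi> (a + i) = \<sigma> i + a) \<and> (\<forall>i. i \<notin> {1..b - a} \<longrightarrow> \<sigma> i = i)" for \<pi>
    by (auto simp: reduced_perm_def fun_eq_iff algebra_simps)
  moreover have [measurable]: "(\<lambda>\<omega>. X \<omega> (a + i)) \<in> N \<rightarrow>\<^sub>M count_space UNIV" if "i \<in> {1..b - a}" for i
    using that by (intro assms) auto
  ultimately show ?thesis by simp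
qed

lemma reduced_perm_perm_after:
  "0 \<le> a \<Longrightarrow> reduced_perm a b (perm_after \<pi> n) = reduced_perm (n + a) (n + b) \<pi>"
  by (auto simp: reduced_perm_def perm_after_def fun_eq_iff algebra_simps)

section \<open>Renewal times of a delayed renewal process\<close>

lemma renewal_time_Suc: "renewal_time Y (Suc k) \<omega> = renewal_time Y k \<omega> + Y (Suc k) \<omega>"
  by (simp add: renewal_time_def)

lemma measurable_renewal_time:
  assumes [measurable]: "\<And>i. Y i \<in> N \<rightarrow>\<^sub>M count_space UNIV"
  shows "renewal_time Y k \<in> N \<rightarrow>\<^sub>M count_space UNIV"
proof (induction k)
  case 0
  have "renewal_time Y 0 = Y 0" by (simp add: renewal_time_def fun_eq_iff)
  then show ?case by simp
next
  case (Suc k)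
  note [measurable] = Suc
  have "renewal_time Y (Suc k) = (\<lambda>\<omega>. renewal_time Y k \<omega> + Y (Suc k) \<omega>)"
    by (simp add: renewal_time_Suc fun_eq_iff)
  then show ?case by simp
qed

text \<open>
  The renewal times as integers. This is meaningful only if they are finite; an infinite renewal
  time is sent to an unspecified value.
\<close>

definition int_time :: "(nat \<Rightarrow> 'a \<Rightarrow> enat) \<Rightarrow> 'a \<Rightarrow> nat \<Rightarrow> int" where
  "int_time Y \<omega> k = int (the_enat (renewal_time Y k \<omega>))"

lemma int_time_nonneg: "0 \<le> int_time Y \<omega> k"
  by (simp add: int_time_def)

text \<open>The delay and the block lengths are finite, and the block lengths are positive.\<close>

definition finite_lengths :: "(nat \<Rightarrow> 'a \<Rightarrow> enat) \<Rightarrow> 'a \<Rightarrow> bool" where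
  "finite_lengths Y \<omega> \<longleftrightarrow> (\<forall>i. Y i \<omega> \<noteq> \<infinity>) \<and> (\<forall>i\<ge>1. 1 \<le> Y i \<omega>)"

context
  fixes Y :: "nat \<Rightarrow> 'a \<Rightarrow> enat" and \<omega> :: 'a
  assumes fl: "finite_lengths Y \<omega>"
begin

lemma renewal_time_finite: "renewal_time Y k \<omega> = enat (nat (int_time Y \<omega> k))"
proof -
  have "renewal_time Y k \<omega> \<noteq> \<infinity>"
    using fl by (induction k) (auto simp: finite_lengths_def renewal_time_def plus_eq_infty_iff_enat)
  then show ?thesis by (auto simp: int_time_def)
qed

lemma int_time_Suc: "int_time Y \<omega> (Suc k) = int_time Y \<omega> k + int (the_enat (Y (Suc k) \<omega>))"
proof -
  obtain a where a: "Y (Suc k) \<omega> = enat a" using fl by (auto simp: finite_lengths_def)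
  obtain b where b: "renewal_time Y k \<omega> = enat b" using renewal_time_finite[of k] by blast
  show ?thesis unfolding int_time_def renewal_time_Suc a b by simp
qed

lemma strict_mono_int_time: "strict_mono (int_time Y \<omega>)"
proof (rule strict_mono_Suc_iff[THEN iffD2], rule allI)
  fix k
  have "1 \<le> Y (Suc k) \<omega>" "Y (Suc k) \<omega> \<noteq> \<infinity>" using fl by (auto simp: finite_lengths_def)
  then have "1 \<le> the_enat (Y (Suc k) \<omega>)" by (auto simp: one_enat_def)
  then show "int_time Y \<omega> k < int_time Y \<omega> (Suc k)" by (simp add: int_time_Suc)
qed

lemma renewal_ind_iff: "renewal_ind Y \<omega> x \<longleftrightarrow> x \<in> range (int_time Y \<omega>)"
proof
  assume "renewal_ind Y \<omega> x"
  then obtain k where "0 \<le> x" "renewal_time Y k \<omega> = enat (nat x)" by (auto simp: renewal_ind_def)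
  then have "x = int_time Y \<omega> k" by (simp add: int_time_def)
  then show "x \<in> range (int_time Y \<omega>)" by blast
next
  assume "x \<in> range (int_time Y \<omega>)"
  then obtain k where "x = int_time Y \<omega> k" by blast
  then show "renewal_ind Y \<omega> x"
    unfolding renewal_ind_def using renewal_time_finite[of k] int_time_nonneg[of Y \<omega> k] by blast
qed

lemma gaps_after_int_time:
  assumes y: "\<forall>i<n. 1 \<le> y i"
  shows "gaps (ind_after (renewal_ind Y \<omega>) (int_time Y \<omega> k)) n y \<longleftrightarrow>
    (\<forall>i<n. Y (Suc (k + i)) \<omega> = enat (nat (y i)))"
proof -
  let ?T = "\<lambda>j. int_time Y \<omega> (k + j)"
  have T: "strict_mono ?T"
    using strict_mono_int_time by (simp add: strict_mono_def)
  have r: "renewal_ind Y \<omega> x \<longleftrightarrow> x \<in> range ?T" if "?T 0 < x" for x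
  proof
    assume "renewal_ind Y \<omega> x"
    then obtain l where l: "x = int_time Y \<omega> l" by (auto simp: renewal_ind_iff)
    then have "k < l" using that strict_mono_int_time by (simp add: strict_mono_less)
    then have "x = ?T (l - k)" using l by simp
    then show "x \<in> range ?T" by blast
  qed (auto simp: renewal_ind_iff)
  have "(?T (Suc i) - ?T i = y i) \<longleftrightarrow> Y (Suc (k + i)) \<omega> = enat (nat (y i))" if "i < n" for i
  proof -
    obtain a where "Y (Suc (k + i)) \<omega> = enat a" using fl by (auto simp: finite_lengths_def)
    moreover have "1 \<le> y i" using y that by simp
    ultimately show ?thesis by (auto simp: int_time_Suc)
  qed
  then show ?thesis
    using gaps_iff[OF T r y] by simp
qed

end

section \<open>The law of the future after a renewal\<close>

text \<open>A regenerative permutation of the positive integers and the joint law \<open>L\<close> of its future after a renewal.\<close>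

locale regenerative_perm =
  fixes M :: "'a measure" and X :: "'a \<Rightarrow> int \<Rightarrow> int" and Y :: "nat \<Rightarrow> 'a \<Rightarrow> enat"
    and L :: "((int \<Rightarrow> int) \<times> (int \<Rightarrow> bool)) measure"
  assumes reg: "regenerative M X Y L"
begin

sublocale M: prob_space M
  using reg by (auto simp: regenerative_def delayed_renewal_def)

sublocale L: prob_space L
  using reg by (auto simp: regenerative_def)

lemma indep_Y: "M.indep_vars (\<lambda>_. count_space UNIV) Y UNIV"
  using reg by (auto simp: regenerative_def delayed_renewal_def)

lemma sets_L [measurable_cong]: "sets L = sets half_paths"
  using reg by (auto simp: regenerative_def)

lemma space_L: "space L = space half_paths"
  using sets_L by (rule sets_eq_imp_space_eq)

lemma measurable_Y [measurable]: "Y i \<in> M \<rightarrow>\<^sub>M count_space UNIV"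
  using indep_Y by (auto simp: M.indep_vars_def)

lemma measurable_X: "1 \<le> i \<Longrightarrow> (\<lambda>\<omega>. X \<omega> i) \<in> M \<rightarrow>\<^sub>M count_space UNIV"
  using reg by (auto simp: regenerative_def random_perm_def)

declare measurable_renewal_time[OF measurable_Y, measurable]

lemma pred_renewal_ind [measurable]: "Measurable.pred M (\<lambda>\<omega>. renewal_ind Y \<omega> x)"
  unfolding renewal_ind_def by measurable

lemma measurable_future_X: "0 \<le> n \<Longrightarrow> (\<lambda>\<omega>. future (X \<omega>) (renewal_ind Y \<omega>) n) \<in> M \<rightarrow>\<^sub>M half_paths"
  by (intro measurable_future measurable_X pred_renewal_ind) auto

lemma AE_bij_L: "AE w in L. bij_betw (fst w) {1..} {1..}"
  using reg by (auto simp: regenerative_def random_perm_def)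

lemma AE_Y_ge_1: "AE \<omega> in M. \<forall>i\<ge>1. 1 \<le> Y i \<omega>"
  using reg by (auto simp: regenerative_def delayed_renewal_def AE_all_countable)

lemma law_indicators:
  "distr L (path_space {1..}) snd =
    distr M (path_space {1..}) (\<lambda>\<omega>. \<lambda>i\<in>{1..}. renewal_ind (Y(0 := \<lambda>_. 0)) \<omega> i)"
  using reg by (auto simp: regenerative_def)

lemma law_future:
  assumes n: "1 \<le> n" "0 < \<P>(\<omega> in M. renewal_ind Y \<omega> n)" and A: "A \<in> sets half_paths"
  shows "\<P>(\<omega> in M. renewal_ind Y \<omega> n \<and> future (X \<omega>) (renewal_ind Y \<omega>) n \<in> A) =
    \<P>(\<omega> in M. renewal_ind Y \<omega> n) * measure L A"
proof -
  let ?R = "{\<omega> \<in> space M. renewal_ind Y \<omega> n}"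
  let ?f = "\<lambda>\<omega>. future (X \<omega>) (renewal_ind Y \<omega>) n"
  have f[measurable]: "?f \<in> M \<rightarrow>\<^sub>M half_paths" using measurable_future_X[of n] n by simp
  have f': "?f \<in> uniform_measure M ?R \<rightarrow>\<^sub>M half_paths"
    using f by (simp cong: measurable_cong_sets)
  have "distr (given M (\<lambda>\<omega>. renewal_ind Y \<omega> n)) half_paths ?f = L"
    using reg n by (auto simp: regenerative_def)
  then have "measure L A = measure (uniform_measure M ?R) (?f -` A \<inter> space M)"
    using measure_distr[OF f' A] by (simp add: given_def)
  also have "\<dots> = measure M (?R \<inter> (?f -` A \<inter> space M)) / measure M ?R"
    using n(2) measurable_sets[OF f A]
    by (intro measure_uniform_measure) (auto simp: M.emeasure_eq_measure)
  also have "?R \<inter> (?f -` A \<inter> space M) = {\<omega> \<in> space M. renewal_ind Y \<omega> n \<and> ?f \<omega> \<in> A}" by auto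
  finally show ?thesis using n(2) by simp
qed

text \<open>
  The future after a renewal is independent of the past indicators; both sides vanish if there is
  almost surely no renewal at \<open>n\<close>.
\<close>

lemma future_indep_past:
  assumes n: "1 \<le> n" and A: "A \<in> sets half_paths" and B: "B \<in> sets (path_space {0..n})"
  shows "\<P>(\<omega> in M. renewal_ind Y \<omega> n \<and> (\<lambda>i\<in>{0..n}. renewal_ind Y \<omega> i) \<in> B \<and>
      future (X \<omega>) (renewal_ind Y \<omega>) n \<in> A) =
    \<P>(\<omega> in M. renewal_ind Y \<omega> n \<and> (\<lambda>i\<in>{0..n}. renewal_ind Y \<omega> i) \<in> B) * measure L A"
proof -
  let ?R = "{\<omega> \<in> space M. renewal_ind Y \<omega> n}"
  let ?f = "\<lambda>\<omega>. future (X \<omega>) (renewal_ind Y \<omega>) n"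
  let ?g = "\<lambda>\<omega>. \<lambda>i\<in>{0..n}. renewal_ind Y \<omega> i"
  have f[measurable]: "?f \<in> M \<rightarrow>\<^sub>M half_paths" using measurable_future_X[of n] n by simp
  have g[measurable]: "?g \<in> M \<rightarrow>\<^sub>M path_space {0..n}" by measurable
  have [measurable]: "A \<in> sets half_paths" "B \<in> sets (path_space {0..n})" by fact+
  show ?thesis
  proof (cases "measure M ?R = 0")
    case True
    then have "measure M {\<omega> \<in> space M. renewal_ind Y \<omega> n \<and> P \<omega>} = 0" for P
    proof -
      have "measure M {\<omega> \<in> space M. renewal_ind Y \<omega> n \<and> P \<omega>} \<le> measure M ?R"
        by (rule M.finite_measure_mono) auto
      with True show ?thesis using measure_nonneg[of M] by (metis order.antisym)
    qed
    then show ?thesis by simp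
  next
    case False
    then have pos: "0 < measure M ?R" by (simp add: zero_less_measure_iff)
    let ?U = "given M (\<lambda>\<omega>. renewal_ind Y \<omega> n)"
    have U: "measure ?U C = measure M (?R \<inter> C) / measure M ?R" if "C \<in> sets M" for C
      unfolding given_def using that pos by (intro measure_uniform_measure) (auto simp: M.emeasure_eq_measure)
    interpret U: prob_space ?U
      unfolding given_def using pos by (intro prob_space_uniform_measure) (auto simp: M.emeasure_eq_measure)
    have "U.indep_set (sets (vimage_algebra (space M) ?g (path_space {0..n})))
          (sets (vimage_algebra (space M) ?f half_paths))"
      using reg n pos by (auto simp: regenerative_def)
    moreover have "?g -` B \<inter> space M \<in> sets (vimage_algebra (space M) ?g (path_space {0..n}))"
      by (rule in_vimage_algebra[OF B])
    moreover have "?f -` A \<inter> space M \<in> sets (vimage_algebra (space M) ?f half_paths)"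
      by (rule in_vimage_algebra[OF A])
    ultimately have "measure ?U ((?g -` B \<inter> space M) \<inter> (?f -` A \<inter> space M)) =
        measure ?U (?g -` B \<inter> space M) * measure ?U (?f -` A \<inter> space M)"
      by (rule U.indep_setD)
    then have eq: "measure M (?R \<inter> ((?g -` B \<inter> space M) \<inter> (?f -` A \<inter> space M))) * measure M ?R =
        measure M (?R \<inter> (?g -` B \<inter> space M)) * measure M (?R \<inter> (?f -` A \<inter> space M))"
      using pos measurable_sets[OF f A] measurable_sets[OF g B] by (simp add: U field_simps)
    have 1: "?R \<inter> ((?g -` B \<inter> space M) \<inter> (?f -` A \<inter> space M)) =
        {\<omega> \<in> space M. renewal_ind Y \<omega> n \<and> ?g \<omega> \<in> B \<and> ?f \<omega> \<in> A}" by auto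
    have 2: "?R \<inter> (?g -` B \<inter> space M) = {\<omega> \<in> space M. renewal_ind Y \<omega> n \<and> ?g \<omega> \<in> B}" by auto
    have 3: "?R \<inter> (?f -` A \<inter> space M) = {\<omega> \<in> space M. renewal_ind Y \<omega> n \<and> ?f \<omega> \<in> A}" by auto
    show ?thesis
      using eq law_future[OF n pos A] pos unfolding 1 2 3 by simp
  qed
qed

text \<open>Under \<open>L\<close>, the future after the first renewal has again law \<open>L\<close> and is independent of its time.\<close>

lemma regeneration_L:
  assumes n: "1 \<le> n" "0 < \<P>(\<omega> in M. renewal_ind Y \<omega> n)" and A: "A \<in> sets half_paths"
  shows "\<P>(w in L. no_renewal (snd w) k \<and> snd w (int (Suc k)) \<and> future (fst w) (snd w) (int (Suc k)) \<in> A) =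
    \<P>(w in L. no_renewal (snd w) k \<and> snd w (int (Suc k))) * measure L A"
proof -
  let ?r = "\<lambda>\<omega>. renewal_ind Y \<omega>"
  let ?m = "n + int (Suc k)"
  note [measurable] = A measurable_future_half_paths
  have f[measurable]: "(\<lambda>\<omega>. future (X \<omega>) (?r \<omega>) n) \<in> M \<rightarrow>\<^sub>M half_paths"
    using measurable_future_X[of n] n by simp
  define B where "B = {r \<in> space (path_space {0..?m}). r n \<and> (\<forall>x\<in>{n<..n + int k}. \<not> r x)}"
  have B: "B \<in> sets (path_space {0..?m})"
    unfolding B_def
  proof (rule sets.sets_Collect_conj)
    show "{r \<in> space (path_space {0..?m}). r n} \<in> sets (path_space {0..?m})"
      using n by (intro predE measurable_component_singleton) auto
    show "{r \<in> space (path_space {0..?m}). \<forall>x\<in>{n<..n + int k}. \<not> r x} \<in> sets (path_space {0..?m})"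
      using n by (intro predE pred_intros_finite(3) pred_intros_logic measurable_component_singleton) auto
  qed
  have B_iff: "(\<lambda>i\<in>{0..?m}. ?r \<omega> i) \<in> B \<longleftrightarrow> ?r \<omega> n \<and> no_renewal (ind_after (?r \<omega>) n) k" for \<omega>
    using n by (auto simp: B_def space_PiM no_renewal_ind_after)
  have ia: "ind_after (?r \<omega>) n (int (Suc k)) = ?r \<omega> ?m" for \<omega>
    by (simp add: ind_after_def)
  define C where "C A = {w \<in> space half_paths. no_renewal (snd w) k \<and> snd w (int (Suc k)) \<and>
      future (fst w) (snd w) (int (Suc k)) \<in> A}" for A
  have C: "C A \<in> sets half_paths" if [measurable]: "A \<in> sets half_paths" for A
    unfolding C_def by measurable
  have Ceq: "\<P>(\<omega> in M. ?r \<omega> n \<and> future (X \<omega>) (?r \<omega>) n \<in> C A) =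
     \<P>(\<omega> in M. ?r \<omega> ?m \<and> (\<lambda>i\<in>{0..?m}. ?r \<omega> i) \<in> B \<and> future (X \<omega>) (?r \<omega>) ?m \<in> A)" for A
  proof -
    have "future (X \<omega>) (?r \<omega>) n \<in> space half_paths" if "\<omega> \<in> space M" for \<omega>
      using measurable_space[OF f that] .
    then have "?r \<omega> n \<and> future (X \<omega>) (?r \<omega>) n \<in> C A \<longleftrightarrow>
        ?r \<omega> ?m \<and> (\<lambda>i\<in>{0..?m}. ?r \<omega> i) \<in> B \<and> future (X \<omega>) (?r \<omega>) ?m \<in> A" if "\<omega> \<in> space M" for \<omega>
      unfolding B_iff C_def using that ia[of \<omega>]
      by (auto simp: perm_after_perm_after ind_after_ind_after simp del: of_nat_Suc)
    then show ?thesis by (intro arg_cong[where f="measure M"] Collect_cong) blast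
  qed
  have "\<P>(\<omega> in M. ?r \<omega> n) * measure L (C A) =
      \<P>(\<omega> in M. ?r \<omega> ?m \<and> (\<lambda>i\<in>{0..?m}. ?r \<omega> i) \<in> B) * measure L A"
    using law_future[OF n C[OF A]] future_indep_past[OF _ A B] n(1) by (simp add: Ceq)
  moreover have "\<P>(\<omega> in M. ?r \<omega> n) * measure L (C (space half_paths)) =
      \<P>(\<omega> in M. ?r \<omega> ?m \<and> (\<lambda>i\<in>{0..?m}. ?r \<omega> i) \<in> B) * measure L (space half_paths)"
    using law_future[OF n C[OF sets.top]] future_indep_past[OF _ sets.top B] n(1) by (simp add: Ceq)
  moreover have "measure L (space half_paths) = 1"
    using L.prob_space by (simp add: space_L)
  ultimately have "\<P>(\<omega> in M. ?r \<omega> n) * measure L (C A) =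
      \<P>(\<omega> in M. ?r \<omega> n) * measure L (C (space half_paths)) * measure L A"
    by (simp only: mult_1_right)
  then have "measure L (C A) = measure L (C (space half_paths)) * measure L A"
    using n(2) by simp
  moreover have "C (space half_paths) = {w \<in> space L. no_renewal (snd w) k \<and> snd w (int (Suc k))}"
    unfolding C_def space_L
    using measurable_space[OF measurable_future_half_paths[of "int (Suc k)"]] by auto
  ultimately show ?thesis by (simp add: C_def space_L)
qed

lemma emeasure_no_renewal: "emeasure L {w \<in> space L. no_renewal (snd w) k} = emeasure M {\<omega> \<in> space M. enat k < Y 1 \<omega>}"
proof -
  define Y0 where "Y0 = Y(0 := \<lambda>_. 0)"
  have Y0: "Y0 0 \<omega> = 0" "Y0 (Suc i) = Y (Suc i)" for \<omega> i by (simp_all add: Y0_def)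
  let ?r = "\<lambda>\<omega>. \<lambda>i\<in>{1..}. renewal_ind Y0 \<omega> i"
  let ?A = "{r \<in> space (path_space {1..}). no_renewal r k}"
  have "Y0 i \<in> M \<rightarrow>\<^sub>M count_space UNIV" for i
    by (cases i) (simp_all add: Y0_def)
  then have "renewal_time Y0 j \<in> M \<rightarrow>\<^sub>M count_space UNIV" for j
    by (rule measurable_renewal_time)
  note [measurable] = this
  have r[measurable]: "?r \<in> M \<rightarrow>\<^sub>M path_space {1..}"
    unfolding renewal_ind_def by measurable
  have A[measurable]: "?A \<in> sets (path_space {1..})"
    unfolding no_renewal_def
    by (intro predE pred_intros_finite(3) pred_intros_logic measurable_component_singleton) auto
  have "{w \<in> space L. no_renewal (snd w) k} = snd -` ?A \<inter> space L"
    by (auto simp: space_L space_pair_measure)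
  also have "emeasure L \<dots> = emeasure (distr L (path_space {1..}) snd) ?A"
    by (subst emeasure_distr) auto
  also have "\<dots> = emeasure M (?r -` ?A \<inter> space M)"
    unfolding law_indicators[folded Y0_def] by (subst emeasure_distr) auto
  also have "\<dots> = emeasure M {\<omega> \<in> space M. enat k < Y 1 \<omega>}"
  proof (rule emeasure_eq_AE)
    show "AE \<omega> in M. \<omega> \<in> ?r -` ?A \<inter> space M \<longleftrightarrow> \<omega> \<in> {\<omega> \<in> space M. enat k < Y 1 \<omega>}"
      using AE_Y_ge_1
    proof eventually_elim
      fix \<omega> assume Y: "\<forall>i\<ge>1. 1 \<le> Y i \<omega>"
      have t1: "renewal_time Y0 1 \<omega> = Y 1 \<omega>" by (simp add: renewal_time_def Y0)
      have le: "Y 1 \<omega> \<le> renewal_time Y0 (Suc j) \<omega>" for j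
      proof (induction j)
        case 0 then show ?case using t1 by simp
      next
        case (Suc j) then show ?case
          unfolding renewal_time_Suc[of _ "Suc j"] Y0 by (meson le_iff_add order.trans)
      qed
      have "no_renewal (?r \<omega>) k \<longleftrightarrow> enat k < Y 1 \<omega>"
      proof
        assume nr: "no_renewal (?r \<omega>) k"
        show "enat k < Y 1 \<omega>"
        proof (rule ccontr)
          assume "\<not> enat k < Y 1 \<omega>"
          then obtain m where m: "Y 1 \<omega> = enat m" "m \<le> k" by (cases "Y 1 \<omega>") auto
          have "1 \<le> m" using Y m by (auto simp: one_enat_def dest: spec[of _ 1])
          moreover have "renewal_ind Y0 \<omega> (int m)" using t1 m by (auto simp: renewal_ind_def intro!: exI[of _ 1])
          ultimately show False using nr m by (auto simp: no_renewal_def dest: bspec[of _ _ "int m"])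
        qed
      next
        assume k: "enat k < Y 1 \<omega>"
        have "\<not> renewal_ind Y0 \<omega> x" if x: "x \<in> {1..int k}" for x
        proof
          assume "renewal_ind Y0 \<omega> x"
          then obtain j where j: "renewal_time Y0 j \<omega> = enat (nat x)" by (auto simp: renewal_ind_def)
          show False
          proof (cases j)
            case 0
            with j x show False by (simp add: renewal_time_def Y0 zero_enat_def)
          next
            case (Suc i)
            then have "Y 1 \<omega> \<le> enat (nat x)" using le[of i] j by simp
            also have "\<dots> \<le> enat k" using x by (simp add: nat_le_iff)
            finally show False using k by simp
          qed
        qed
        then show "no_renewal (?r \<omega>) k" by (auto simp: no_renewal_def)
      qed
      moreover have "?r \<omega> \<in> space (path_space {1..})" by (simp add: space_PiM)
      ultimately show "\<omega> \<in> ?r -` ?A \<inter> space M \<longleftrightarrow> \<omega> \<in> {\<omega> \<in> space M. enat k < Y 1 \<omega>}" by auto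
    qed
  qed measurable
  finally show ?thesis .
qed

text \<open>The first renewal after a renewal has the same mean as the block length \<open>Y\<^sub>1\<close>, finite or not.\<close>

lemma suminf_no_renewal:
  "(\<Sum>k. emeasure L {w \<in> space L. no_renewal (snd w) k}) = (\<integral>\<^sup>+\<omega>. ennreal_of_enat (Y 1 \<omega>) \<partial>M)"
  unfolding emeasure_no_renewal by (rule nn_integral_enat_function[symmetric]) measurable

end

section \<open>Block lengths and blocks after a renewal\<close>

text \<open>A regenerative permutation with integrable block lengths and blocks governed by \<open>Q\<close>.\<close>

locale governed_perm = regenerative_perm +
  fixes p :: "nat pmf" and Q :: "nat \<Rightarrow> (int \<Rightarrow> int) pmf" and \<mu> :: real
  assumes gov: "governed_by M X Y p Q"
    and summable_mean: "summable (\<lambda>n. real n * pmf p n)"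
    and mean: "\<mu> = (\<Sum>n. real n * pmf p n)"
begin

lemma pmf_p_0: "pmf p 0 = 0"
  using gov by (simp add: governed_by_def)

lemma prob_Y: "1 \<le> i \<Longrightarrow> \<P>(\<omega> in M. Y i \<omega> = enat n) = pmf p n"
  using gov by (simp add: governed_by_def)

lemma AE_Y_finite:
  assumes i: "1 \<le> i"
  shows "AE \<omega> in M. Y i \<omega> \<noteq> \<infinity>"
proof -
  have "emeasure M (\<Union>n. {\<omega> \<in> space M. Y i \<omega> = enat n}) = (\<Sum>n. emeasure M {\<omega> \<in> space M. Y i \<omega> = enat n})"
    by (rule suminf_emeasure[symmetric]) (auto simp: disjoint_family_on_def)
  also have "\<dots> = (\<Sum>n. ennreal (pmf p n))"
    by (simp add: M.emeasure_eq_measure prob_Y[OF i])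
  also have "\<dots> = 1"
    by (simp add: nn_integral_count_space_nat[symmetric] nn_integral_pmf measure_pmf.emeasure_space_1[simplified])
  finally have "AE \<omega> in M. \<omega> \<in> (\<Union>n. {\<omega> \<in> space M. Y i \<omega> = enat n})"
    by (intro M.AE_prob_1) (simp add: measure_def)
  then show ?thesis by eventually_elim auto
qed

lemma AE_finite_lengths: "AE \<omega> in M. finite_lengths Y \<omega>"
proof -
  have "AE \<omega> in M. Y i \<omega> \<noteq> \<infinity>" for i
  proof (cases "i = 0")
    case True
    have "AE \<omega> in M. Y 0 \<omega> < \<infinity>" using reg by (auto simp: regenerative_def delayed_renewal_def)
    then show ?thesis using True by (auto elim: eventually_mono)
  qed (use AE_Y_finite[of i] in auto)
  then have "AE \<omega> in M. \<forall>i. Y i \<omega> \<noteq> \<infinity>" by (simp add: AE_all_countable)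
  with AE_Y_ge_1 show ?thesis by eventually_elim (auto simp: finite_lengths_def)
qed

lemma pred_finite_lengths [measurable]: "Measurable.pred M (finite_lengths Y)"
  unfolding finite_lengths_def by measurable

lemma mean_Y: "(\<integral>\<^sup>+\<omega>. ennreal_of_enat (Y 1 \<omega>) \<partial>M) = ennreal \<mu>"
proof -
  let ?A = "\<lambda>n. {\<omega> \<in> space M. Y 1 \<omega> = enat n}"
  have "(\<integral>\<^sup>+\<omega>. ennreal_of_enat (Y 1 \<omega>) \<partial>M) = (\<integral>\<^sup>+\<omega>. (\<Sum>n. of_nat n * indicator (?A n) \<omega>) \<partial>M)"
  proof (rule nn_integral_cong_AE)
    show "AE \<omega> in M. ennreal_of_enat (Y 1 \<omega>) = (\<Sum>n. of_nat n * indicator (?A n) \<omega>)"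
      using AE_finite_lengths AE_space
    proof eventually_elim
      fix \<omega> assume "finite_lengths Y \<omega>" "\<omega> \<in> space M"
      moreover then obtain k where "Y 1 \<omega> = enat k" by (auto simp: finite_lengths_def)
      ultimately have "\<omega> \<in> ?A k" "ennreal_of_enat (Y 1 \<omega>) = of_nat k" by auto
      moreover have "disjoint_family ?A" by (auto simp: disjoint_family_on_def)
      ultimately show "ennreal_of_enat (Y 1 \<omega>) = (\<Sum>n. of_nat n * indicator (?A n) \<omega>)"
        using suminf_cmult_indicator[of ?A \<omega> k "of_nat"] by simp
    qed
  qed
  also have "\<dots> = (\<Sum>n. \<integral>\<^sup>+\<omega>. of_nat n * indicator (?A n) \<omega> \<partial>M)"
    by (rule nn_integral_suminf) measurable
  also have "\<dots> = (\<Sum>n. ennreal (real n * pmf p n))"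
  proof (rule suminf_cong)
    fix n
    have "(\<integral>\<^sup>+\<omega>. of_nat n * indicator (?A n) \<omega> \<partial>M) = of_nat n * emeasure M (?A n)"
      by (rule nn_integral_cmult_indicator) measurable
    then show "(\<integral>\<^sup>+\<omega>. of_nat n * indicator (?A n) \<omega> \<partial>M) = ennreal (real n * pmf p n)"
      using prob_Y[of 1 n] by (simp add: M.emeasure_eq_measure ennreal_mult ennreal_of_nat_eq_real_of_nat)
  qed
  also have "\<dots> = ennreal \<mu>"
    unfolding mean by (rule suminf_ennreal2) (use summable_mean in auto)
  finally show ?thesis .
qed

lemma suminf_no_renewal_eq: "(\<Sum>k. emeasure L {w \<in> space L. no_renewal (snd w) k}) = ennreal \<mu>"
  unfolding suminf_no_renewal by (rule mean_Y)

lemma mean_pos: "0 < \<mu>"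
proof (rule ccontr)
  assume "\<not> 0 < \<mu>"
  then have "(\<Sum>k. emeasure L {w \<in> space L. no_renewal (snd w) k}) = 0"
    using suminf_no_renewal_eq by (simp add: ennreal_neg)
  moreover have "emeasure L {w \<in> space L. no_renewal (snd w) 0} \<le> (\<Sum>k. emeasure L {w \<in> space L. no_renewal (snd w) k})"
    using sum_le_suminf[of "\<lambda>k. emeasure L {w \<in> space L. no_renewal (snd w) k}" "{0}"] by simp
  ultimately show False by (simp add: L.emeasure_space_1)
qed

lemma ex_renewal_pos: "\<exists>n\<ge>1. 0 < \<P>(\<omega> in M. renewal_ind Y \<omega> n)"
proof (rule ccontr)
  assume "\<not> ?thesis"
  then have "\<P>(\<omega> in M. renewal_ind Y \<omega> n) = 0" if "1 \<le> n" for n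
    using that by (meson measure_nonneg not_le order.antisym)
  then have "AE \<omega> in M. \<not> renewal_ind Y \<omega> n" if "1 \<le> n" for n
    using that by (subst (asm) M.prob_eq_0) auto
  then have "AE \<omega> in M. 1 \<le> n \<longrightarrow> \<not> renewal_ind Y \<omega> n" for n by (cases "1 \<le> n") auto
  then have "AE \<omega> in M. \<forall>n\<ge>1. \<not> renewal_ind Y \<omega> n" by (simp add: AE_all_countable)
  with AE_finite_lengths have "AE \<omega> in M. False"
  proof eventually_elim
    fix \<omega> assume *: "finite_lengths Y \<omega>" "\<forall>n\<ge>1. \<not> renewal_ind Y \<omega> n"
    have "int_time Y \<omega> 0 < int_time Y \<omega> 1" using strict_mono_int_time[OF *(1)] by (simp add: strict_mono_less)
    moreover have "0 \<le> int_time Y \<omega> 0" by (rule int_time_nonneg)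
    ultimately have "1 \<le> int_time Y \<omega> 1" by simp
    then show False using * by (auto simp: renewal_ind_iff)
  qed
  then show False by simp
qed

lemma pred_gaps_path: "{r \<in> space (path_space {1..}). gaps r n y} \<in> sets (path_space {1..})"
  unfolding gaps_def
  by (intro predE pred_intros_finite(3) pred_intros_logic measurable_component_singleton) auto

lemma prob_gaps:
  assumes y: "\<forall>i<n. 1 \<le> y i"
  shows "\<P>(w in L. gaps (snd w) n y) = (\<Prod>i<n. pmf p (nat (y i)))"
proof -
  define Y0 where "Y0 = Y(0 := \<lambda>_. 0)"
  have Y0: "Y0 0 \<omega> = 0" "Y0 (Suc i) = Y (Suc i)" for \<omega> i by (simp_all add: Y0_def)
  let ?r = "\<lambda>\<omega>. \<lambda>i\<in>{1..}. renewal_ind Y0 \<omega> i"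
  let ?A = "{r \<in> space (path_space {1..}). gaps r n y}"
  have "Y0 i \<in> M \<rightarrow>\<^sub>M count_space UNIV" for i
    by (cases i) (simp_all add: Y0_def)
  then have "renewal_time Y0 j \<in> M \<rightarrow>\<^sub>M count_space UNIV" for j
    by (rule measurable_renewal_time)
  note [measurable] = this pred_gaps_path
  have r[measurable]: "?r \<in> M \<rightarrow>\<^sub>M path_space {1..}"
    unfolding renewal_ind_def by measurable
  have "{w \<in> space L. gaps (snd w) n y} = snd -` ?A \<inter> space L"
    by (auto simp: space_L space_pair_measure)
  also have "measure L \<dots> = measure (distr L (path_space {1..}) snd) ?A"
    by (subst measure_distr) auto
  also have "\<dots> = measure M (?r -` ?A \<inter> space M)"
    unfolding law_indicators[folded Y0_def] by (subst measure_distr) auto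
  also have "\<dots> = measure M {\<omega> \<in> space M. \<forall>i<n. Y (Suc i) \<omega> = enat (nat (y i))}"
  proof (rule measure_eq_AE)
    show "AE \<omega> in M. \<omega> \<in> ?r -` ?A \<inter> space M \<longleftrightarrow> \<omega> \<in> {\<omega> \<in> space M. \<forall>i<n. Y (Suc i) \<omega> = enat (nat (y i))}"
      using AE_finite_lengths
    proof eventually_elim
      fix \<omega> assume "finite_lengths Y \<omega>"
      then have f: "finite_lengths Y0 \<omega>" by (auto simp: finite_lengths_def Y0_def zero_enat_def)
      have t: "int_time Y0 \<omega> 0 = 0" by (simp add: int_time_def renewal_time_def Y0 zero_enat_def)
      have "?r \<omega> = ind_after (renewal_ind Y0 \<omega>) (int_time Y0 \<omega> 0)" by (simp add: t ind_after_def)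
      then have "gaps (?r \<omega>) n y \<longleftrightarrow> (\<forall>i<n. Y (Suc i) \<omega> = enat (nat (y i)))"
        using gaps_after_int_time[OF f y, of 0] by (simp add: Y0)
      moreover have "?r \<omega> \<in> space (path_space {1..})" by (simp add: space_PiM)
      ultimately show "\<omega> \<in> ?r -` ?A \<inter> space M \<longleftrightarrow> \<omega> \<in> {\<omega> \<in> space M. \<forall>i<n. Y (Suc i) \<omega> = enat (nat (y i))}" by auto
    qed
  qed measurable
  also have "\<dots> = (\<Prod>i<n. pmf p (nat (y i)))"
  proof (cases "n = 0")
    case False
    have "measure M (\<Inter>j\<in>Suc ` {..<n}. Y j -` {enat (nat (y (j - 1)))} \<inter> space M) =
        (\<Prod>j\<in>Suc ` {..<n}. measure M (Y j -` {enat (nat (y (j - 1)))} \<inter> space M))"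
      using False by (intro M.indep_varsD[OF indep_Y]) auto
    moreover have "(\<Inter>j\<in>Suc ` {..<n}. Y j -` {enat (nat (y (j - 1)))} \<inter> space M) =
        {\<omega> \<in> space M. \<forall>i<n. Y (Suc i) \<omega> = enat (nat (y i))}"
      using False by auto
    moreover have "measure M (Y (Suc i) -` {enat (nat (y i))} \<inter> space M) = pmf p (nat (y i))" for i
      using prob_Y[of "Suc i" "nat (y i)"] by (simp add: vimage_def Int_def conj_commute)
    ultimately show ?thesis by (simp add: prod.reindex)
  qed (simp add: M.prob_space)
  finally show ?thesis .
qed

lemma pred_reduced_block: "Measurable.pred M (\<lambda>\<omega>. reduced_block X Y (Suc l) \<omega> = \<sigma>)"
proof -
  have X: "Measurable.pred M (\<lambda>\<omega>. reduced_perm (int a) (int b) (X \<omega>) = \<sigma>)" for a b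
    by (rule pred_reduced_perm) (auto intro: measurable_X)
  have "Measurable.pred M (\<lambda>\<omega>. reduced_perm (int (the_enat (renewal_time Y l \<omega>))) (int b) (X \<omega>) = \<sigma>)" for b
    by (rule measurable_compose_countable[where f="\<lambda>a \<omega>. reduced_perm (int a) (int b) (X \<omega>) = \<sigma>"]) (use X in measurable)
  note this[measurable]
  show ?thesis unfolding reduced_block_def
    by (simp, rule measurable_compose_countable[where
       f="\<lambda>b \<omega>. reduced_perm (int (the_enat (renewal_time Y l \<omega>))) (int b) (X \<omega>) = \<sigma>"]) measurable
qed

text \<open>
  Conditionally on all the block lengths, the reduced block has the law prescribed by \<open>Q\<close>; in
  particular given any event that fixes the renewal time and the lengths of the next blocks.
\<close>

lemma prob_lengths_block:
  fixes k t :: nat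
  assumes j: "j < m" and y: "\<forall>i<m. 1 \<le> y i"
  defines "E \<equiv> \<lambda>\<omega>. renewal_time Y k \<omega> = enat t \<and> (\<forall>i<m. Y (Suc (k + i)) \<omega> = enat (nat (y i)))"
  shows "\<P>(\<omega> in M. E \<omega> \<and> reduced_block X Y (Suc (k + j)) \<omega> = \<sigma>) =
    pmf (Q (nat (y j))) \<sigma> * \<P>(\<omega> in M. E \<omega>)"
proof -
  define F where "F = vimage_algebra (space M) (\<lambda>\<omega> i. Y i \<omega>) (path_space UNIV)"
  have "(\<lambda>\<omega> i. Y i \<omega>) \<in> M \<rightarrow>\<^sub>M path_space UNIV"
    by (rule measurable_PiM_single') (auto simp: PiE_UNIV_domain)
  then have sub: "subalgebra M F"
    unfolding subalgebra_def F_def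
    by (auto simp: sets_vimage_algebra2 intro: measurable_sets)
  interpret F: finite_measure_subalgebra M F
    by standard (rule sub)
  have YF: "Y i \<in> F \<rightarrow>\<^sub>M count_space UNIV" for i
  proof -
    have "(\<lambda>\<omega>. (\<lambda>i. Y i \<omega>) i) \<in> F \<rightarrow>\<^sub>M count_space UNIV"
      unfolding F_def
      by (intro measurable_compose[OF measurable_vimage_algebra1 measurable_component_singleton]) auto
    then show ?thesis by simp
  qed
  note [measurable] = YF measurable_renewal_time[OF YF]
  have spF: "space F = space M" by (simp add: F_def)
  let ?E = "{\<omega> \<in> space M. E \<omega>}"
  let ?B = "{\<omega> \<in> space M. reduced_block X Y (Suc (k + j)) \<omega> = \<sigma>}"
  have "{\<omega> \<in> space F. E \<omega>} \<in> sets F" unfolding E_def by measurable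
  then have EF: "?E \<in> sets F" by (simp add: spF)
  then have EM[measurable]: "?E \<in> sets M" using sub by (auto simp: subalgebra_def)
  have B[measurable]: "?B \<in> sets M" using pred_reduced_block by (simp add: pred_def)
  have ae: "AE \<omega> in M. real_cond_exp M F (indicator ?B) \<omega> = pmf (Q (the_enat (Y (Suc (k + j)) \<omega>))) \<sigma>"
    using gov unfolding governed_by_def Let_def F_def by auto
  have "measure M (?E \<inter> ?B) = (\<integral>\<omega>\<in>?E. indicator ?B \<omega> \<partial>M)"
    by (simp add: set_lebesgue_integral_def indicator_inter_arith[symmetric])
  also have "\<dots> = (\<integral>\<omega>\<in>?E. real_cond_exp M F (indicator ?B) \<omega> \<partial>M)"
    by (rule F.real_cond_exp_intA[OF _ EF]) (simp add: M.emeasure_eq_measure)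
  also have "\<dots> = (\<integral>\<omega>\<in>?E. pmf (Q (nat (y j))) \<sigma> \<partial>M)"
    unfolding set_lebesgue_integral_def
  proof (rule integral_cong_AE)
    show "AE \<omega> in M. indicator ?E \<omega> *\<^sub>R real_cond_exp M F (indicator ?B) \<omega> = indicator ?E \<omega> *\<^sub>R pmf (Q (nat (y j))) \<sigma>"
      using ae by eventually_elim (use j in \<open>auto simp: E_def indicator_def\<close>)
  qed measurable
  also have "\<dots> = pmf (Q (nat (y j))) \<sigma> * measure M ?E"
    by (simp add: set_lebesgue_integral_def)
  also have "?E \<inter> ?B = {\<omega> \<in> space M. E \<omega> \<and> reduced_block X Y (Suc (k + j)) \<omega> = \<sigma>}" by auto
  finally show ?thesis .
qed

text \<open>
  A renewal at \<open>n\<close> is the \<open>k\<close>-th renewal for a unique \<open>k \<le> n\<close>. Summing over \<open>k\<close> the previous formula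
  gives the law of a block under \<open>L\<close>.
\<close>

lemma prob_gaps_block:
  assumes j: "j < m" and y: "\<forall>i<m. 1 \<le> y i"
  shows "\<P>(w in L. gaps (snd w) m y \<and> reduced_perm (\<Sum>i<j. y i) (\<Sum>i<Suc j. y i) (fst w) = \<sigma>) =
    (\<Prod>i<m. pmf p (nat (y i))) * pmf (Q (nat (y j))) \<sigma>"
proof -
  obtain n where n: "1 \<le> n" "0 < \<P>(\<omega> in M. renewal_ind Y \<omega> n)" using ex_renewal_pos by blast
  let ?s = "\<lambda>j. \<Sum>i<j. y i"
  have s0: "0 \<le> ?s j" using y j by (intro sum_nonneg) (auto intro: order.trans[of 0 1])
  let ?f = "\<lambda>\<omega>. future (X \<omega>) (renewal_ind Y \<omega>) n"
  define E where "E k \<omega> \<longleftrightarrow> renewal_time Y k \<omega> = enat (nat n) \<and> (\<forall>i<m. Y (Suc (k + i)) \<omega> = enat (nat (y i)))" for k \<omega>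
  have E[measurable]: "Measurable.pred M (E k)" for k unfolding E_def by measurable
  define B where "B k \<omega> \<longleftrightarrow> reduced_block X Y (Suc (k + j)) \<omega> = \<sigma>" for k \<omega>
  have B[measurable]: "Measurable.pred M (B k)" for k unfolding B_def by (rule pred_reduced_block)
  have blk[measurable]: "Measurable.pred half_paths (\<lambda>w. reduced_perm (?s j) (?s (Suc j)) (fst w) = \<sigma>)"
    using s0 by (intro pred_reduced_perm measurable_half_paths_component) auto
  have f[measurable]: "?f \<in> M \<rightarrow>\<^sub>M half_paths" using measurable_future_X[of n] n by simp
  have key: "\<P>(\<omega> in M. renewal_ind Y \<omega> n \<and> ?f \<omega> \<in> {w \<in> space half_paths. gaps (snd w) m y \<and> G w}) =
      (\<Sum>k\<le>nat n. \<P>(\<omega> in M. E k \<omega> \<and> H k \<omega>))"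
    if [measurable]: "Measurable.pred half_paths G" "\<And>k. Measurable.pred M (H k)"
      and GH: "\<And>\<omega> k. finite_lengths Y \<omega> \<Longrightarrow> E k \<omega> \<Longrightarrow> G (?f \<omega>) \<longleftrightarrow> H k \<omega>" for G H
  proof -
    let ?D = "\<lambda>k. {\<omega> \<in> space M. finite_lengths Y \<omega> \<and> E k \<omega> \<and> H k \<omega>}"
    have iff: "renewal_ind Y \<omega> n \<and> gaps (snd (?f \<omega>)) m y \<and> G (?f \<omega>) \<longleftrightarrow> (\<exists>k\<le>nat n. E k \<omega> \<and> H k \<omega>)"
      if fl: "finite_lengths Y \<omega>" for \<omega>
    proof -
      have E_iff: "E k \<omega> \<longleftrightarrow> n = int_time Y \<omega> k \<and> gaps (ind_after (renewal_ind Y \<omega>) n) m y" for k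
        using renewal_time_finite[OF fl, of k] gaps_after_int_time[OF fl y, of k] n(1) int_time_nonneg[of Y \<omega> k]
        unfolding E_def by (auto simp: eq_nat_nat_iff)
      have "k \<le> nat n" if "n = int_time Y \<omega> k" for k
      proof -
        have "int k \<le> int_time Y \<omega> k"
        proof (induction k)
          case (Suc k)
          have "int_time Y \<omega> k < int_time Y \<omega> (Suc k)"
            using strict_mono_int_time[OF fl] by (simp add: strict_mono_less)
          with Suc show ?case by simp
        qed (simp add: int_time_nonneg)
        then show ?thesis using that by simp
      qed
      moreover have "renewal_ind Y \<omega> n \<longleftrightarrow> (\<exists>k. n = int_time Y \<omega> k)"
        using renewal_ind_iff[OF fl, of n] by auto
      ultimately show ?thesis using GH[OF fl] E_iff by auto
    qed
    have inj: "k = l" if "finite_lengths Y \<omega>" "E k \<omega>" "E l \<omega>" for k l \<omega>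
    proof -
      have "int_time Y \<omega> k = int_time Y \<omega> l" using that by (auto simp: E_def int_time_def)
      then show ?thesis using strict_mono_int_time[OF that(1)] by (simp add: strict_mono_eq)
    qed
    have "\<P>(\<omega> in M. renewal_ind Y \<omega> n \<and> ?f \<omega> \<in> {w \<in> space half_paths. gaps (snd w) m y \<and> G w}) =
       measure M (\<Union>k\<in>{..nat n}. ?D k)"
    proof (rule measure_eq_AE)
      show "AE \<omega> in M. \<omega> \<in> {\<omega> \<in> space M. renewal_ind Y \<omega> n \<and> ?f \<omega> \<in> {w \<in> space half_paths. gaps (snd w) m y \<and> G w}} \<longleftrightarrow>
          \<omega> \<in> (\<Union>k\<in>{..nat n}. ?D k)"
        using AE_finite_lengths AE_space
      proof eventually_elim
        fix \<omega> assume *: "finite_lengths Y \<omega>" "\<omega> \<in> space M"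
        then show "\<omega> \<in> {\<omega> \<in> space M. renewal_ind Y \<omega> n \<and> ?f \<omega> \<in> {w \<in> space half_paths. gaps (snd w) m y \<and> G w}} \<longleftrightarrow>
          \<omega> \<in> (\<Union>k\<in>{..nat n}. ?D k)"
          using iff[OF *(1)] measurable_space[OF f *(2)] by auto
      qed
    qed measurable
    also have "\<dots> = (\<Sum>k\<le>nat n. measure M (?D k))"
      by (rule M.finite_measure_finite_Union) (auto simp: disjoint_family_on_def dest: inj)
    also have "\<dots> = (\<Sum>k\<le>nat n. \<P>(\<omega> in M. E k \<omega> \<and> H k \<omega>))"
    proof (rule sum.cong[OF refl], rule measure_eq_AE)
      fix k
      show "AE \<omega> in M. \<omega> \<in> ?D k \<longleftrightarrow> \<omega> \<in> {\<omega> \<in> space M. E k \<omega> \<and> H k \<omega>}"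
        using AE_finite_lengths by eventually_elim auto
    qed measurable
    finally show ?thesis .
  qed
  have A: "{w \<in> space half_paths. gaps (snd w) m y \<and> reduced_perm (?s j) (?s (Suc j)) (fst w) = \<sigma>} \<in> sets half_paths"
    by measurable
  have "\<P>(\<omega> in M. renewal_ind Y \<omega> n) * \<P>(w in L. gaps (snd w) m y \<and> reduced_perm (?s j) (?s (Suc j)) (fst w) = \<sigma>) =
      (\<Sum>k\<le>nat n. \<P>(\<omega> in M. E k \<omega> \<and> B k \<omega>))"
    using law_future[OF n A] 
  proof (subst (asm) key[of _ B])
    fix \<omega> k assume fl: "finite_lengths Y \<omega>" and "E k \<omega>"
    then have e: "int_time Y \<omega> k = n" and l: "\<And>i. i < m \<Longrightarrow> Y (Suc (k + i)) \<omega> = enat (nat (y i))"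
      using n(1) by (auto simp: E_def int_time_def)
    have "int_time Y \<omega> (k + i) = n + ?s i" if "i \<le> m" for i
      using that
    proof (induction i)
      case (Suc i)
      then show ?case using int_time_Suc[OF fl, of "k + i"] l[of i] y by (auto simp: order.trans[of 0 1])
    qed (simp add: e)
    from this[of j] this[of "Suc j"] j
    show "(reduced_perm (?s j) (?s (Suc j)) (fst (?f \<omega>)) = \<sigma>) \<longleftrightarrow> B k \<omega>"
      using s0 by (simp add: B_def reduced_block_def reduced_perm_perm_after int_time_def)
  qed (use blk in \<open>auto simp: space_L\<close>)
  also have "\<dots> = (\<Sum>k\<le>nat n. pmf (Q (nat (y j))) \<sigma> * \<P>(\<omega> in M. E k \<omega>))"
    using prob_lengths_block[OF j y] by (simp add: E_def B_def conj_assoc)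
  also have "\<dots> = pmf (Q (nat (y j))) \<sigma> * (\<Sum>k\<le>nat n. \<P>(\<omega> in M. E k \<omega> \<and> True))"
    by (simp add: sum_distrib_left)
  also have "(\<Sum>k\<le>nat n. \<P>(\<omega> in M. E k \<omega> \<and> True)) =
      \<P>(\<omega> in M. renewal_ind Y \<omega> n \<and> ?f \<omega> \<in> {w \<in> space half_paths. gaps (snd w) m y \<and> True})"
    by (rule key[symmetric]) auto
  also have "\<dots> = \<P>(\<omega> in M. renewal_ind Y \<omega> n) * \<P>(w in L. gaps (snd w) m y)"
    by (subst law_future[OF n]) (auto simp: space_L)
  finally show ?thesis using n(2) by (simp add: prob_gaps[OF y])
qed

end

section \<open>Palm formula for stationary regenerative permutations\<close>

lemma measurable_Pair_count_space:
  fixes f :: "'a \<Rightarrow> 'b::countable" and g :: "'a \<Rightarrow> 'c::countable"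
  assumes [measurable]: "f \<in> N \<rightarrow>\<^sub>M count_space UNIV" "g \<in> N \<rightarrow>\<^sub>M count_space UNIV"
  shows "(\<lambda>x. (f x, g x)) \<in> N \<rightarrow>\<^sub>M count_space UNIV"
  by (rule measurable_compose_countable[where f="\<lambda>a x. (a, g x)" and g=f]) measurable

text \<open>
  What is needed of the law \<open>L\<close> of the future after a renewal: the future after the first renewal is
  independent of the time of this renewal and has again law \<open>L\<close>, and the mean of this time, which is the
  sum of its tail probabilities, is \<open>1 / c\<close>. The number \<open>c\<close> will be the rate of renewals.
\<close>

locale palm_law = L: prob_space L
  for L :: "((int \<Rightarrow> int) \<times> (int \<Rightarrow> bool)) measure" +
  fixes c :: real
  assumes sets_L [measurable_cong]: "sets L = sets half_paths"
    and c_pos: "0 < c"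
    and total: "(\<Sum>k. ennreal c * emeasure L {w \<in> space L. no_renewal (snd w) k}) = 1"
    and regeneration: "A \<in> sets half_paths \<Longrightarrow>
      emeasure L {w \<in> space L. no_renewal (snd w) k \<and> snd w (int (Suc k)) \<and>
        future (fst w) (snd w) (int (Suc k)) \<in> A} =
      emeasure L {w \<in> space L. no_renewal (snd w) k \<and> snd w (int (Suc k))} * emeasure L A"
    and AE_bij: "AE w in L. bij_betw (fst w) {1..} {1..}"
begin

lemma space_L: "space L = space half_paths"
  using sets_L by (rule sets_eq_imp_space_eq)

lemma AE_ex_renewal: "AE w in L. \<exists>x\<ge>1. snd w x"
proof -
  let ?a = "\<lambda>k. measure L {w \<in> space L. no_renewal (snd w) k}"
  have "(\<Sum>k. ennreal (c * ?a k)) = 1"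
    using total c_pos by (simp add: L.emeasure_eq_measure ennreal_mult)
  then have "summable (\<lambda>k. c * ?a k)"
    using c_pos by (intro summable_suminf_not_top) auto
  then have "(\<lambda>k. c * ?a k) \<longlonglongrightarrow> 0" by (rule summable_LIMSEQ_zero)
  then have lim: "?a \<longlonglongrightarrow> 0" using c_pos tendsto_mult_left_iff[of c ?a 0 sequentially] by simp
  have "measure L {w \<in> space L. \<forall>k. no_renewal (snd w) k} \<le> ?a k" for k
    by (rule L.finite_measure_mono) auto
  then have "measure L {w \<in> space L. \<forall>k. no_renewal (snd w) k} \<le> 0"
    by (intro LIMSEQ_le_const[OF lim]) auto
  then have "\<P>(w in L. \<forall>k. no_renewal (snd w) k) = 0"
    by (simp add: measure_le_0_iff)
  then have "AE w in L. \<not> (\<forall>k. no_renewal (snd w) k)"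
    by (subst (asm) L.prob_eq_0) auto
  then show ?thesis
    by eventually_elim (auto simp: no_renewal_def)
qed

lemma suminf_first_renewal: "(\<Sum>k. emeasure L {w \<in> space L. no_renewal (snd w) k \<and> snd w (int (Suc k))}) = 1"
proof -
  let ?A = "\<lambda>k. {w \<in> space L. no_renewal (snd w) k \<and> snd w (int (Suc k))}"
  have [measurable]: "?A k \<in> sets L" for k by measurable
  have "disjoint_family ?A"
  proof -
    have "k = l" if "w \<in> ?A k" "w \<in> ?A l" for k l w
    proof (rule ccontr)
      assume "k \<noteq> l"
      then consider "k < l" | "l < k" by linarith
      then show False
        using that by cases (auto simp: no_renewal_def)
    qed
    then show ?thesis by (auto simp: disjoint_family_on_def)
  qed
  then have "(\<Sum>k. emeasure L (?A k)) = emeasure L (\<Union>k. ?A k)"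
    by (intro suminf_emeasure) auto
  also have "\<dots> = emeasure L (space L)"
  proof (rule emeasure_eq_AE)
    show "AE w in L. w \<in> (\<Union>k. ?A k) \<longleftrightarrow> w \<in> space L"
      using AE_ex_renewal
    proof eventually_elim
      fix w :: "(int \<Rightarrow> int) \<times> (int \<Rightarrow> bool)" assume "\<exists>x\<ge>1. snd w x"
      then obtain x where "1 \<le> x" "snd w x" by blast
      then have "\<exists>k. snd w (int (Suc k))" by (intro exI[of _ "nat (x - 1)"]) auto
      then obtain k where k: "snd w (int (Suc k))" "\<And>l. l < k \<Longrightarrow> \<not> snd w (int (Suc l))"
        using exists_least_iff[of "\<lambda>k. snd w (int (Suc k))"] by blast
      have "no_renewal (snd w) k"
        unfolding no_renewal_def
      proof
        fix x assume "x \<in> {1..int k}"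
        then have "nat (x - 1) < k" "int (Suc (nat (x - 1))) = x" by auto
        then show "\<not> snd w x" using k(2)[of "nat (x - 1)"] by simp
      qed
      with k(1) show "w \<in> (\<Union>k. ?A k) \<longleftrightarrow> w \<in> space L" by auto
    qed
  qed auto
  finally show ?thesis by (simp add: L.emeasure_space_1)
qed

text \<open>
  The future of the stationary process: choose the age \<open>k\<close> since the last renewal and look at the
  path of law \<open>L\<close> from time \<open>k\<close> on, weighted by the event that there is no renewal up to \<open>k\<close>.
\<close>

definition stationary_future :: "((int \<Rightarrow> int) \<times> (int \<Rightarrow> bool)) measure" where
  "stationary_future = distr
     (density (count_space UNIV \<Otimes>\<^sub>M L) (\<lambda>(k, w). ennreal c * indicator {w. no_renewal (snd w) k} w))
     half_paths (\<lambda>(k, w). future (fst w) (snd w) (int k))"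

lemma sets_stationary_future [simp, measurable_cong]: "sets stationary_future = sets half_paths"
  by (simp add: stationary_future_def)

lemma emeasure_stationary_future:
  assumes A[measurable]: "A \<in> sets half_paths"
  shows "emeasure stationary_future A = (\<Sum>k. ennreal c *
    emeasure L {w \<in> space L. no_renewal (snd w) k \<and> future (fst w) (snd w) (int k) \<in> A})"
proof -
  note [measurable] = measurable_future_half_paths
  have f[measurable]: "(\<lambda>(k, w). future (fst w) (snd w) (int k)) \<in> count_space UNIV \<Otimes>\<^sub>M L \<rightarrow>\<^sub>M half_paths"
    by (rule measurable_pair_measure_countable1) (auto intro: measurable_future_half_paths simp: measurable_cong_sets[OF sets_L refl])
  have g[measurable]: "(\<lambda>(k, w). ennreal c * indicator {w. no_renewal (snd w) k} w) \<in> borel_measurable (count_space UNIV \<Otimes>\<^sub>M L)"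
    by (rule measurable_pair_measure_countable1) auto
  have "emeasure stationary_future A = (\<integral>\<^sup>+kw. (case kw of (k, w) \<Rightarrow> ennreal c * indicator {w. no_renewal (snd w) k} w) *
      indicator ((\<lambda>(k, w). future (fst w) (snd w) (int k)) -` A \<inter> space (count_space UNIV \<Otimes>\<^sub>M L)) kw
      \<partial>(count_space UNIV \<Otimes>\<^sub>M L))"
    unfolding stationary_future_def
    using measurable_sets[OF f A]
    by (subst emeasure_distr) (auto simp: emeasure_density)
  also have "\<dots> = (\<integral>\<^sup>+k. \<integral>\<^sup>+w. ennreal c * indicator {w. no_renewal (snd w) k} w *
      indicator ((\<lambda>(k, w). future (fst w) (snd w) (int k)) -` A \<inter> space (count_space UNIV \<Otimes>\<^sub>M L)) (k, w) \<partial>L \<partial>count_space UNIV)"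
    using measurable_sets[OF f A] by (subst L.nn_integral_fst[symmetric]) auto
  also have "\<dots> = (\<integral>\<^sup>+k. \<integral>\<^sup>+w. ennreal c * indicator {w \<in> space L. no_renewal (snd w) k \<and> future (fst w) (snd w) (int k) \<in> A} w \<partial>L \<partial>count_space UNIV)"
    by (intro nn_integral_cong) (auto simp: indicator_def space_pair_measure)
  also have "\<dots> = (\<Sum>k. ennreal c * emeasure L {w \<in> space L. no_renewal (snd w) k \<and> future (fst w) (snd w) (int k) \<in> A})"
    by (simp add: nn_integral_count_space_nat nn_integral_cmult_indicator)
  finally show ?thesis .
qed

lemma prob_space_stationary_future: "prob_space stationary_future"
proof
  have "emeasure stationary_future (space half_paths) = 1"
    using total measurable_space[OF measurable_future_half_paths]
    by (simp add: emeasure_stationary_future space_L cong: conj_cong)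
  then show "emeasure stationary_future (space stationary_future) = 1"
    by (simp add: sets_eq_imp_space_eq[OF sets_stationary_future])
qed

lemma emeasure_stationary_future_renewal:
  assumes A[measurable]: "A \<in> sets half_paths"
  shows "emeasure stationary_future {w \<in> space half_paths. snd w 1 \<and> future (fst w) (snd w) 1 \<in> A} =
    ennreal c * emeasure L A"
proof -
  note [measurable] = measurable_future_half_paths
  have eq: "{w \<in> space L. no_renewal (snd w) k \<and> future (fst w) (snd w) (int k) \<in>
        {w \<in> space half_paths. snd w 1 \<and> future (fst w) (snd w) 1 \<in> A}} =
      {w \<in> space L. no_renewal (snd w) k \<and> snd w (int (Suc k)) \<and> future (fst w) (snd w) (int (Suc k)) \<in> A}" for k
    using measurable_space[OF measurable_future_half_paths[of "int k"]]
    by (auto simp: space_L perm_after_perm_after ind_after_ind_after ind_after_apply add.commute)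
  have "emeasure stationary_future {w \<in> space half_paths. snd w 1 \<and> future (fst w) (snd w) 1 \<in> A} =
      (\<Sum>k. ennreal c * emeasure L {w \<in> space L. no_renewal (snd w) k \<and> future (fst w) (snd w) (int k) \<in>
        {w \<in> space half_paths. snd w 1 \<and> future (fst w) (snd w) 1 \<in> A}})"
    by (rule emeasure_stationary_future) measurable
  also have "\<dots> =
      (\<Sum>k. ennreal c * (emeasure L {w \<in> space L. no_renewal (snd w) k \<and> snd w (int (Suc k))} * emeasure L A))"
    unfolding eq regeneration[OF A] ..
  also have "\<dots> = ennreal c * ((\<Sum>k. emeasure L {w \<in> space L. no_renewal (snd w) k \<and> snd w (int (Suc k))}) * emeasure L A)"
    by simp
  finally show ?thesis by (simp only: suminf_first_renewal mult_1)
qed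

text \<open>
  Shifting by 1 turns age \<open>k\<close> into age \<open>k + 1\<close>, unless there is a renewal at the next time. These
  renewals contribute a total mass \<open>c\<close> of paths of law \<open>L\<close>, which replaces the paths of age 0.
\<close>

lemma distr_stationary_future:
  "distr stationary_future half_paths (\<lambda>w. future (fst w) (snd w) 1) = stationary_future"
proof (rule measure_eqI)
  fix A assume "A \<in> sets (distr stationary_future half_paths (\<lambda>w. future (fst w) (snd w) 1))"
  then have A[measurable]: "A \<in> sets half_paths" by simp
  note [measurable] = measurable_future_half_paths
  have sp: "space stationary_future = space half_paths" by (rule sets_eq_imp_space_eq) simp
  let ?a = "\<lambda>k. ennreal c * emeasure L {w \<in> space L. no_renewal (snd w) k \<and> future (fst w) (snd w) (int k) \<in> A}"
  let ?t = "\<lambda>k. emeasure L {w \<in> space L. no_renewal (snd w) k \<and> snd w (int (Suc k))}"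
  have "emeasure (distr stationary_future half_paths (\<lambda>w. future (fst w) (snd w) 1)) A =
      emeasure stationary_future {w \<in> space half_paths. future (fst w) (snd w) 1 \<in> A}"
    by (subst emeasure_distr) (auto simp: sp intro!: arg_cong[where f="emeasure stationary_future"])
  also have "\<dots> = (\<Sum>k. ennreal c * emeasure L {w \<in> space L. no_renewal (snd w) k \<and>
      future (fst w) (snd w) (int (Suc k)) \<in> A})"
  proof (subst emeasure_stationary_future)
    have "{w \<in> space L. no_renewal (snd w) k \<and> future (fst w) (snd w) (int k) \<in>
        {w \<in> space half_paths. future (fst w) (snd w) 1 \<in> A}} =
      {w \<in> space L. no_renewal (snd w) k \<and> future (fst w) (snd w) (int (Suc k)) \<in> A}" for k
      using measurable_space[OF measurable_future_half_paths[of "int k"]]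
      by (auto simp: space_L perm_after_perm_after ind_after_ind_after add.commute)
    then show "(\<Sum>k. ennreal c * emeasure L {w \<in> space L. no_renewal (snd w) k \<and> future (fst w) (snd w) (int k) \<in>
        {w \<in> space half_paths. future (fst w) (snd w) 1 \<in> A}}) = 
        (\<Sum>k. ennreal c * emeasure L {w \<in> space L. no_renewal (snd w) k \<and>
          future (fst w) (snd w) (int (Suc k)) \<in> A})" by simp
  qed measurable
  also have "\<dots> = (\<Sum>k. ?a (Suc k) + ennreal c * (?t k * emeasure L A))"
  proof (rule suminf_cong)
    fix k
    let ?U = "{w \<in> space L. no_renewal (snd w) (Suc k) \<and> future (fst w) (snd w) (int (Suc k)) \<in> A}"
    let ?V = "{w \<in> space L. no_renewal (snd w) k \<and> snd w (int (Suc k)) \<and> future (fst w) (snd w) (int (Suc k)) \<in> A}"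
    have eq: "{w \<in> space L. no_renewal (snd w) k \<and> future (fst w) (snd w) (int (Suc k)) \<in> A} = ?U \<union> ?V"
      unfolding no_renewal_Suc by blast
    have "emeasure L (?U \<union> ?V) = emeasure L ?U + emeasure L ?V"
      by (rule plus_emeasure[symmetric]) (auto simp: no_renewal_Suc simp del: of_nat_Suc)
    then show "ennreal c * emeasure L {w \<in> space L. no_renewal (snd w) k \<and> future (fst w) (snd w) (int (Suc k)) \<in> A}
        = ?a (Suc k) + ennreal c * (?t k * emeasure L A)"
      unfolding eq regeneration[OF A]
      by (simp only: distrib_left)
  qed
  also have "\<dots> = (\<Sum>k. ?a (Suc k)) + (\<Sum>k. ennreal c * (?t k * emeasure L A))"
    by (rule suminf_add[symmetric]) auto
  also have "(\<Sum>k. ennreal c * (?t k * emeasure L A)) = ennreal c * ((\<Sum>k. ?t k) * emeasure L A)"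
    by simp
  also have "\<dots> = ennreal c * emeasure L A"
    by (simp only: suminf_first_renewal mult_1)
  also have "\<dots> = ?a 0"
  proof -
    have "A \<subseteq> space L" using sets.sets_into_space[OF A] by (simp add: space_L)
    then have "{w \<in> space L. no_renewal (snd w) 0 \<and> future (fst w) (snd w) (int 0) \<in> A} = A"
      using future_zero by (auto simp: space_L)
    then show ?thesis by simp
  qed
  also have "(\<Sum>k. ?a (Suc k)) + ?a 0 = (\<Sum>k. ?a k)"
    using suminf_offset[of ?a 1] by (simp add: add.commute)
  also have "\<dots> = emeasure stationary_future A"
    by (rule emeasure_stationary_future[symmetric]) measurable
  finally show "emeasure (distr stationary_future half_paths (\<lambda>w. future (fst w) (snd w) 1)) A = emeasure stationary_future A" .
qed simp

end

text \<open>
  A two-sided process satisfying the Palm formula: at each \<open>z\<close> there is a renewal with probability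
  \<open>c\<close>, and given this renewal the future after \<open>z\<close> has law \<open>L\<close>.
\<close>

locale palm_process = N: prob_space N + L: prob_space L
  for N :: "'b measure" and L :: "((int \<Rightarrow> int) \<times> (int \<Rightarrow> bool)) measure" +
  fixes X :: "'b \<Rightarrow> int \<Rightarrow> int" and R :: "'b \<Rightarrow> int \<Rightarrow> bool" and c :: real
  assumes sets_L [measurable_cong]: "sets L = sets half_paths"
    and measurable_X [measurable]: "(\<lambda>\<omega>. X \<omega> z) \<in> N \<rightarrow>\<^sub>M count_space UNIV"
    and measurable_R [measurable]: "(\<lambda>\<omega>. R \<omega> z) \<in> N \<rightarrow>\<^sub>M count_space UNIV"
    and palm: "A \<in> sets half_paths \<Longrightarrow>
      emeasure N {\<omega> \<in> space N. R \<omega> z \<and> future (X \<omega>) (R \<omega>) z \<in> A} = ennreal c * emeasure L A"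
begin

lemma space_L: "space L = space half_paths"
  using sets_L by (rule sets_eq_imp_space_eq)

lemma measurable_future_X [measurable]: "(\<lambda>\<omega>. future (X \<omega>) (R \<omega>) z) \<in> N \<rightarrow>\<^sub>M half_paths"
  by (intro measurable_future measurable_X measurable_R)

text \<open>The last renewal up to time \<open>z\<close> is at \<open>z - k\<close>.\<close>

definition last_renewal :: "int \<Rightarrow> nat \<Rightarrow> 'b \<Rightarrow> bool" where
  "last_renewal z k \<omega> \<longleftrightarrow> R \<omega> (z - int k) \<and> (\<forall>x\<in>{z - int k<..z}. \<not> R \<omega> x)"

lemma pred_last_renewal [measurable]: "Measurable.pred N (last_renewal z k)"
  unfolding last_renewal_def by measurable

lemma last_renewal_unique: "last_renewal z k \<omega> \<Longrightarrow> last_renewal z l \<omega> \<Longrightarrow> k = l"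
proof (rule ccontr)
  assume *: "last_renewal z k \<omega>" "last_renewal z l \<omega>" and "k \<noteq> l"
  then consider "k < l" | "l < k" by linarith
  then show False using * by cases (auto simp: last_renewal_def)
qed

lemma last_renewal_law:
  assumes A[measurable]: "A \<in> sets half_paths"
  shows "emeasure N {\<omega> \<in> space N. last_renewal z k \<omega> \<and> future (X \<omega>) (R \<omega>) z \<in> A} =
    ennreal c * emeasure L {w \<in> space L. no_renewal (snd w) k \<and> future (fst w) (snd w) (int k) \<in> A}"
proof -
  note [measurable] = measurable_future_half_paths
  let ?C = "{w \<in> space half_paths. no_renewal (snd w) k \<and> future (fst w) (snd w) (int k) \<in> A}"
  have eq: "{\<omega> \<in> space N. last_renewal z k \<omega> \<and> future (X \<omega>) (R \<omega>) z \<in> A} =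
      {\<omega> \<in> space N. R \<omega> (z - int k) \<and> future (X \<omega>) (R \<omega>) (z - int k) \<in> ?C}"
  proof (rule Collect_cong)
    fix \<omega>
    have "future (X \<omega>) (R \<omega>) (z - int k) \<in> space half_paths" if "\<omega> \<in> space N"
      using measurable_space[OF measurable_future_X that] .
    then show "(\<omega> \<in> space N \<and> last_renewal z k \<omega> \<and> future (X \<omega>) (R \<omega>) z \<in> A) \<longleftrightarrow>
      (\<omega> \<in> space N \<and> R \<omega> (z - int k) \<and> future (X \<omega>) (R \<omega>) (z - int k) \<in> ?C)"
      unfolding last_renewal_def mem_Collect_eq fst_conv snd_conv no_renewal_ind_after
      by (simp add: perm_after_perm_after ind_after_ind_after) blast
  qed
  show ?thesis
    unfolding eq space_L by (rule palm) measurable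
qed

lemma last_renewal_prob:
  "emeasure N {\<omega> \<in> space N. last_renewal z k \<omega>} = ennreal c * emeasure L {w \<in> space L. no_renewal (snd w) k}"
proof -
  have "{\<omega> \<in> space N. last_renewal z k \<omega>} =
      {\<omega> \<in> space N. last_renewal z k \<omega> \<and> future (X \<omega>) (R \<omega>) z \<in> space half_paths}"
    using measurable_space[OF measurable_future_X[of z]] by blast
  moreover have "{w \<in> space L. no_renewal (snd w) k} =
      {w \<in> space L. no_renewal (snd w) k \<and> future (fst w) (snd w) (int k) \<in> space half_paths}"
    using measurable_space[OF measurable_future_half_paths[of "int k"]] unfolding space_L by force
  ultimately show ?thesis using last_renewal_law[OF sets.top, of z k] by simp
qed

lemma suminf_last_renewal:
  assumes [measurable]: "Measurable.pred N P"
  shows "(\<Sum>k. emeasure N {\<omega> \<in> space N. last_renewal z k \<omega> \<and> P \<omega>}) =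
    emeasure N {\<omega> \<in> space N. (\<exists>k. last_renewal z k \<omega>) \<and> P \<omega>}"
proof -
  have "(\<Sum>k. emeasure N {\<omega> \<in> space N. last_renewal z k \<omega> \<and> P \<omega>}) =
      emeasure N (\<Union>k. {\<omega> \<in> space N. last_renewal z k \<omega> \<and> P \<omega>})"
    by (rule suminf_emeasure) (auto simp: disjoint_family_on_def dest: last_renewal_unique)
  also have "(\<Union>k. {\<omega> \<in> space N. last_renewal z k \<omega> \<and> P \<omega>}) = {\<omega> \<in> space N. (\<exists>k. last_renewal z k \<omega>) \<and> P \<omega>}"
    by auto
  finally show ?thesis .
qed

text \<open>The events that \<open>-k\<close> is the last renewal up to time 0 are disjoint; for \<open>c > 0\<close> this forces a finite mean.\<close>

lemma suminf_no_renewal_le_1: "(\<Sum>k. ennreal c * emeasure L {w \<in> space L. no_renewal (snd w) k}) \<le> 1"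
  unfolding last_renewal_prob[of 0, symmetric]
  using suminf_last_renewal[of "\<lambda>_. True" 0] by (simp add: N.measure_le_1)

lemma AE_after_renewal:
  assumes "AE w in L. P w"
  shows "AE \<omega> in N. \<forall>z. R \<omega> z \<longrightarrow> P (future (X \<omega>) (R \<omega>) z)"
proof (rule AE_all_countable[THEN iffD2], rule allI)
  fix z
  obtain A where A: "{w \<in> space L. \<not> P w} \<subseteq> A" "A \<in> sets L" "emeasure L A = 0"
    using assms by (rule AE_E)
  have A': "A \<in> sets half_paths" using A(2) sets_L by simp
  let ?B = "{\<omega> \<in> space N. R \<omega> z \<and> future (X \<omega>) (R \<omega>) z \<in> A}"
  have "?B \<in> null_sets N"
    using palm[OF A', of z] A' A(3) by (intro null_setsI) auto
  moreover have "{\<omega> \<in> space N. \<not> (R \<omega> z \<longrightarrow> P (future (X \<omega>) (R \<omega>) z))} \<subseteq> ?B"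
    using A(1) measurable_space[OF measurable_future_X[of z]] by (auto simp: space_L)
  ultimately show "AE \<omega> in N. R \<omega> z \<longrightarrow> P (future (X \<omega>) (R \<omega>) z)"
    by (rule AE_I')
qed

end

text \<open>
  If \<open>1 / c\<close> equals the mean, then the probabilities of the possible positions of the last renewal up to
  \<open>z\<close> add up to 1. Hence there are renewals arbitrarily far to the left, and the law of the future
  after any \<open>z\<close> is determined by \<open>L\<close>.
\<close>

locale stationary_process = palm_process N L X R c + palm_law L c
  for N :: "'b measure" and L X R c
begin

lemma AE_last_renewal: "AE \<omega> in N. \<forall>z. \<exists>k. last_renewal z k \<omega>"
proof (rule AE_all_countable[THEN iffD2], rule allI)
  fix z
  have "emeasure N {\<omega> \<in> space N. \<exists>k. last_renewal z k \<omega>} = 1"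
    using suminf_last_renewal[of "\<lambda>_. True" z] total by (simp add: last_renewal_prob)
  then have "AE \<omega> in N. \<omega> \<in> {\<omega> \<in> space N. \<exists>k. last_renewal z k \<omega>}"
    by (intro N.AE_prob_1) (simp add: measure_def)
  then show "AE \<omega> in N. \<exists>k. last_renewal z k \<omega>" by eventually_elim auto
qed

lemma AE_unbounded: "AE \<omega> in N. \<forall>z. (\<exists>x\<le>z. R \<omega> x) \<and> (\<exists>x>z. R \<omega> x)"
  using AE_last_renewal AE_after_renewal[OF AE_ex_renewal]
proof eventually_elim
  fix \<omega> assume last: "\<forall>z. \<exists>k. last_renewal z k \<omega>"
    and "next": "\<forall>z. R \<omega> z \<longrightarrow> (\<exists>x\<ge>1. snd (future (X \<omega>) (R \<omega>) z) x)"
  show "\<forall>z. (\<exists>x\<le>z. R \<omega> x) \<and> (\<exists>x>z. R \<omega> x)"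
  proof
    fix z
    obtain k where k: "last_renewal z k \<omega>" using last by blast
    then have R: "R \<omega> (z - int k)" by (simp add: last_renewal_def)
    then obtain x where x: "1 \<le> x" "R \<omega> (z - int k + x)"
      using "next" by (auto simp: ind_after_def)
    moreover have "\<not> z - int k + x \<le> z" using k x by (auto simp: last_renewal_def)
    ultimately show "(\<exists>x\<le>z. R \<omega> x) \<and> (\<exists>x>z. R \<omega> x)"
      using R by (intro conjI exI[of _ "z - int k"] exI[of _ "z - int k + x"]) auto
  qed
qed

lemma law_future_stationary:
  "distr N half_paths (\<lambda>\<omega>. future (X \<omega>) (R \<omega>) z) = stationary_future"
proof (rule measure_eqI)
  fix A assume "A \<in> sets (distr N half_paths (\<lambda>\<omega>. future (X \<omega>) (R \<omega>) z))"
  then have A[measurable]: "A \<in> sets half_paths" by simp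
  have "emeasure (distr N half_paths (\<lambda>\<omega>. future (X \<omega>) (R \<omega>) z)) A =
      emeasure N {\<omega> \<in> space N. future (X \<omega>) (R \<omega>) z \<in> A}"
    by (subst emeasure_distr) (auto intro!: arg_cong[where f="emeasure N"])
  also have "\<dots> = emeasure N {\<omega> \<in> space N. (\<exists>k. last_renewal z k \<omega>) \<and> future (X \<omega>) (R \<omega>) z \<in> A}"
    by (rule emeasure_eq_AE) (use AE_last_renewal in \<open>auto elim!: eventually_mono\<close>)
  also have "\<dots> = (\<Sum>k. emeasure N {\<omega> \<in> space N. last_renewal z k \<omega> \<and> future (X \<omega>) (R \<omega>) z \<in> A})"
    by (rule suminf_last_renewal[symmetric]) measurable
  also have "\<dots> = emeasure stationary_future A"
    by (simp add: last_renewal_law[OF A] emeasure_stationary_future[OF A])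
  finally show "emeasure (distr N half_paths (\<lambda>\<omega>. future (X \<omega>) (R \<omega>) z)) A = emeasure stationary_future A" .
qed simp

end

lemma stationary_regenerative_rate:
  assumes st: "stationary_regenerative N X R L"
  shows "\<P>(\<omega> in N. R \<omega> z) = \<P>(\<omega> in N. R \<omega> 0)"
proof -
  have [measurable]: "(\<lambda>\<omega>. X \<omega> z) \<in> N \<rightarrow>\<^sub>M count_space UNIV" "(\<lambda>\<omega>. R \<omega> z) \<in> N \<rightarrow>\<^sub>M count_space UNIV" for z
    using st by (auto simp: stationary_regenerative_def random_perm_def)
  have m: "(\<lambda>\<omega> z. (X \<omega> (z + h) - (z + h), R \<omega> (z + h))) \<in> N \<rightarrow>\<^sub>M path_space UNIV" for h
    by (rule measurable_PiM_single') (auto simp: PiE_UNIV_domain intro!: measurable_Pair_count_space)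
  have A: "{v. snd (v 0)} \<in> sets (path_space (UNIV :: int set) :: (int \<Rightarrow> int \<times> bool) measure)"
  proof -
    have "(\<lambda>v::int \<Rightarrow> int \<times> bool. snd (v 0)) \<in> path_space UNIV \<rightarrow>\<^sub>M count_space UNIV"
      by (rule measurable_compose[OF measurable_component_singleton[of 0 UNIV]]) auto
    from predE[OF this] show ?thesis by simp
  qed
  have "measure (distr N (path_space UNIV) (\<lambda>\<omega> z. (X \<omega> (z + h) - (z + h), R \<omega> (z + h)))) {v. snd (v 0)} =
      \<P>(\<omega> in N. R \<omega> h)" for h
    by (subst measure_distr[OF m A]) (auto intro!: arg_cong[where f="measure N"])
  from this[of z] this[of 0] show ?thesis
    using st by (simp add: stationary_regenerative_def)
qed

lemma palm_process_stationary_regenerative: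
  assumes st: "stationary_regenerative N X R L" and L: "prob_space L" "sets L = sets half_paths"
  shows "palm_process N L X R (\<P>(\<omega> in N. R \<omega> 0))"
proof -
  interpret N: prob_space N using st by (simp add: stationary_regenerative_def)
  interpret L: prob_space L by fact
  let ?c = "\<P>(\<omega> in N. R \<omega> 0)"
  have pos: "0 < ?c" using st by (simp add: stationary_regenerative_def)
  have [measurable]: "(\<lambda>\<omega>. X \<omega> z) \<in> N \<rightarrow>\<^sub>M count_space UNIV" "(\<lambda>\<omega>. R \<omega> z) \<in> N \<rightarrow>\<^sub>M count_space UNIV" for z
    using st by (auto simp: stationary_regenerative_def random_perm_def)
  show ?thesis
  proof
    fix A :: "((int \<Rightarrow> int) \<times> (int \<Rightarrow> bool)) set" and z
    assume A: "A \<in> sets half_paths"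
    let ?R = "{\<omega> \<in> space N. R \<omega> z}" and ?f = "\<lambda>\<omega>. future (X \<omega>) (R \<omega>) z"
    have f[measurable]: "?f \<in> N \<rightarrow>\<^sub>M half_paths" by (rule measurable_future) measurable
    have f': "?f \<in> uniform_measure N ?R \<rightarrow>\<^sub>M half_paths"
      using f by (simp cong: measurable_cong_sets)
    have R: "measure N ?R = ?c" by (rule stationary_regenerative_rate[OF st])
    have "distr (given N (\<lambda>\<omega>. R \<omega> z)) half_paths ?f = L"
      using st by (simp add: stationary_regenerative_def)
    then have "measure L A = measure (uniform_measure N ?R) (?f -` A \<inter> space N)"
      using measure_distr[OF f' A] by (simp add: given_def)
    also have "\<dots> = measure N (?R \<inter> (?f -` A \<inter> space N)) / measure N ?R"
      using pos measurable_sets[OF f A]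
      by (intro measure_uniform_measure) (auto simp: N.emeasure_eq_measure R)
    also have "?R \<inter> (?f -` A \<inter> space N) = {\<omega> \<in> space N. R \<omega> z \<and> ?f \<omega> \<in> A}" by auto
    finally have "measure N {\<omega> \<in> space N. R \<omega> z \<and> ?f \<omega> \<in> A} = ?c * measure L A"
      using pos by (simp add: R field_simps)
    then show "emeasure N {\<omega> \<in> space N. R \<omega> z \<and> ?f \<omega> \<in> A} = ennreal ?c * emeasure L A"
      using pos by (simp add: N.emeasure_eq_measure L.emeasure_eq_measure ennreal_mult)
  qed (use L in auto)
qed

lemma (in regenerative_perm) positive_recurrent_if_stationary:
  assumes "stationary_regenerative N X' R' L"
  shows "positive_recurrent M Y"
proof -
  let ?c = "\<P>(\<omega> in N. R' \<omega> 0)"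
  interpret palm_process N L X' R' ?c
    by (rule palm_process_stationary_regenerative[OF assms L.prob_space_axioms sets_L])
  have "0 < ?c" using assms by (simp add: stationary_regenerative_def)
  moreover have "ennreal ?c * (\<integral>\<^sup>+\<omega>. ennreal_of_enat (Y 1 \<omega>) \<partial>M) \<le> 1"
    using suminf_no_renewal_le_1 by (simp add: suminf_no_renewal)
  ultimately show ?thesis
    unfolding positive_recurrent_def
    by (auto simp: less_top[symmetric] top_unique ennreal_mult_top)
qed

sublocale governed_perm \<subseteq> palm_law L "1 / \<mu>"
proof
  show "(\<Sum>k. ennreal (1 / \<mu>) * emeasure L {w \<in> space L. no_renewal (snd w) k}) = 1"
    using mean_pos by (simp add: suminf_no_renewal_eq ennreal_mult[symmetric])
  fix A k assume A: "A \<in> sets half_paths"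
  show "emeasure L {w \<in> space L. no_renewal (snd w) k \<and> snd w (int (Suc k)) \<and>
        future (fst w) (snd w) (int (Suc k)) \<in> A} =
      emeasure L {w \<in> space L. no_renewal (snd w) k \<and> snd w (int (Suc k))} * emeasure L A"
    using ex_renewal_pos regeneration_L[OF _ _ A, of _ k]
    by (auto simp: L.emeasure_eq_measure ennreal_mult)
qed (use mean_pos sets_L AE_bij_L in auto)

section \<open>Two-sided extension of a stationary law\<close>

lemma sets_borel_discrete [measurable_cong]: "sets (borel :: 'a discrete measure) = sets (count_space UNIV)"
  using open_discrete by (auto intro: borel_open)

lemma sets_half_paths_cylinder:
  assumes J: "finite J" and k: "\<And>i. i \<in> J \<Longrightarrow> 1 \<le> k i"
  shows "{w \<in> space half_paths. \<forall>i\<in>J. P i (fst w (k i)) (snd w (k i))} \<in> sets half_paths"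
proof (intro predE pred_intros_finite(3) J)
  fix i assume "i \<in> J"
  then have "(\<lambda>w. (fst w (k i), snd w (k i))) \<in> half_paths \<rightarrow>\<^sub>M count_space UNIV"
    using k by (intro measurable_Pair_count_space measurable_half_paths_component)
  then have "(\<lambda>w. case (fst w (k i), snd w (k i)) of (x, y) \<Rightarrow> P i x y) \<in> half_paths \<rightarrow>\<^sub>M count_space UNIV"
    by (rule measurable_compose) simp
  then show "Measurable.pred half_paths (\<lambda>w. P i (fst w (k i)) (snd w (k i)))" by simp
qed

lemma shift_invariant_int:
  assumes S0: "sets S0 = sets half_paths" "distr S0 half_paths (\<lambda>w. future (fst w) (snd w) 1) = S0"
  shows "distr S0 half_paths (\<lambda>w. future (fst w) (snd w) (int k)) = S0"
proof (induction k)
  case 0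
  have "distr S0 half_paths (\<lambda>w. future (fst w) (snd w) (int 0)) = distr S0 S0 (\<lambda>w. w)"
    using S0(1) sets_eq_imp_space_eq[OF S0(1)] future_zero by (intro distr_cong) simp_all
  then show ?case by (simp add: distr_id)
next
  case (Suc k)
  have f: "(\<lambda>w. future (fst w) (snd w) (int k)) \<in> S0 \<rightarrow>\<^sub>M half_paths"
    using measurable_future_half_paths[of "int k"] by (simp add: measurable_cong_sets[OF S0(1) refl])
  have "distr S0 half_paths (\<lambda>w. future (fst w) (snd w) 1) =
      distr (distr S0 half_paths (\<lambda>w. future (fst w) (snd w) (int k))) half_paths (\<lambda>w. future (fst w) (snd w) 1)"
    by (simp only: Suc)
  also have "\<dots> = distr S0 half_paths (\<lambda>w. future (fst w) (snd w) (int (Suc k)))"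
    by (subst distr_distr[OF measurable_future_half_paths f])
      (simp_all add: comp_def perm_after_perm_after ind_after_ind_after add.commute)
  finally show ?case using S0(2) by simp
qed

text \<open>
  A law on half paths that is invariant under the shift is the law of all futures of a two-sided
  path. The finite-dimensional laws of the displacements and indicators are read off at a position
  so far to the right that only positive times are involved, and Kolmogorov's theorem applies.
\<close>

lemma two_sided_extension:
  assumes "prob_space S0" and sets: "sets S0 = sets half_paths"
    and inv: "distr S0 half_paths (\<lambda>w. future (fst w) (snd w) 1) = S0"
  shows "\<exists>S. prob_space S \<and> sets S = sets (path_space UNIV \<Otimes>\<^sub>M path_space UNIV) \<and>
    (\<forall>z. distr S half_paths (\<lambda>w. future (fst w) (snd w) z) = S0)"
proof -
  interpret S0: prob_space S0 by fact
  have space: "space S0 = space half_paths" using sets by (rule sets_eq_imp_space_eq)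
  note [measurable_cong] = sets
  \<comment> \<open>The displacements and indicators at the times in \<open>J\<close>, read off at \<open>J + s\<close>. Values are put into the
    discrete topology, in order to have a Polish space.\<close>
  define F :: "int \<Rightarrow> int set \<Rightarrow> (int \<Rightarrow> int) \<times> (int \<Rightarrow> bool) \<Rightarrow> int \<Rightarrow> (int \<times> bool) discrete"
    where "F s J w = (\<lambda>i\<in>J. discrete (fst w (i + s) - (i + s), snd w (i + s)))" for s J w
  have F: "F s J \<in> S0 \<rightarrow>\<^sub>M PiM J (\<lambda>_. borel)" if "\<And>i. i \<in> J \<Longrightarrow> 1 \<le> i + s" for s J
    unfolding F_def
  proof (rule measurable_restrict)
    fix i assume i: "i \<in> J"
    have [measurable]: "(\<lambda>w. fst w (i + s)) \<in> S0 \<rightarrow>\<^sub>M count_space UNIV" "(\<lambda>w. snd w (i + s)) \<in> S0 \<rightarrow>\<^sub>M count_space UNIV"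
      using measurable_half_paths_component[OF that[OF i]] by (simp_all add: measurable_cong_sets[OF sets refl])
    have "(\<lambda>w. (fst w (i + s) - (i + s), snd w (i + s))) \<in> S0 \<rightarrow>\<^sub>M count_space UNIV"
      by (rule measurable_Pair_count_space) measurable
    then have "(\<lambda>w. discrete (fst w (i + s) - (i + s), snd w (i + s))) \<in> S0 \<rightarrow>\<^sub>M count_space UNIV"
      by (rule measurable_compose) simp
    then show "(\<lambda>w. discrete (fst w (i + s) - (i + s), snd w (i + s))) \<in> borel_measurable S0"
      by (simp add: measurable_cong_sets[OF refl sets_borel_discrete])
  qed
  have shift_le: "distr S0 (PiM J (\<lambda>_. borel)) (F s J) = distr S0 (PiM J (\<lambda>_. borel)) (F t J)"
    if s: "\<And>i. i \<in> J \<Longrightarrow> 1 \<le> i + s" and st: "s \<le> t" for s t J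
  proof -
    let ?g = "\<lambda>w. future (fst w) (snd w) (int (nat (t - s)))"
    have g: "?g \<in> S0 \<rightarrow>\<^sub>M half_paths"
      using measurable_future_half_paths by (simp add: measurable_cong_sets[OF sets refl])
    have F': "F s J \<in> half_paths \<rightarrow>\<^sub>M PiM J (\<lambda>_. borel)"
      using F[of J s] s by (simp add: measurable_cong_sets[OF sets refl])
    have "distr S0 (PiM J (\<lambda>_. borel)) (F s J) = distr (distr S0 half_paths ?g) (PiM J (\<lambda>_. borel)) (F s J)"
      by (simp only: shift_invariant_int[OF sets inv])
    also have "\<dots> = distr S0 (PiM J (\<lambda>_. borel)) (F s J \<circ> ?g)"
      by (rule distr_distr[OF F' g])
    also have "F s J \<circ> ?g = F t J"
      using s st by (auto simp: F_def fun_eq_iff perm_after_def ind_after_def algebra_simps)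
    finally show ?thesis .
  qed
  have shift: "distr S0 (PiM J (\<lambda>_. borel)) (F s J) = distr S0 (PiM J (\<lambda>_. borel)) (F t J)"
    if "\<And>i. i \<in> J \<Longrightarrow> 1 \<le> i + s" "\<And>i. i \<in> J \<Longrightarrow> 1 \<le> i + t" for s t J
  proof (cases "s \<le> t")
    case True
    with that(1) show ?thesis by (rule shift_le)
  next
    case False
    then have "t \<le> s" by simp
    with that(2) show ?thesis by (rule shift_le[symmetric])
  qed
  define s where "s J = 1 + (\<Sum>i\<in>J. \<bar>i\<bar>)" for J :: "int set"
  have s: "1 \<le> i + s J" if "finite J" "i \<in> J" for i J
    using member_le_sum[of i J abs] that unfolding s_def by fastforce
  define P where "P J = distr S0 (PiM J (\<lambda>_. borel)) (F (s J) J)" for J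
  have P_eq: "P J = distr S0 (PiM J (\<lambda>_. borel)) (F t J)"
    if "finite J" "\<And>i. i \<in> J \<Longrightarrow> 1 \<le> i + t" for J t
    unfolding P_def using s that by (intro shift) auto
  interpret P: polish_projective UNIV P
  proof (intro polish_projective.intro projective_family.intro)
    fix J H :: "int set" assume JH: "J \<subseteq> H" "finite H"
    have "distr (P H) (PiM J (\<lambda>_. borel)) (\<lambda>f. restrict f J) =
        distr S0 (PiM J (\<lambda>_. borel)) ((\<lambda>f. restrict f J) \<circ> F (s H) H)"
      unfolding P_def using F s JH by (intro distr_distr measurable_restrict_subset) auto
    also have "(\<lambda>f. restrict f J) \<circ> F (s H) H = F (s H) J"
      using JH by (auto simp: F_def fun_eq_iff)
    also have "distr S0 (PiM J (\<lambda>_. borel)) (F (s H) J) = P J"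
      using s JH by (intro P_eq[symmetric]) (auto intro: finite_subset)
    finally show "P J = distr (P H) (PiM J (\<lambda>_. borel)) (\<lambda>f. restrict f J)" by (rule sym)
  next
    fix J :: "int set" assume "finite J"
    then show "prob_space (P J)"
      unfolding P_def using F s by (intro S0.prob_space_distr) auto
  qed
  let ?K = "path_space UNIV \<Otimes>\<^sub>M path_space UNIV :: ((int \<Rightarrow> int) \<times> (int \<Rightarrow> bool)) measure"
  define G :: "(int \<Rightarrow> (int \<times> bool) discrete) \<Rightarrow> (int \<Rightarrow> int) \<times> (int \<Rightarrow> bool)"
    where "G x = (\<lambda>z. fst (of_discrete (x z)) + z, \<lambda>z. snd (of_discrete (x z)))" for x
  have comp: "(\<lambda>x. h (x z)) \<in> P.lim \<rightarrow>\<^sub>M count_space UNIV" for h :: "(int \<times> bool) discrete \<Rightarrow> 'c" and z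
  proof -
    have "(\<lambda>x. x z) \<in> P.lim \<rightarrow>\<^sub>M (borel :: (int \<times> bool) discrete measure)"
      unfolding measurable_cong_sets[OF P.sets_lim refl] by (rule measurable_component_singleton) simp
    then have "(\<lambda>x. x z) \<in> P.lim \<rightarrow>\<^sub>M (count_space UNIV :: (int \<times> bool) discrete measure)"
      by (simp add: measurable_cong_sets[OF refl sets_borel_discrete])
    then show ?thesis by (rule measurable_compose) simp
  qed
  have G: "G \<in> P.lim \<rightarrow>\<^sub>M ?K"
    unfolding G_def by (intro measurable_Pair measurable_PiM_single') (auto simp: PiE_UNIV_domain intro: comp)
  define S where "S = distr P.lim ?K G"
  have "distr S half_paths (\<lambda>w. future (fst w) (snd w) z) = S0" for z
  proof (rule measure_eqI_pair_cylinders[where I = "{1..}"])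
    have fut: "(\<lambda>w. future (fst w) (snd w) z) \<in> ?K \<rightarrow>\<^sub>M half_paths"
      by (rule measurable_future) (auto intro!: measurable_compose[OF measurable_fst] measurable_compose[OF measurable_snd])
    have S_fut: "distr S half_paths (\<lambda>w. future (fst w) (snd w) z) =
        distr P.lim half_paths ((\<lambda>w. future (fst w) (snd w) z) \<circ> G)"
      unfolding S_def by (rule distr_distr[OF fut G])
    note futG = measurable_comp[OF G fut]
    show "finite_measure (distr S half_paths (\<lambda>w. future (fst w) (snd w) z))"
      unfolding S_fut using futG by (intro P.P.finite_measure_distr)
    fix J :: "int set" assume J: "finite J" "J \<subseteq> {1..}"
    show "\<exists>J'. finite J' \<and> J \<subseteq> J' \<and> J' \<subseteq> {1..} \<and>
      (\<forall>a b. emeasure (distr S half_paths (\<lambda>w. future (fst w) (snd w) z)) {w \<in> space half_paths. \<forall>i\<in>J'. fst w i = a i \<and> snd w i = b i} =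
             emeasure S0 {w \<in> space half_paths. \<forall>i\<in>J'. fst w i = a i \<and> snd w i = b i})"
    proof (intro exI[of _ J] conjI allI)
      fix a b
      let ?C = "{w \<in> space half_paths. \<forall>i\<in>J. fst w i = a i \<and> snd w i = b i}"
      have C: "?C \<in> sets half_paths"
        using J by (intro sets_half_paths_cylinder[where P = "\<lambda>i x y. x = a i \<and> y = b i"]) auto
      define J' where "J' = (\<lambda>i. z + i) ` J"
      have J': "finite J'" using J by (simp add: J'_def)
      define D where "D = {v \<in> space (PiM J' (\<lambda>_. borel)). \<forall>i\<in>J. v (z + i) = discrete (a i - i, b i)}"
      have D: "D \<in> sets (PiM J' (\<lambda>_. borel))"
        unfolding D_def
      proof (intro predE pred_intros_finite(3) J)
        fix i assume "i \<in> J"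
        then have "(\<lambda>v. v (z + i)) \<in> PiM J' (\<lambda>_. borel) \<rightarrow>\<^sub>M (borel :: (int \<times> bool) discrete measure)"
          by (intro measurable_component_singleton) (simp add: J'_def)
        then have "(\<lambda>v. v (z + i)) \<in> PiM J' (\<lambda>_. borel) \<rightarrow>\<^sub>M (count_space UNIV :: (int \<times> bool) discrete measure)"
          by (simp add: measurable_cong_sets[OF refl sets_borel_discrete])
        then show "Measurable.pred (PiM J' (\<lambda>_. borel)) (\<lambda>v. v (z + i) = discrete (a i - i, b i))"
          by measurable
      qed
      have "emeasure (distr S half_paths (\<lambda>w. future (fst w) (snd w) z)) ?C =
          emeasure P.lim (((\<lambda>w. future (fst w) (snd w) z) \<circ> G) -` ?C \<inter> space P.lim)"
        unfolding S_fut by (rule emeasure_distr[OF futG C])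
      also have "((\<lambda>w. future (fst w) (snd w) z) \<circ> G) -` ?C \<inter> space P.lim = P.emb UNIV J' D"
      proof (rule set_eqI)
        fix x :: "int \<Rightarrow> (int \<times> bool) discrete"
        have ev: "(fst (of_discrete d) + (z + i) - z = a i \<and> snd (of_discrete d) = b i) \<longleftrightarrow> d = discrete (a i - i, b i)" for d i
          by (cases d) (auto simp: discrete_inverse discrete_inject)
        have "x \<in> ((\<lambda>w. future (fst w) (snd w) z) \<circ> G) -` ?C \<inter> space P.lim \<longleftrightarrow>
            (\<forall>i\<in>J. fst (of_discrete (x (z + i))) + (z + i) - z = a i \<and> snd (of_discrete (x (z + i))) = b i)"
          using J by (auto simp: G_def perm_after_def ind_after_def space_PiM space_pair_measure P.space_lim PiE_UNIV_domain subset_iff)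
        also have "\<dots> \<longleftrightarrow> x \<in> P.emb UNIV J' D"
          unfolding ev by (auto simp: prod_emb_def D_def J'_def space_PiM)
        finally show "x \<in> ((\<lambda>w. future (fst w) (snd w) z) \<circ> G) -` ?C \<inter> space P.lim \<longleftrightarrow> x \<in> P.emb UNIV J' D" .
      qed
      also have "emeasure P.lim (P.emb UNIV J' D) = emeasure (P J') D"
        using J' D by (intro P.emeasure_lim_emb) auto
      \<comment> \<open>The times in \<open>J' = z + J\<close> may be read off at \<open>J\<close>, the shift being \<open>- z\<close>.\<close>
      also have "P J' = distr S0 (PiM J' (\<lambda>_. borel)) (F (- z) J')"
        using J J' by (intro P_eq) (auto simp: J'_def)
      also have "emeasure \<dots> D = emeasure S0 (F (- z) J' -` D \<inter> space S0)"
        using J by (intro emeasure_distr[OF F D]) (auto simp: J'_def)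
      also have "F (- z) J' -` D \<inter> space S0 = ?C"
        by (auto simp: F_def D_def J'_def space space_PiM discrete_inject)
      finally show "emeasure (distr S half_paths (\<lambda>w. future (fst w) (snd w) z)) ?C = emeasure S0 ?C" .
    qed (use J in auto)
  qed (use sets in auto)
  moreover have "prob_space S" unfolding S_def by (rule P.P.prob_space_distr[OF G])
  moreover have "sets S = sets ?K" by (simp add: S_def)
  ultimately show ?thesis by blast
qed

section \<open>Existence and uniqueness of the stationary version\<close>

lemma ex_lower_bound_int:
  assumes "finite (J :: int set)"
  shows "\<exists>z. \<forall>i\<in>J. 1 \<le> i - z"
proof -
  have "bdd_below J" using assms by (rule bdd_below_finite)
  then obtain m where "\<And>i. i \<in> J \<Longrightarrow> m \<le> i" by (auto simp: bdd_below_def)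
  then show ?thesis by (intro exI[of _ "m - 1"]) auto
qed

text \<open>The laws of all futures determine the law of a two-sided path.\<close>

lemma measure_eqI_futures:
  assumes S: "sets S = sets (path_space UNIV \<Otimes>\<^sub>M path_space UNIV)" "finite_measure S"
    and S': "sets S' = sets (path_space UNIV \<Otimes>\<^sub>M path_space UNIV)"
    and eq: "\<And>z. distr S half_paths (\<lambda>w. future (fst w) (snd w) z) = distr S' half_paths (\<lambda>w. future (fst w) (snd w) z)"
  shows "S = S'"
proof (rule measure_eqI_pair_cylinders[OF S S'])
  fix J :: "int set" assume J: "finite J"
  let ?K = "path_space UNIV \<Otimes>\<^sub>M path_space UNIV :: ((int \<Rightarrow> int) \<times> (int \<Rightarrow> bool)) measure"
  obtain z where z: "\<And>i. i \<in> J \<Longrightarrow> 1 \<le> i - z" using ex_lower_bound_int[OF J] by blast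
  have fut: "(\<lambda>w. future (fst w) (snd w) z) \<in> ?K \<rightarrow>\<^sub>M half_paths"
    by (rule measurable_future) (auto intro!: measurable_compose[OF measurable_fst] measurable_compose[OF measurable_snd])
  have "emeasure S {w \<in> space ?K. \<forall>i\<in>J. fst w i = a i \<and> snd w i = b i} =
      emeasure S' {w \<in> space ?K. \<forall>i\<in>J. fst w i = a i \<and> snd w i = b i}" for a b
  proof -
    let ?C = "{w \<in> space half_paths. \<forall>i\<in>J. fst w (i - z) = a i - z \<and> snd w (i - z) = b i}"
    have C: "?C \<in> sets half_paths"
      using J z by (intro sets_half_paths_cylinder[where P = "\<lambda>i x y. x = a i - z \<and> y = b i"]) force+
    have "emeasure R {w \<in> space ?K. \<forall>i\<in>J. fst w i = a i \<and> snd w i = b i} =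
        emeasure (distr R half_paths (\<lambda>w. future (fst w) (snd w) z)) ?C" if R: "sets R = sets ?K" for R
    proof -
      have f: "(\<lambda>w. future (fst w) (snd w) z) \<in> R \<rightarrow>\<^sub>M half_paths"
        using fut by (simp add: measurable_cong_sets[OF R refl])
      have "space R = space ?K" using R by (rule sets_eq_imp_space_eq)
      then have "(\<lambda>w. future (fst w) (snd w) z) -` ?C \<inter> space R = {w \<in> space ?K. \<forall>i\<in>J. fst w i = a i \<and> snd w i = b i}"
        using z measurable_space[OF fut] by (auto simp: perm_after_def ind_after_def space_pair_measure)
      then show ?thesis by (simp only: emeasure_distr[OF f C])
    qed
    from this[OF S(1)] this[OF S'] show ?thesis by (simp only: eq)
  qed
  then show "\<exists>J'. finite J' \<and> J \<subseteq> J' \<and> J' \<subseteq> UNIV \<and>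
      (\<forall>a b. emeasure S {w \<in> space ?K. \<forall>i\<in>J'. fst w i = a i \<and> snd w i = b i} =
             emeasure S' {w \<in> space ?K. \<forall>i\<in>J'. fst w i = a i \<and> snd w i = b i})"
    using J by (intro exI[of _ J]) simp
qed

lemma splits_at_if_bij_future:
  assumes bij: "bij_betw \<pi> UNIV UNIV" and fut: "bij_betw (perm_after \<pi> z) {1..} {1..}"
  shows "splits_at UNIV \<pi> z"
proof -
  have "\<pi> ` {z<..} = {z<..}"
  proof -
    have 1: "(\<lambda>i. z + i) ` {1..} = {z<..}"
      by (auto simp: image_iff intro!: bexI[of _ "_ - z"])
    have "\<pi> ` (\<lambda>i. z + i) ` {1..} = (\<lambda>i. z + i) ` perm_after \<pi> z ` {1..}"
      unfolding image_image by (simp add: perm_after_def)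
    also have "perm_after \<pi> z ` {1..} = {1..}" using fut by (rule bij_betw_imp_surj_on)
    finally show ?thesis unfolding 1 .
  qed
  moreover have "{..z} = - {z<..}" by auto
  moreover have "\<pi> ` (- {z<..}) = - \<pi> ` {z<..}" using bij by (rule bij_image_Compl_eq)
  ultimately have "\<pi> ` {..z} = {..z}" by (simp only:)
  then show ?thesis by (simp add: splits_at_def)
qed

lemma bij_if_bij_futures:
  assumes unb: "\<And>z :: int. \<exists>x\<le>z. r x"
    and fut: "\<And>z. r z \<Longrightarrow> bij_betw (perm_after \<pi> z) {1..} {1..}"
  shows "bij_betw \<pi> UNIV UNIV"
proof -
  have inj: "x = y" if "\<pi> x = \<pi> y" for x y
  proof -
    obtain z where z: "z \<le> min x y - 1" "r z" using unb by blast
    then have "inj_on (perm_after \<pi> z) {1..}" using fut bij_betw_imp_inj_on by blast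
    moreover have "perm_after \<pi> z (x - z) = perm_after \<pi> z (y - z)" "x - z \<in> {1..}" "y - z \<in> {1..}"
      using z that by (auto simp: perm_after_def)
    ultimately show ?thesis by (auto dest: inj_onD)
  qed
  have "y \<in> range \<pi>" for y
  proof -
    obtain z where z: "z \<le> y - 1" "r z" using unb by blast
    then have "y - z \<in> perm_after \<pi> z ` {1..}" using fut[OF z(2)] by (simp add: bij_betw_def)
    then obtain i where "1 \<le> i" "y - z = \<pi> (z + i) - z" by (auto simp: perm_after_def)
    then have "y = \<pi> (z + i)" by simp
    then show ?thesis by blast
  qed
  then show ?thesis using inj by (auto simp: bij_betw_def inj_on_def)
qed

lemma (in palm_law) ex_stationary_regenerative:
  "\<exists>S. sets S = sets (path_space UNIV \<Otimes>\<^sub>M path_space UNIV) \<and>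
    stationary_regenerative S fst snd L \<and> (\<forall>z. \<P>(w in S. snd w z) = c)"
proof -
  let ?K = "path_space UNIV \<Otimes>\<^sub>M path_space UNIV :: ((int \<Rightarrow> int) \<times> (int \<Rightarrow> bool)) measure"
  obtain S where S: "prob_space S" "sets S = sets ?K"
    and law: "\<And>z. distr S half_paths (\<lambda>w. future (fst w) (snd w) z) = stationary_future"
    using two_sided_extension[OF prob_space_stationary_future sets_stationary_future distr_stationary_future] by blast
  interpret S: prob_space S by fact
  note [measurable_cong] = S(2)
  have comp[measurable]: "(\<lambda>w. fst w z) \<in> S \<rightarrow>\<^sub>M count_space UNIV" "(\<lambda>w. snd w z) \<in> S \<rightarrow>\<^sub>M count_space UNIV" for z
    by (auto simp: measurable_cong_sets[OF S(2) refl] intro!: measurable_compose[OF measurable_fst] measurable_compose[OF measurable_snd])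
  have fut[measurable]: "(\<lambda>w. future (fst w) (snd w) z) \<in> S \<rightarrow>\<^sub>M half_paths" for z
    by (intro measurable_future comp)
  have law': "emeasure S {w \<in> space S. future (fst w) (snd w) z \<in> A} = emeasure stationary_future A"
    if "A \<in> sets half_paths" for z A
  proof -
    have "{w \<in> space S. future (fst w) (snd w) z \<in> A} = (\<lambda>w. future (fst w) (snd w) z) -` A \<inter> space S" by auto
    then show ?thesis using emeasure_distr[OF fut[of z] that] by (simp only: law)
  qed
  have palm: "emeasure S {w \<in> space S. snd w z \<and> future (fst w) (snd w) z \<in> A} = ennreal c * emeasure L A"
    if A[measurable]: "A \<in> sets half_paths" for z A
  proof -
    note [measurable] = measurable_future_half_paths
    let ?C = "{w \<in> space half_paths. snd w 1 \<and> future (fst w) (snd w) 1 \<in> A}"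
    have eq: "{w \<in> space S. snd w z \<and> future (fst w) (snd w) z \<in> A} = {w \<in> space S. future (fst w) (snd w) (z - 1) \<in> ?C}"
    proof (rule Collect_cong)
      fix w
      have "future (fst w) (snd w) (z - 1) \<in> space half_paths" if "w \<in> space S"
        using measurable_space[OF fut that] .
      then show "(w \<in> space S \<and> snd w z \<and> future (fst w) (snd w) z \<in> A) \<longleftrightarrow>
          (w \<in> space S \<and> future (fst w) (snd w) (z - 1) \<in> ?C)"
        unfolding mem_Collect_eq fst_conv snd_conv
        by (simp add: perm_after_perm_after ind_after_ind_after ind_after_apply) blast
    qed
    have "emeasure S {w \<in> space S. future (fst w) (snd w) (z - 1) \<in> ?C} = emeasure stationary_future ?C"
      by (rule law') measurable
    then show ?thesis
      unfolding eq emeasure_stationary_future_renewal[OF A] .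
  qed
  interpret st: stationary_process S L fst snd c
    by standard (use sets_L palm in auto)
  have rate: "\<P>(w in S. snd w z) = c" for z
  proof -
    have "{w \<in> space S. snd w z} = {w \<in> space S. snd w z \<and> future (fst w) (snd w) z \<in> space half_paths}"
      using measurable_space[OF fut] by blast
    then have "emeasure S {w \<in> space S. snd w z} = ennreal c * emeasure L (space half_paths)"
      using palm[OF sets.top, of z] by (simp only:)
    then have "emeasure S {w \<in> space S. snd w z} = ennreal c"
      using L.emeasure_space_1 by (simp add: space_L)
    then show ?thesis using c_pos by (simp add: measure_def)
  qed
  have bij: "AE w in S. bij_betw (fst w) UNIV UNIV \<and> (\<forall>z. snd w z \<longrightarrow> splits_at UNIV (fst w) z)"
    using st.AE_unbounded st.AE_after_renewal[OF AE_bij]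
  proof eventually_elim
    fix w :: "(int \<Rightarrow> int) \<times> (int \<Rightarrow> bool)"
    assume unb: "\<forall>z. (\<exists>x\<le>z. snd w x) \<and> (\<exists>x>z. snd w x)"
      and b: "\<forall>z. snd w z \<longrightarrow> bij_betw (fst (future (fst w) (snd w) z)) {1..} {1..}"
    have "bij_betw (fst w) UNIV UNIV"
      by (rule bij_if_bij_futures[of "snd w"]) (use unb b in auto)
    with b show "bij_betw (fst w) UNIV UNIV \<and> (\<forall>z. snd w z \<longrightarrow> splits_at UNIV (fst w) z)"
      by (auto intro: splits_at_if_bij_future)
  qed
  have stat: "distr S (path_space UNIV) (\<lambda>w z. (fst w (z + h) - (z + h), snd w (z + h))) =
      distr S (path_space UNIV) (\<lambda>w z. (fst w z - z, snd w z))" for h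
  proof -
    let ?D = "\<lambda>h (w :: (int \<Rightarrow> int) \<times> (int \<Rightarrow> bool)) z. (fst w (z + h) - (z + h), snd w (z + h))"
    have m: "?D h \<in> S \<rightarrow>\<^sub>M path_space UNIV" for h
      by (rule measurable_PiM_single') (auto simp: PiE_UNIV_domain intro!: measurable_Pair_count_space)
    have "distr S (path_space UNIV) (?D h) = distr S (path_space UNIV) (?D 0)"
    proof (rule measure_eqI_cylinders[where K = "path_space UNIV" and I = UNIV and h = "\<lambda>v. v" and g = "\<lambda>v. v"])
      fix J :: "int set" assume J: "finite J"
      obtain z where z: "\<And>i. i \<in> J \<Longrightarrow> 1 \<le> i - z" using ex_lower_bound_int[OF J] by blast
      have key: "emeasure (distr S (path_space UNIV) (?D h)) {v \<in> space (path_space UNIV). \<forall>i\<in>J. v i = y i} =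
          emeasure stationary_future {w \<in> space half_paths. \<forall>i\<in>J. fst w (i - z) - (i - z) = fst (y i) \<and> snd w (i - z) = snd (y i)}"
          (is "emeasure _ ?E = emeasure _ ?C") for h y
      proof -
        have E: "?E \<in> sets (path_space UNIV)"
        proof (intro predE pred_intros_finite(3) J)
          fix i :: int
          show "Measurable.pred (path_space UNIV) (\<lambda>v. v i = y i)"
            by (rule measurable_compose[OF measurable_component_singleton[of i UNIV]]) auto
        qed
        have C: "?C \<in> sets half_paths"
          using J z
          by (intro sets_half_paths_cylinder[where P = "\<lambda>i x y'. x - (i - z) = fst (y i) \<and> y' = snd (y i)"]) force+
        have "emeasure (distr S (path_space UNIV) (?D h)) ?E = emeasure S (?D h -` ?E \<inter> space S)"
          by (rule emeasure_distr[OF m E])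
        also have "?D h -` ?E \<inter> space S = {w \<in> space S. future (fst w) (snd w) (z + h) \<in> ?C}"
          using z measurable_space[OF fut, of _ "z + h"]
          by (auto simp: perm_after_def ind_after_def prod_eq_iff algebra_simps)
        also have "emeasure S \<dots> = emeasure stationary_future ?C" by (rule law'[OF C])
        finally show ?thesis .
      qed
      show "\<exists>J'. finite J' \<and> J \<subseteq> J' \<and> J' \<subseteq> UNIV \<and>
        (\<forall>y. emeasure (distr S (path_space UNIV) (?D h)) {v \<in> space (path_space UNIV). \<forall>i\<in>J'. v i = y i} =
             emeasure (distr S (path_space UNIV) (?D 0)) {v \<in> space (path_space UNIV). \<forall>i\<in>J'. v i = y i})"
        using J by (intro exI[of _ J] conjI allI) (simp_all only: key subset_refl subset_UNIV)
    qed (use m in \<open>auto intro!: S.finite_measure_distr\<close>)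
    then show ?thesis by simp
  qed
  have given: "distr (given S (\<lambda>w. snd w z)) half_paths (\<lambda>w. future (fst w) (snd w) z) = L" for z
  proof (rule measure_eqI)
    fix A assume "A \<in> sets (distr (given S (\<lambda>w. snd w z)) half_paths (\<lambda>w. future (fst w) (snd w) z))"
    then have A[measurable]: "A \<in> sets half_paths" by simp
    let ?R = "{w \<in> space S. snd w z}" and ?f = "\<lambda>w. future (fst w) (snd w) z"
    have f': "?f \<in> uniform_measure S ?R \<rightarrow>\<^sub>M half_paths"
      using fut by (simp cong: measurable_cong_sets)
    have eR: "emeasure S ?R = ennreal c" by (simp add: S.emeasure_eq_measure rate)
    have "emeasure (distr (given S (\<lambda>w. snd w z)) half_paths ?f) A = emeasure (uniform_measure S ?R) (?f -` A \<inter> space S)"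
      using emeasure_distr[OF f' A] by (simp add: given_def)
    also have "\<dots> = emeasure S (?R \<inter> (?f -` A \<inter> space S)) / emeasure S ?R"
      using measurable_sets[OF fut A] by (intro emeasure_uniform_measure) auto
    also have "?R \<inter> (?f -` A \<inter> space S) = {w \<in> space S. snd w z \<and> ?f w \<in> A}" by auto
    also have "emeasure S \<dots> / emeasure S ?R = ennreal c * emeasure L A / ennreal c"
      by (simp only: palm[OF A] eR)
    also have "\<dots> = emeasure L A"
      using c_pos by (simp add: L.emeasure_eq_measure ennreal_mult[symmetric] divide_ennreal)
    finally show "emeasure (distr (given S (\<lambda>w. snd w z)) half_paths ?f) A = emeasure L A" .
  qed (simp add: sets_L)
  have "stationary_regenerative S fst snd L"
    unfolding stationary_regenerative_def random_perm_def
    using S(1) bij stat given rate c_pos by auto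
  with S(2) rate show ?thesis by blast
qed

context governed_perm
begin

lemma stationary_process_version:
  assumes "stationary_version M X Y L \<mu> N X' R'"
  shows "stationary_process N L X' R' (1 / \<mu>)"
proof -
  have st: "stationary_regenerative N X' R' L" and rate: "\<P>(\<omega> in N. R' \<omega> 0) = 1 / \<mu>"
    using assms by (auto simp: stationary_version_def)
  interpret palm_process N L X' R' "1 / \<mu>"
    using palm_process_stationary_regenerative[OF st L.prob_space_axioms sets_L] by (simp only: rate)
  show ?thesis by unfold_locales
qed

lemma stationary_versionI:
  assumes st: "stationary_regenerative N X' R' L" and rate: "\<And>z. \<P>(\<omega> in N. R' \<omega> z) = 1 / \<mu>"
  shows "stationary_version M X Y L \<mu> N X' R'"
  unfolding stationary_version_def
proof (intro conjI allI impI)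
  fix z n :: int assume n: "1 \<le> n" "0 < \<P>(\<omega> in M. renewal_ind Y \<omega> n)"
  have "(\<lambda>\<omega>. X' \<omega> z) \<in> N \<rightarrow>\<^sub>M count_space UNIV" "(\<lambda>\<omega>. R' \<omega> z) \<in> N \<rightarrow>\<^sub>M count_space UNIV" for z
    using st by (auto simp: stationary_regenerative_def random_perm_def)
  then have f: "(\<lambda>\<omega>. future (X' \<omega>) (R' \<omega>) z) \<in> given N (\<lambda>\<omega>. R' \<omega> z) \<rightarrow>\<^sub>M half_paths"
    unfolding given_def by (auto intro!: measurable_future simp: measurable_cong_sets[OF sets_uniform_measure refl])
  have g: "(\<lambda>\<omega>. future (X \<omega>) (renewal_ind Y \<omega>) n) \<in> given M (\<lambda>\<omega>. renewal_ind Y \<omega> n) \<rightarrow>\<^sub>M half_paths"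
    unfolding given_def using measurable_future_X[of n] n by (simp add: measurable_cong_sets[OF sets_uniform_measure refl])
  have "distr (given N (\<lambda>\<omega>. R' \<omega> z)) (path_space {1..}) (\<lambda>\<omega>. perm_after (X' \<omega>) z) =
      distr (distr (given N (\<lambda>\<omega>. R' \<omega> z)) half_paths (\<lambda>\<omega>. future (X' \<omega>) (R' \<omega>) z)) (path_space {1..}) fst"
    by (subst distr_distr[OF measurable_fst f]) (simp add: comp_def)
  also have "\<dots> = distr L (path_space {1..}) fst"
    using st by (simp add: stationary_regenerative_def)
  also have "\<dots> = distr (distr (given M (\<lambda>\<omega>. renewal_ind Y \<omega> n)) half_paths (\<lambda>\<omega>. future (X \<omega>) (renewal_ind Y \<omega>) n)) (path_space {1..}) fst"
    using reg n by (simp add: regenerative_def)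
  also have "\<dots> = distr (given M (\<lambda>\<omega>. renewal_ind Y \<omega> n)) (path_space {1..}) (\<lambda>\<omega>. perm_after (X \<omega>) n)"
    by (subst distr_distr[OF measurable_fst g]) (simp add: comp_def)
  finally show "distr (given N (\<lambda>\<omega>. R' \<omega> z)) (path_space {1..}) (\<lambda>\<omega>. perm_after (X' \<omega>) z) =
      distr (given M (\<lambda>\<omega>. renewal_ind Y \<omega> n)) (path_space {1..}) (\<lambda>\<omega>. perm_after (X \<omega>) n)" .
qed (use st rate in auto)

lemma ex1_stationary_version:
  "\<exists>!S. sets S = sets (path_space UNIV \<Otimes>\<^sub>M path_space UNIV) \<and> stationary_version M X Y L \<mu> S fst snd"
proof (rule ex_ex1I)
  show "\<exists>S. sets S = sets (path_space UNIV \<Otimes>\<^sub>M path_space UNIV) \<and> stationary_version M X Y L \<mu> S fst snd"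
    using ex_stationary_regenerative stationary_versionI by blast
next
  fix S S' :: "((int \<Rightarrow> int) \<times> (int \<Rightarrow> bool)) measure"
  assume S: "sets S = sets (path_space UNIV \<Otimes>\<^sub>M path_space UNIV) \<and> stationary_version M X Y L \<mu> S fst snd"
    and S': "sets S' = sets (path_space UNIV \<Otimes>\<^sub>M path_space UNIV) \<and> stationary_version M X Y L \<mu> S' fst snd"
  interpret S: stationary_process S L fst snd "1 / \<mu>" by (rule stationary_process_version) (use S in simp)
  interpret S': stationary_process S' L fst snd "1 / \<mu>" by (rule stationary_process_version) (use S' in simp)
  show "S = S'"
    by (rule measure_eqI_futures)
      (use S S' S.law_future_stationary S'.law_future_stationary S.N.finite_measure_axioms in auto)
qed

end

section \<open>Enumeration of the renewal times on the integers\<close>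

text \<open>There are times arbitrarily far in both directions.\<close>

definition unbounded_times :: "(int \<Rightarrow> bool) \<Rightarrow> bool" where
  "unbounded_times r \<longleftrightarrow> (\<forall>z. (\<exists>x\<le>z. r x) \<and> (\<exists>x>z. r x))"

lemma ex_enumerates_times:
  assumes r: "unbounded_times r"
  shows "\<exists>T. enumerates_times r T"
proof -
  define A where "A = {n. r (int n)}"
  define B where "B = {n. r (- 1 - int n)}"
  have A: "infinite A"
    unfolding infinite_nat_iff_unbounded
  proof
    fix m
    obtain x where "int m < x" "r x" using r by (auto simp: unbounded_times_def)
    then show "\<exists>n>m. n \<in> A" by (intro exI[of _ "nat x"]) (auto simp: A_def)
  qed
  have B: "infinite B"
    unfolding infinite_nat_iff_unbounded
  proof
    fix m
    obtain x where "x \<le> - 2 - int m" "r x" using r by (auto simp: unbounded_times_def)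
    then show "\<exists>n>m. n \<in> B" by (intro exI[of _ "nat (- 1 - x)"]) (auto simp: B_def)
  qed
  \<comment> \<open>The times in \<open>A\<close> are enumerated to the right, the reflected times in \<open>B\<close> to the left.\<close>
  define T where "T z = (if 0 \<le> z then int (enumerate A (nat z)) else - 1 - int (enumerate B (nat (- 1 - z))))" for z
  have "strict_mono T"
  proof (rule strict_monoI)
    fix x y :: int assume "x < y"
    then show "T x < T y"
      using enumerate_mono[OF _ A, of "nat x" "nat y"] enumerate_mono[OF _ B, of "nat (- 1 - y)" "nat (- 1 - x)"]
      by (auto simp: T_def nat_less_eq_zless)
  qed
  moreover have "range T = {z. r z}"
  proof (intro equalityI subsetI)
    fix x assume "x \<in> range T"
    then obtain z where "x = T z" by blast
    then show "x \<in> {z. r z}"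
      using enumerate_in_set[OF A, of "nat z"] enumerate_in_set[OF B, of "nat (- 1 - z)"]
      by (auto simp: T_def A_def B_def)
  next
    fix x assume "x \<in> {z. r z}"
    show "x \<in> range T"
    proof (cases "0 \<le> x")
      case True
      with \<open>x \<in> {z. r z}\<close> have "nat x \<in> A" by (simp add: A_def)
      then obtain n where "enumerate A n = nat x" using enumerate_Ex[OF A] by blast
      then have "x = T (int n)" using True by (simp add: T_def)
      then show ?thesis by blast
    next
      case False
      with \<open>x \<in> {z. r z}\<close> have "nat (- 1 - x) \<in> B" by (simp add: B_def)
      then obtain n where "enumerate B n = nat (- 1 - x)" using enumerate_Ex[OF B] by blast
      then have "x = T (- 1 - int n)" using False by (simp add: T_def)
      then show ?thesis by blast
    qed
  qed
  moreover have "T (- 1) < 0" "0 \<le> T 0" by (simp_all add: T_def)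
  ultimately show ?thesis unfolding enumerates_times_def by blast
qed

lemma strict_mono_int_diff:
  fixes T :: "int \<Rightarrow> int"
  assumes "strict_mono T" "i \<le> j"
  shows "j - i \<le> T j - T i"
  using assms(2)
proof (induction j rule: int_ge_induct)
  case (step j)
  have "T j < T (j + 1)" using assms(1) by (simp add: strict_mono_less)
  with step show ?case by simp
qed simp

lemma unbounded_if_enumerates:
  assumes "enumerates_times r T"
  shows "unbounded_times r"
  unfolding unbounded_times_def
proof
  fix z
  have T: "strict_mono T" and r: "\<And>k. r (T k)" using assms by (auto simp: enumerates_times_def)
  have "T (- \<bar>T 0 - z\<bar>) \<le> z" "z < T (\<bar>T 0 - z\<bar> + 1)"
    using strict_mono_int_diff[OF T, of "- \<bar>T 0 - z\<bar>" 0] strict_mono_int_diff[OF T, of 0 "\<bar>T 0 - z\<bar> + 1"] by auto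
  then show "(\<exists>x\<le>z. r x) \<and> (\<exists>x>z. r x)" using r by blast
qed

context
  fixes r :: "int \<Rightarrow> bool" and T :: "int \<Rightarrow> int"
  assumes T: "enumerates_times r T"
begin

lemma enum_strict_mono: "strict_mono T"
  using T by (simp add: enumerates_times_def)

lemma enum_less [simp]: "T i < T j \<longleftrightarrow> i < j"
  using enum_strict_mono by (rule strict_mono_less)

lemma enum_iff: "r x \<longleftrightarrow> (\<exists>k. x = T k)"
  using T by (auto simp: enumerates_times_def)

lemma enum_sign: "T i < 0 \<longleftrightarrow> i < 0"
proof
  assume "T i < 0"
  moreover have "0 \<le> T 0" using T by (simp add: enumerates_times_def)
  ultimately have "T i < T 0" by linarith
  then show "i < 0" by simp
next
  assume "i < 0"
  then have "\<not> T (- 1) < T i" by simp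
  moreover have "T (- 1) < 0" using T by (simp add: enumerates_times_def)
  ultimately show "T i < 0" by linarith
qed

lemma enum_0_iff: "T 0 = t \<longleftrightarrow> r t \<and> 0 \<le> t \<and> (\<forall>x\<in>{0..<t}. \<not> r x)"
proof (safe)
  show "r (T 0)" by (auto simp: enum_iff)
  show "0 \<le> T 0" using enum_sign[of 0] by simp
next
  fix x assume x: "x \<in> {0..<T 0}" "r x"
  then obtain k where "x = T k" by (auto simp: enum_iff)
  with x show False using enum_sign[of k] by auto
next
  assume *: "r t" "0 \<le> t" "\<forall>x\<in>{0..<t}. \<not> r x"
  then obtain k where k: "t = T k" by (auto simp: enum_iff)
  have "\<not> k < 0" using * k enum_sign[of k] by simp
  moreover have "\<not> 0 < k"
  proof
    assume "0 < k"
    then have "T 0 \<in> {0..<t}" using k enum_sign[of 0] by simp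
    with *(3) have "\<not> r (T 0)" by blast
    then show False using enum_iff by blast
  qed
  ultimately have "k = 0" by simp
  with k show "T 0 = t" by simp
qed

lemma enum_next_iff: "T (z + 1) = t \<longleftrightarrow> r t \<and> T z < t \<and> (\<forall>x\<in>{T z<..<t}. \<not> r x)"
proof (safe)
  show "r (T (z + 1))" by (auto simp: enum_iff)
  show "T z < T (z + 1)" by simp
next
  fix x assume x: "x \<in> {T z<..<T (z + 1)}" "r x"
  then obtain k where "x = T k" by (auto simp: enum_iff)
  with x show False by auto
next
  assume *: "r t" "T z < t" "\<forall>x\<in>{T z<..<t}. \<not> r x"
  then obtain k where k: "t = T k" by (auto simp: enum_iff)
  have "z < k" using * k by simp
  moreover have "\<not> z + 1 < k"
  proof
    assume "z + 1 < k"
    then have "T (z + 1) \<in> {T z<..<t}" using k by simp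
    with *(3) have "\<not> r (T (z + 1))" by blast
    then show False using enum_iff by blast
  qed
  ultimately have "k = z + 1" by simp
  with k show "T (z + 1) = t" by simp
qed

lemma enum_prev_iff: "T (z - 1) = t \<longleftrightarrow> r t \<and> t < T z \<and> (\<forall>x\<in>{t<..<T z}. \<not> r x)"
proof (safe)
  show "r (T (z - 1))" by (auto simp: enum_iff)
  show "T (z - 1) < T z" by simp
next
  fix x assume x: "x \<in> {T (z - 1)<..<T z}" "r x"
  then obtain k where "x = T k" by (auto simp: enum_iff)
  with x show False by auto
next
  assume *: "r t" "t < T z" "\<forall>x\<in>{t<..<T z}. \<not> r x"
  then obtain k where k: "t = T k" by (auto simp: enum_iff)
  have "k < z" using * k by simp
  moreover have "\<not> k < z - 1"
  proof
    assume "k < z - 1"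
    then have "T (z - 1) \<in> {t<..<T z}" using k by simp
    with *(3) have "\<not> r (T (z - 1))" by blast
    then show False using enum_iff by blast
  qed
  ultimately have "k = z - 1" by simp
  with k show "T (z - 1) = t" by simp
qed

end

lemma enumerates_times_unique:
  assumes T: "enumerates_times r T" and U: "enumerates_times r U"
  shows "T = U"
proof
  fix z
  show "T z = U z"
  proof (induction z rule: int_induct[where k = 0])
    case base
    show ?case using enum_0_iff[OF T] enum_0_iff[OF U] by metis
  next
    case (step1 z)
    then show ?case using enum_next_iff[OF T, of z] enum_next_iff[OF U, of z] by metis
  next
    case (step2 z)
    then show ?case using enum_prev_iff[OF T, of z] enum_prev_iff[OF U, of z] by metis
  qed
qed

lemma enumerates_star_time:
  assumes "unbounded_times (R \<omega>)"
  shows "enumerates_times (R \<omega>) (\<lambda>z. star_time R z \<omega>)"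
proof -
  obtain T where T: "enumerates_times (R \<omega>) T" using ex_enumerates_times[OF assms] by blast
  then have "(THE T. enumerates_times (R \<omega>) T) = T"
    using enumerates_times_unique by (intro the_equality) auto
  then show ?thesis using T by (simp add: star_time_def)
qed

text \<open>
  Without an enumeration, \<open>star_time\<close> is a default value that does not depend on the sample point;
  this is why \<open>star_time\<close> is measurable everywhere.
\<close>

lemma star_time_bounded: "\<not> unbounded_times (R \<omega>) \<Longrightarrow> star_time R z \<omega> = (THE T. False) z"
  using unbounded_if_enumerates[of "R \<omega>"] by (simp add: star_time_def) metis

text \<open>
  For given positive lengths \<open>y (-m), \<dots>, y m\<close> of the blocks around 0 and a given delay \<open>t\<close>, all
  renewal times in the window are determined by the first one.
\<close>

lemma window_iff_gaps:
  assumes T: "enumerates_times r T"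
    and y: "\<forall>i\<in>{- int m..int m}. 1 \<le> y i" and t: "0 \<le> t" "t < y 0"
  defines "y' \<equiv> \<lambda>j. y (int j - int m)"
  defines "s \<equiv> t - (\<Sum>i<Suc m. y' i)"
  shows "(T 0 = t \<and> (\<forall>i\<in>{- int m..int m}. T i - T (i - 1) = y i)) \<longleftrightarrow>
      r s \<and> gaps (ind_after r s) (2 * m + 1) y'" (is "?L \<longleftrightarrow> ?R")
    and "T 0 = t \<and> (\<forall>i\<in>{- int m..int m}. T i - T (i - 1) = y i) \<Longrightarrow> j < 2 * m + 1 \<Longrightarrow>
      T (int j - int m - 1) = s + (\<Sum>i<j. y' i) \<and> T (int j - int m) = s + (\<Sum>i<Suc j. y' i)"
proof -
  note mono = enum_less[OF T]
  have y': "\<forall>i<2 * m + 1. 1 \<le> y' i" using y by (auto simp: y'_def)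
  have gaps: "gaps (ind_after r (T a)) (2 * m + 1) y' \<longleftrightarrow>
      (\<forall>i<2 * m + 1. T (a + int (Suc i)) - T (a + int i) = y' i)" for a
  proof -
    let ?T = "\<lambda>j. T (a + int j)"
    have "r x \<longleftrightarrow> x \<in> range ?T" if "?T 0 < x" for x
    proof
      assume "r x"
      then obtain k where k: "x = T k" using enum_iff[OF T] by blast
      then have "a < k" using that mono by simp
      then have "x = ?T (nat (k - a))" using k by simp
      then show "x \<in> range ?T" by blast
    qed (auto simp: enum_iff[OF T])
    then have "gaps (ind_after r (?T 0)) (2 * m + 1) y' \<longleftrightarrow> (\<forall>i<2 * m + 1. ?T (Suc i) - ?T i = y' i)"
      using mono y' by (intro gaps_iff) (auto simp: strict_mono_def)
    then show ?thesis by simp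
  qed
  have tele: "T (a + int j) = T a + (\<Sum>i<j. y' i)"
    if "\<forall>i<2 * m + 1. T (a + int (Suc i)) - T (a + int i) = y' i" "j \<le> 2 * m + 1" for a j
    using that(2)
  proof (induction j)
    case (Suc j)
    from Suc.prems have "j < 2 * m + 1" by simp
    with that(1) have "T (a + int (Suc j)) - T (a + int j) = y' j" by blast
    moreover have "T (a + int j) = T a + (\<Sum>i<j. y' i)" using Suc by simp
    ultimately show ?case unfolding sum.lessThan_Suc by linarith
  qed simp
  let ?a = "- int m - 1"
  have win: "(\<forall>i\<in>{- int m..int m}. T i - T (i - 1) = y i) \<longleftrightarrow>
      (\<forall>i<2 * m + 1. T (?a + int (Suc i)) - T (?a + int i) = y' i)"
  proof safe
    fix i assume *: "\<forall>i\<in>{- int m..int m}. T i - T (i - 1) = y i" "i < 2 * m + 1"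
    have "T (int i - int m) - T (int i - int m - 1) = y (int i - int m)"
      using * by auto
    then show "T (?a + int (Suc i)) - T (?a + int i) = y' i"
      by (simp add: y'_def algebra_simps)
  next
    fix i assume *: "\<forall>i<2 * m + 1. T (?a + int (Suc i)) - T (?a + int i) = y' i" "i \<in> {- int m..int m}"
    have "nat (i + int m) < 2 * m + 1" using *(2) by auto
    with *(1) have "T (?a + int (Suc (nat (i + int m)))) - T (?a + int (nat (i + int m))) = y' (nat (i + int m))"
      by blast
    then show "T i - T (i - 1) = y i" using *(2) by (simp add: y'_def algebra_simps)
  qed
  have L_s: "T ?a = s" if ?L
    using tele[of ?a "Suc m"] that win by (simp add: s_def)
  show "?L \<longleftrightarrow> ?R"
  proof
    assume ?L
    then show ?R using L_s gaps[of ?a] win by (auto simp: enum_iff[OF T])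
  next
    assume R: ?R
    then obtain a where a: "s = T a" by (auto simp: enum_iff[OF T])
    then have g: "\<forall>i<2 * m + 1. T (a + int (Suc i)) - T (a + int i) = y' i" using R gaps by simp
    have 1: "T (a + int (Suc m)) = t" using tele[OF g, of "Suc m"] a by (simp add: s_def)
    moreover have "T (a + int (Suc m)) - T (a + int m) = y 0" using g by (auto simp: y'_def)
    ultimately have "T (a + int m) < 0" "\<not> T (a + int (Suc m)) < 0" using t by auto
    then have "a = ?a" using enum_sign[OF T, of "a + int m"] enum_sign[OF T, of "a + int (Suc m)"] by simp
    then show ?L using 1 g win by simp
  qed
  show "T (int j - int m - 1) = s + (\<Sum>i<j. y' i) \<and> T (int j - int m) = s + (\<Sum>i<Suc j. y' i)"
    if ?L "j < 2 * m + 1"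
  proof -
    have g: "\<forall>i<2 * m + 1. T (?a + int (Suc i)) - T (?a + int i) = y' i" using that win by simp
    have "?a + int j = int j - int m - 1" "?a + int (Suc j) = int j - int m" by simp_all
    then show ?thesis
      using tele[OF g, of j] tele[OF g, of "Suc j"] that(2) L_s[OF that(1)] by (simp only:)
  qed
qed

section \<open>Conditional probabilities given a discrete process\<close>

text \<open>
  To condition on a random element \<open>W\<close> that is encoded as a two-sided path with countably many
  values, it suffices to condition on its values in finite windows around 0. The
  conditional probability is here assumed to be a function \<open>\<kappa>\<close> of the value at a single time \<open>j\<close>.
\<close>

lemma real_cond_exp_window:
  fixes h :: "'k \<Rightarrow> int \<Rightarrow> 'v::countable" and \<kappa> :: "'v \<Rightarrow> real"
  assumes "prob_space N" and W[measurable]: "W \<in> N \<rightarrow>\<^sub>M K"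
    and h[measurable]: "h \<in> K \<rightarrow>\<^sub>M path_space UNIV" and g: "g \<in> path_space UNIV \<rightarrow>\<^sub>M K"
    and gh: "\<And>x. x \<in> space K \<Longrightarrow> g (h x) = x"
    and B[measurable]: "B \<in> sets N" and \<kappa>: "\<And>v. 0 \<le> \<kappa> v" "\<And>v. \<kappa> v \<le> 1"
    and window: "\<And>m y. \<bar>j\<bar> \<le> int m \<Longrightarrow>
      \<P>(\<omega> in N. (\<forall>i\<in>{- int m..int m}. h (W \<omega>) i = y i) \<and> \<omega> \<in> B) =
      \<kappa> (y j) * \<P>(\<omega> in N. \<forall>i\<in>{- int m..int m}. h (W \<omega>) i = y i)"
  shows "AE \<omega> in N. real_cond_exp N (vimage_algebra (space N) W K) (indicator B) \<omega> = \<kappa> (h (W \<omega>) j)"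
proof -
  interpret prob_space N by fact
  define F where "F = vimage_algebra (space N) W K"
  have WK: "W \<in> space N \<rightarrow> space K" using measurable_space[OF W] by auto
  have sub: "subalgebra N F"
    unfolding subalgebra_def F_def
    using WK by (auto simp: sets_vimage_algebra2 intro: measurable_sets[OF W])
  interpret F: finite_measure_subalgebra N F
    by standard (rule sub)
  have comp[measurable]: "(\<lambda>x. h x i) \<in> K \<rightarrow>\<^sub>M count_space UNIV" for i
    by (rule measurable_compose[OF h measurable_component_singleton]) simp
  have \<kappa>m[measurable]: "(\<lambda>x. \<kappa> (h x j)) \<in> borel_measurable K"
    by (rule measurable_compose[OF comp]) simp
  have WF: "W \<in> F \<rightarrow>\<^sub>M K" unfolding F_def by (rule measurable_vimage_algebra1[OF WK])
  \<comment> \<open>The two sides of the defining equation of the conditional expectation, as measures on \<open>K\<close>.\<close>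
  define \<nu>1 where "\<nu>1 = distr (density N (indicator B)) K W"
  define \<nu>2 where "\<nu>2 = distr (density N (\<lambda>\<omega>. ennreal (\<kappa> (h (W \<omega>) j)))) K W"
  have e1: "emeasure \<nu>1 C = emeasure N {\<omega> \<in> space N. W \<omega> \<in> C \<and> \<omega> \<in> B}" if [measurable]: "C \<in> sets K" for C
  proof -
    have "emeasure \<nu>1 C = emeasure (density N (indicator B)) (W -` C \<inter> space N)"
      unfolding \<nu>1_def by (subst emeasure_distr) auto
    also have "\<dots> = (\<integral>\<^sup>+\<omega>. indicator B \<omega> * indicator (W -` C \<inter> space N) \<omega> \<partial>N)"
      by (rule emeasure_density) auto
    also have "\<dots> = (\<integral>\<^sup>+\<omega>. indicator {\<omega> \<in> space N. W \<omega> \<in> C \<and> \<omega> \<in> B} \<omega> \<partial>N)"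
      by (intro nn_integral_cong) (auto simp: indicator_def)
    finally show ?thesis by simp
  qed
  have e2: "emeasure \<nu>2 C = (\<integral>\<^sup>+\<omega>. ennreal (\<kappa> (h (W \<omega>) j)) * indicator (W -` C \<inter> space N) \<omega> \<partial>N)"
    if [measurable]: "C \<in> sets K" for C
  proof -
    have "emeasure \<nu>2 C = emeasure (density N (\<lambda>\<omega>. ennreal (\<kappa> (h (W \<omega>) j)))) (W -` C \<inter> space N)"
      unfolding \<nu>2_def by (subst emeasure_distr) auto
    also have "\<dots> = (\<integral>\<^sup>+\<omega>. ennreal (\<kappa> (h (W \<omega>) j)) * indicator (W -` C \<inter> space N) \<omega> \<partial>N)"
      by (rule emeasure_density) auto
    finally show ?thesis .
  qed
  have "\<nu>1 = \<nu>2"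
  proof (rule measure_eqI_cylinders[where K = K and I = UNIV and h = h and g = g])
    show "finite_measure \<nu>1"
    proof
      have "emeasure \<nu>1 (space K) \<noteq> \<infinity>" by (subst e1) (auto simp: emeasure_eq_measure)
      then show "emeasure \<nu>1 (space \<nu>1) \<noteq> \<infinity>" by (simp add: \<nu>1_def)
    qed
    fix J :: "int set" assume J: "finite J"
    define m where "m = nat (\<bar>j\<bar> + (\<Sum>i\<in>J. \<bar>i\<bar>))"
    have m: "int m = \<bar>j\<bar> + (\<Sum>i\<in>J. \<bar>i\<bar>)" unfolding m_def by (simp add: sum_nonneg)
    let ?W = "{- int m..int m}"
    have jm: "\<bar>j\<bar> \<le> int m" using m by (simp add: sum_nonneg)
    have jW: "j \<in> ?W" using jm by auto
    have JW: "J \<subseteq> ?W"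
    proof
      fix i assume "i \<in> J"
      then have "\<bar>i\<bar> \<le> int m" using member_le_sum[of i J abs] J m by fastforce
      then show "i \<in> ?W" by auto
    qed
    have "emeasure \<nu>1 {x \<in> space K. \<forall>i\<in>?W. h x i = y i} = emeasure \<nu>2 {x \<in> space K. \<forall>i\<in>?W. h x i = y i}" for y
    proof -
      let ?C = "{x \<in> space K. \<forall>i\<in>?W. h x i = y i}"
      let ?E = "{\<omega> \<in> space N. \<forall>i\<in>?W. h (W \<omega>) i = y i}"
      have C[measurable]: "?C \<in> sets K" by measurable
      have E: "?E \<in> sets N" by measurable
      have "{\<omega> \<in> space N. W \<omega> \<in> ?C \<and> \<omega> \<in> B} = {\<omega> \<in> space N. (\<forall>i\<in>?W. h (W \<omega>) i = y i) \<and> \<omega> \<in> B}"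
        using WK by auto
      then have "emeasure \<nu>1 ?C = ennreal (\<kappa> (y j) * measure N ?E)"
        using window[OF jm, of y] by (simp add: e1 emeasure_eq_measure)
      also have "\<dots> = (\<integral>\<^sup>+\<omega>. ennreal (\<kappa> (y j)) * indicator ?E \<omega> \<partial>N)"
        using E \<kappa> by (simp add: nn_integral_cmult_indicator emeasure_eq_measure ennreal_mult)
      also have "\<dots> = (\<integral>\<^sup>+\<omega>. ennreal (\<kappa> (h (W \<omega>) j)) * indicator (W -` ?C \<inter> space N) \<omega> \<partial>N)"
        using WK by (intro nn_integral_cong) (auto simp: indicator_def dest: bspec[OF _ jW])
      also have "\<dots> = emeasure \<nu>2 ?C" by (rule e2[symmetric]) (rule C)
      finally show ?thesis .
    qed
    then show "\<exists>J'. finite J' \<and> J \<subseteq> J' \<and> J' \<subseteq> UNIV \<and>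
      (\<forall>y. emeasure \<nu>1 {x \<in> space K. \<forall>i\<in>J'. h x i = y i} = emeasure \<nu>2 {x \<in> space K. \<forall>i\<in>J'. h x i = y i})"
      using JW by (intro exI[of _ ?W]) simp
  qed (use h g gh in \<open>auto simp: \<nu>1_def \<nu>2_def\<close>)
  have int: "integrable N (\<lambda>\<omega>. \<kappa> (h (W \<omega>) j))"
    by (rule integrable_const_bound[where B = 1]) (use \<kappa> in auto)
  show ?thesis
    unfolding F_def[symmetric]
  proof (rule F.real_cond_exp_charact)
    fix A assume "A \<in> sets F"
    then obtain C where C[measurable]: "C \<in> sets K" and A: "A = W -` C \<inter> space N"
      unfolding F_def sets_vimage_algebra2[OF WK] by blast
    have AN[measurable]: "A \<in> sets N" unfolding A by measurable
    have "(\<integral>\<omega>\<in>A. indicator B \<omega> \<partial>N) = measure N (A \<inter> B)"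
      by (simp add: set_lebesgue_integral_def indicator_inter_arith[symmetric])
    also have "A \<inter> B = {\<omega> \<in> space N. W \<omega> \<in> C \<and> \<omega> \<in> B}" using A by auto
    also have "measure N \<dots> = enn2real (emeasure \<nu>2 C)"
      using e1[OF C] \<open>\<nu>1 = \<nu>2\<close> by (simp add: measure_def)
    also have "emeasure \<nu>2 C = (\<integral>\<^sup>+\<omega>. ennreal (indicator A \<omega> * \<kappa> (h (W \<omega>) j)) \<partial>N)"
      unfolding e2[OF C] A by (intro nn_integral_cong) (auto simp: indicator_def)
    also have "enn2real \<dots> = (\<integral>\<omega>. indicator A \<omega> * \<kappa> (h (W \<omega>) j) \<partial>N)"
      using \<kappa> by (intro integral_eq_nn_integral[symmetric]) auto
    finally show "(\<integral>\<omega>\<in>A. indicator B \<omega> \<partial>N) = (\<integral>\<omega>\<in>A. \<kappa> (h (W \<omega>) j) \<partial>N)"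
      by (simp add: set_lebesgue_integral_def)
  next
    show "(\<lambda>\<omega>. \<kappa> (h (W \<omega>) j)) \<in> borel_measurable F"
      by (rule measurable_compose[OF WF \<kappa>m])
    show "integrable N (indicator B :: _ \<Rightarrow> real)" by (simp add: emeasure_eq_measure)
  qed (rule int)
qed

section \<open>The stationary version seen through its blocks\<close>

lemma pmf_map_int:
  assumes "pmf q 0 = 0"
  shows "pmf (map_pmf int q) y = pmf q (nat y)"
proof (cases "0 \<le> y")
  case True
  have "pmf (map_pmf int q) (int (nat y)) = pmf q (nat y)" by (rule pmf_map_inj') (simp add: inj_on_def)
  with True show ?thesis by simp
next
  case False
  then have "y \<notin> set_pmf (map_pmf int q)" by auto
  then have "pmf (map_pmf int q) y = 0" by (rule pmf_eq_0_set_pmf[THEN iffD2])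
  then show ?thesis using False assms by simp
qed

text \<open>A stationary version of a governed regenerative permutation, with its renewal times and block lengths.\<close>

locale stationary_version_process = governed_perm M X Y L p Q \<mu> + st: stationary_process N L X' R' "1 / \<mu>"
  for M :: "'a measure" and X Y L p Q \<mu> and N :: "'b measure" and X' R'
begin

abbreviation "T \<equiv> star_time R'"
abbreviation "len \<equiv> star_length R'"

lemma AE_enumerates: "AE \<omega> in N. enumerates_times (R' \<omega>) (\<lambda>z. T z \<omega>)"
  using st.AE_unbounded by eventually_elim (rule enumerates_star_time, simp add: unbounded_times_def)

lemma pred_unbounded [measurable]: "Measurable.pred N (\<lambda>\<omega>. unbounded_times (R' \<omega>))"
  unfolding unbounded_times_def by measurable

lemma pred_star_time: "Measurable.pred N (\<lambda>\<omega>. unbounded_times (R' \<omega>) \<and> T z \<omega> = t)"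
proof (induction z arbitrary: t rule: int_induct[where k = 0])
  case base
  have eq: "(\<lambda>\<omega>. unbounded_times (R' \<omega>) \<and> T 0 \<omega> = t) =
      (\<lambda>\<omega>. unbounded_times (R' \<omega>) \<and> R' \<omega> t \<and> 0 \<le> t \<and> (\<forall>x\<in>{0..<t}. \<not> R' \<omega> x))"
  proof
    fix \<omega>
    show "(unbounded_times (R' \<omega>) \<and> T 0 \<omega> = t) =
        (unbounded_times (R' \<omega>) \<and> R' \<omega> t \<and> 0 \<le> t \<and> (\<forall>x\<in>{0..<t}. \<not> R' \<omega> x))"
      using enum_0_iff[OF enumerates_star_time, of R' \<omega> t] by blast
  qed
  show ?case unfolding eq by measurable
next
  case (step1 z)
  note [measurable] = step1(2)
  have eq: "(\<lambda>\<omega>. unbounded_times (R' \<omega>) \<and> T (z + 1) \<omega> = t) =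
      (\<lambda>\<omega>. \<exists>s. (unbounded_times (R' \<omega>) \<and> T z \<omega> = s) \<and> R' \<omega> t \<and> s < t \<and> (\<forall>x\<in>{s<..<t}. \<not> R' \<omega> x))"
  proof
    fix \<omega>
    show "(unbounded_times (R' \<omega>) \<and> T (z + 1) \<omega> = t) =
        (\<exists>s. (unbounded_times (R' \<omega>) \<and> T z \<omega> = s) \<and> R' \<omega> t \<and> s < t \<and> (\<forall>x\<in>{s<..<t}. \<not> R' \<omega> x))"
      using enum_next_iff[OF enumerates_star_time, of R' \<omega> z t] by blast
  qed
  show ?case unfolding eq by measurable
next
  case (step2 z)
  note [measurable] = step2(2)
  have eq: "(\<lambda>\<omega>. unbounded_times (R' \<omega>) \<and> T (z - 1) \<omega> = t) =
      (\<lambda>\<omega>. \<exists>s. (unbounded_times (R' \<omega>) \<and> T z \<omega> = s) \<and> R' \<omega> t \<and> t < s \<and> (\<forall>x\<in>{t<..<s}. \<not> R' \<omega> x))"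
  proof
    fix \<omega>
    show "(unbounded_times (R' \<omega>) \<and> T (z - 1) \<omega> = t) =
        (\<exists>s. (unbounded_times (R' \<omega>) \<and> T z \<omega> = s) \<and> R' \<omega> t \<and> t < s \<and> (\<forall>x\<in>{t<..<s}. \<not> R' \<omega> x))"
      using enum_prev_iff[OF enumerates_star_time, of R' \<omega> z t] by blast
  qed
  show ?case unfolding eq by measurable
qed

lemma measurable_star_time [measurable]: "T z \<in> N \<rightarrow>\<^sub>M count_space UNIV"
proof -
  have "Measurable.pred N (\<lambda>\<omega>. T z \<omega> = t)" for t
  proof -
    note [measurable] = pred_star_time
    have "(\<lambda>\<omega>. T z \<omega> = t) = (\<lambda>\<omega>. (unbounded_times (R' \<omega>) \<and> T z \<omega> = t) \<or>
        (\<not> unbounded_times (R' \<omega>) \<and> (THE T. False) z = t))"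
      using star_time_bounded[of R' _ z] by (intro ext) metis
    then show ?thesis by simp
  qed
  then show ?thesis
    by (subst measurable_count_space_eq2_countable) (auto simp: pred_def vimage_def Int_def conj_commute)
qed

lemma measurable_star_length [measurable]: "len z \<in> N \<rightarrow>\<^sub>M count_space UNIV"
proof -
  have "len z = (\<lambda>\<omega>. T z \<omega> - T (z - 1) \<omega>)" by (simp add: fun_eq_iff star_length_def)
  then show ?thesis by simp
qed

lemma pred_star_block [measurable]: "Measurable.pred N (\<lambda>\<omega>. star_block X' R' i \<omega> = \<sigma>)"
proof -
  have "Measurable.pred N (\<lambda>\<omega>. reduced_perm a b (X' \<omega>) = \<sigma>)" for a b
    by (rule pred_reduced_perm) (rule st.measurable_X)
  note [measurable] = this
  have [measurable]: "Measurable.pred N (\<lambda>\<omega>. reduced_perm (T (i - 1) \<omega>) b (X' \<omega>) = \<sigma>)" for b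
    by (rule measurable_compose_countable[where f = "\<lambda>a \<omega>. reduced_perm a b (X' \<omega>) = \<sigma>"]) measurable
  show ?thesis
    unfolding star_block_def
    by (rule measurable_compose_countable[where f = "\<lambda>b \<omega>. reduced_perm (T (i - 1) \<omega>) b (X' \<omega>) = \<sigma>"]) measurable
qed

lemma palm_prob:
  assumes "A \<in> sets half_paths"
  shows "\<P>(\<omega> in N. R' \<omega> z \<and> future (X' \<omega>) (R' \<omega>) z \<in> A) = measure L A / \<mu>"
proof -
  have "ennreal (\<P>(\<omega> in N. R' \<omega> z \<and> future (X' \<omega>) (R' \<omega>) z \<in> A)) = ennreal (1 / \<mu> * measure L A)"
    using st.palm[OF assms, of z] mean_pos
    by (simp add: st.N.emeasure_eq_measure L.emeasure_eq_measure ennreal_mult[symmetric])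
  then show ?thesis using mean_pos by (simp add: ennreal_inj)
qed

lemma prod_window:
  fixes f :: "int \<Rightarrow> real"
  shows "(\<Prod>j<2 * m + 1. f (int j - int m)) = (\<Prod>i\<in>{- int m..int m}. f i)"
proof (rule prod.reindex_bij_betw)
  show "bij_betw (\<lambda>j. int j - int m) {..<2 * m + 1} {- int m..int m}"
    by (rule bij_betw_byWitness[where f' = "\<lambda>i. nat (i + int m)"]) auto
qed

text \<open>
  Given the delay and the lengths of the blocks \<open>-m, \<dots>, m\<close>, the first renewal \<open>s\<close> in the window is a
  fixed time. There is a renewal at \<open>s\<close> with probability \<open>1 / \<mu>\<close>, and after it the lengths are independent with law \<open>p\<close>.
  The result depends on the delay only through \<open>0 \<le> t < y 0\<close>: this makes \<open>Y\<^sub>0\<close> size biased and the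
  delay uniform.
\<close>

lemma prob_window:
  "\<P>(\<omega> in N. T 0 \<omega> = t \<and> (\<forall>i\<in>{- int m..int m}. len i \<omega> = y i)) =
    (if 0 \<le> t \<and> t < y 0 then (\<Prod>i\<in>{- int m..int m}. pmf p (nat (y i))) / \<mu> else 0)"
    (is "?lengths")
  and prob_window_block: "\<bar>i\<bar> \<le> int m \<Longrightarrow>
    \<P>(\<omega> in N. (T 0 \<omega> = t \<and> (\<forall>i\<in>{- int m..int m}. len i \<omega> = y i)) \<and> star_block X' R' i \<omega> = \<sigma>) =
    pmf (Q (nat (y i))) \<sigma> * \<P>(\<omega> in N. T 0 \<omega> = t \<and> (\<forall>i\<in>{- int m..int m}. len i \<omega> = y i))"
proof -
  let ?W = "{- int m..int m}"
  let ?E = "\<lambda>\<omega>. T 0 \<omega> = t \<and> (\<forall>i\<in>?W. len i \<omega> = y i)"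
  let ?P = "\<Prod>i\<in>?W. pmf p (nat (y i))"
  have "(?lengths) \<and> (\<bar>i\<bar> \<le> int m \<longrightarrow>
    \<P>(\<omega> in N. ?E \<omega> \<and> star_block X' R' i \<omega> = \<sigma>) = pmf (Q (nat (y i))) \<sigma> * \<P>(\<omega> in N. ?E \<omega>))" for i
  proof (cases "0 \<le> t \<and> t < y 0 \<and> (\<forall>i\<in>?W. 1 \<le> y i)")
    case True
    then have y: "\<forall>i\<in>?W. 1 \<le> y i" and t: "0 \<le> t" "t < y 0" by auto
    define y' where "y' j = y (int j - int m)" for j
    define s where "s = t - (\<Sum>i<Suc m. y' i)"
    have y': "\<forall>i<2 * m + 1. 1 \<le> y' i" using y by (auto simp: y'_def)
    have W: "(\<forall>i\<in>?W. len i \<omega> = y i) \<longleftrightarrow> (\<forall>i\<in>?W. T i \<omega> - T (i - 1) \<omega> = y i)" for \<omega>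
      by (simp add: star_length_def)
    have win: "?E \<omega> \<longleftrightarrow> R' \<omega> s \<and> gaps (ind_after (R' \<omega>) s) (2 * m + 1) y'"
      and win_times: "?E \<omega> \<Longrightarrow> j < 2 * m + 1 \<Longrightarrow>
        T (int j - int m - 1) \<omega> = s + (\<Sum>i<j. y' i) \<and> T (int j - int m) \<omega> = s + (\<Sum>i<Suc j. y' i)"
      if "enumerates_times (R' \<omega>) (\<lambda>z. T z \<omega>)" for \<omega> j
      using window_iff_gaps[OF that y t] unfolding y'_def[symmetric] s_def[symmetric] W by blast+
    have prod: "(\<Prod>j<2 * m + 1. pmf p (nat (y' j))) = ?P"
      unfolding y'_def by (rule prod_window)
    have fut: "future (X' \<omega>) (R' \<omega>) s \<in> space half_paths" if "\<omega> \<in> space N" for \<omega>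
      using measurable_space[OF st.measurable_future_X that] .
    let ?C = "{w \<in> space half_paths. gaps (snd w) (2 * m + 1) y'}"
    have "\<P>(\<omega> in N. ?E \<omega>) = \<P>(\<omega> in N. R' \<omega> s \<and> future (X' \<omega>) (R' \<omega>) s \<in> ?C)"
    proof (rule measure_eq_AE)
      show "AE \<omega> in N. \<omega> \<in> {\<omega> \<in> space N. ?E \<omega>} \<longleftrightarrow>
          \<omega> \<in> {\<omega> \<in> space N. R' \<omega> s \<and> future (X' \<omega>) (R' \<omega>) s \<in> ?C}"
        using AE_enumerates
      proof eventually_elim
        fix \<omega> assume e: "enumerates_times (R' \<omega>) (\<lambda>z. T z \<omega>)"
        show "\<omega> \<in> {\<omega> \<in> space N. ?E \<omega>} \<longleftrightarrow>
          \<omega> \<in> {\<omega> \<in> space N. R' \<omega> s \<and> future (X' \<omega>) (R' \<omega>) s \<in> ?C}"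
          unfolding mem_Collect_eq fst_conv snd_conv win[OF e] using fut by blast
      qed
    qed measurable
    also have "\<dots> = measure L ?C / \<mu>"
      by (rule palm_prob) measurable
    also have "\<dots> = ?P / \<mu>"
      using prob_gaps[OF y'] prod by (simp add: space_L)
    finally have len: "\<P>(\<omega> in N. ?E \<omega>) = ?P / \<mu>" .
    moreover have "\<P>(\<omega> in N. ?E \<omega> \<and> star_block X' R' i \<omega> = \<sigma>) = pmf (Q (nat (y i))) \<sigma> * \<P>(\<omega> in N. ?E \<omega>)"
      if i: "\<bar>i\<bar> \<le> int m"
    proof -
      \<comment> \<open>Block \<open>i\<close> is the one with index \<open>i + m\<close> after the renewal at \<open>s\<close>, counted from 0.\<close>
      define j where "j = nat (i + int m)"
      have j: "j < 2 * m + 1" "int j - int m = i" "y' j = y i" using i by (auto simp: j_def y'_def)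
      let ?s = "\<lambda>j. \<Sum>i<j. y' i"
      have s0: "0 \<le> ?s j" using y' j(1) by (intro sum_nonneg) (auto intro: order.trans[of 0 1])
      have [measurable]: "Measurable.pred half_paths (\<lambda>w. reduced_perm (?s j) (?s (Suc j)) (fst w) = \<sigma>)"
        using s0 by (intro pred_reduced_perm measurable_half_paths_component) auto
      let ?C = "{w \<in> space half_paths. gaps (snd w) (2 * m + 1) y' \<and> reduced_perm (?s j) (?s (Suc j)) (fst w) = \<sigma>}"
      have C: "?C \<in> sets half_paths" by measurable
      have "\<P>(\<omega> in N. ?E \<omega> \<and> star_block X' R' i \<omega> = \<sigma>) = \<P>(\<omega> in N. R' \<omega> s \<and> future (X' \<omega>) (R' \<omega>) s \<in> ?C)"
      proof (rule measure_eq_AE)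
        show "AE \<omega> in N. \<omega> \<in> {\<omega> \<in> space N. ?E \<omega> \<and> star_block X' R' i \<omega> = \<sigma>} \<longleftrightarrow>
            \<omega> \<in> {\<omega> \<in> space N. R' \<omega> s \<and> future (X' \<omega>) (R' \<omega>) s \<in> ?C}"
          using AE_enumerates
        proof eventually_elim
          fix \<omega> assume e: "enumerates_times (R' \<omega>) (\<lambda>z. T z \<omega>)"
          have "star_block X' R' i \<omega> = reduced_perm (?s j) (?s (Suc j)) (perm_after (X' \<omega>) s)" if E: "?E \<omega>"
            using win_times[OF e E j(1)] by (simp only: j(2) star_block_def reduced_perm_perm_after[OF s0])
          then have "?E \<omega> \<and> star_block X' R' i \<omega> = \<sigma> \<longleftrightarrow> R' \<omega> s \<and> gaps (ind_after (R' \<omega>) s) (2 * m + 1) y' \<and>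
              reduced_perm (?s j) (?s (Suc j)) (perm_after (X' \<omega>) s) = \<sigma>"
            using win[OF e] by metis
          then show "\<omega> \<in> {\<omega> \<in> space N. ?E \<omega> \<and> star_block X' R' i \<omega> = \<sigma>} \<longleftrightarrow>
              \<omega> \<in> {\<omega> \<in> space N. R' \<omega> s \<and> future (X' \<omega>) (R' \<omega>) s \<in> ?C}"
            unfolding mem_Collect_eq fst_conv snd_conv using fut by blast
        qed
      qed (use C in measurable)
      also have "\<dots> = measure L ?C / \<mu>" by (rule palm_prob[OF C])
      also have "measure L ?C = ?P * pmf (Q (nat (y i))) \<sigma>"
        using prob_gaps_block[OF j(1) y', of \<sigma>] unfolding prod j(3) space_L .
      finally show ?thesis unfolding len by simp
    qed
    ultimately show ?thesis using t by simp
  next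
    case False
    have "AE \<omega> in N. \<not> ?E \<omega>"
      using AE_enumerates
    proof eventually_elim
      fix \<omega> assume e: "enumerates_times (R' \<omega>) (\<lambda>z. T z \<omega>)"
      show "\<not> ?E \<omega>"
      proof
        assume E: "?E \<omega>"
        have len: "len i \<omega> = y i" if "i \<in> ?W" for i using E that by blast
        have "1 \<le> len i \<omega>" for i using enum_less[OF e, of "i - 1" i] by (simp add: star_length_def)
        then have "\<forall>i\<in>?W. 1 \<le> y i" using len by metis
        moreover have "T 0 \<omega> - T (- 1) \<omega> = y 0" using len[of 0] by (simp add: star_length_def)
        moreover have "\<not> T 0 \<omega> < 0" "T (- 1) \<omega> < 0" using enum_sign[OF e] by simp_all
        ultimately show False using E False by auto
      qed
    qed
    then have E0: "\<P>(\<omega> in N. ?E \<omega>) = 0"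
      by (subst st.N.prob_eq_0) auto
    have "\<P>(\<omega> in N. ?E \<omega> \<and> star_block X' R' i \<omega> = \<sigma>) \<le> \<P>(\<omega> in N. ?E \<omega>)"
      by (rule st.N.finite_measure_mono) auto
    then have "\<P>(\<omega> in N. ?E \<omega> \<and> star_block X' R' i \<omega> = \<sigma>) = 0"
      unfolding E0 by (simp add: measure_le_0_iff)
    moreover have "?P = 0" if "0 \<le> t \<and> t < y 0"
    proof -
      from False that have "\<exists>i\<in>?W. \<not> 1 \<le> y i" by blast
      then obtain i where "i \<in> ?W" "\<not> 1 \<le> y i" by blast
      then have "i \<in> ?W" "pmf p (nat (y i)) = 0" using pmf_p_0 by auto
      then show ?thesis by (intro prod_zero) auto
    qed
    ultimately show ?thesis using E0 by auto
  qed
  then show ?lengths "\<bar>i\<bar> \<le> int m \<Longrightarrow>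
    \<P>(\<omega> in N. ?E \<omega> \<and> star_block X' R' i \<omega> = \<sigma>) = pmf (Q (nat (y i))) \<sigma> * \<P>(\<omega> in N. ?E \<omega>)"
    by blast+
qed

lemma prob_lengths_window:
  "\<P>(\<omega> in N. \<forall>i\<in>{- int m..int m}. len i \<omega> = y i) =
    real_of_int (y 0) / \<mu> * (\<Prod>i\<in>{- int m..int m}. pmf p (nat (y i)))"
proof -
  let ?W = "{- int m..int m}"
  let ?E = "\<lambda>t \<omega>. T 0 \<omega> = t \<and> (\<forall>i\<in>?W. len i \<omega> = y i)"
  let ?P = "\<Prod>i\<in>?W. pmf p (nat (y i))"
  have "\<P>(\<omega> in N. \<forall>i\<in>?W. len i \<omega> = y i) = measure N (\<Union>t\<in>{0..<y 0}. {\<omega> \<in> space N. ?E t \<omega>})"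
  proof (rule measure_eq_AE)
    show "AE \<omega> in N. \<omega> \<in> {\<omega> \<in> space N. \<forall>i\<in>?W. len i \<omega> = y i} \<longleftrightarrow> \<omega> \<in> (\<Union>t\<in>{0..<y 0}. {\<omega> \<in> space N. ?E t \<omega>})"
      using AE_enumerates
    proof eventually_elim
      fix \<omega> assume e: "enumerates_times (R' \<omega>) (\<lambda>z. T z \<omega>)"
      have "T 0 \<omega> \<in> {0..<y 0}" if "\<forall>i\<in>?W. len i \<omega> = y i"
      proof -
        have "len 0 \<omega> = y 0" by (rule bspec[OF that]) simp
        then have "T 0 \<omega> - T (- 1) \<omega> = y 0" by (simp add: star_length_def)
        moreover have "\<not> T 0 \<omega> < 0" "T (- 1) \<omega> < 0" using enum_sign[OF e] by simp_all
        ultimately show ?thesis by auto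
      qed
      then show "\<omega> \<in> {\<omega> \<in> space N. \<forall>i\<in>?W. len i \<omega> = y i} \<longleftrightarrow> \<omega> \<in> (\<Union>t\<in>{0..<y 0}. {\<omega> \<in> space N. ?E t \<omega>})"
        by blast
    qed
  qed measurable
  also have "\<dots> = (\<Sum>t\<in>{0..<y 0}. \<P>(\<omega> in N. ?E t \<omega>))"
    by (rule st.N.finite_measure_finite_Union) (auto simp: disjoint_family_on_def)
  also have "\<dots> = (\<Sum>t\<in>{0..<y 0}. ?P / \<mu>)"
    unfolding prob_window by (rule sum.cong) auto
  also have "\<dots> = real_of_int (y 0) / \<mu> * ?P"
  proof (cases "0 \<le> y 0")
    case False
    then have "?P = 0" using pmf_p_0 by (intro prod_zero) (auto intro!: bexI[of _ 0])
    then show ?thesis by simp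
  qed simp
  finally show ?thesis .
qed

text \<open>The law of the length \<open>Y\<^sub>i\<close> of the block \<open>i\<close>; the block that covers 0 is size biased.\<close>

definition length_pmf :: "int \<Rightarrow> int pmf" where
  "length_pmf i = map_pmf int (if i = 0 then embed_pmf (\<lambda>n. real n * pmf p n / \<mu>) else p)"

lemma pmf_size_biased: "pmf (embed_pmf (\<lambda>n. real n * pmf p n / \<mu>)) n = real n * pmf p n / \<mu>"
proof (rule pmf_embed_pmf)
  show "0 \<le> real n * pmf p n / \<mu>" for n using mean_pos by simp
  have "(\<integral>\<^sup>+n. ennreal (real n * pmf p n / \<mu>) \<partial>count_space UNIV) = (\<Sum>n. ennreal (real n * pmf p n / \<mu>))"
    by (rule nn_integral_count_space_nat)
  also have "\<dots> = ennreal (\<Sum>n. real n * pmf p n / \<mu>)"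
    using mean_pos summable_mean by (intro suminf_ennreal2 summable_divide) auto
  also have "(\<Sum>n. real n * pmf p n / \<mu>) = 1"
    using mean_pos by (simp add: suminf_divide[OF summable_mean] mean[symmetric])
  finally show "(\<integral>\<^sup>+n. ennreal (real n * pmf p n / \<mu>) \<partial>count_space UNIV) = 1" by simp
qed

lemma pmf_length_pmf: "pmf (length_pmf i) y = (if i = 0 then real (nat y) / \<mu> else 1) * pmf p (nat y)"
  unfolding length_pmf_def
  by (subst pmf_map_int) (auto simp: pmf_size_biased pmf_p_0)

lemma law_lengths: "distr N (path_space UNIV) (\<lambda>\<omega> z. len z \<omega>) = PiM UNIV (\<lambda>i. measure_pmf (length_pmf i))"
proof (rule measure_eqI_cylinders[where K = "path_space UNIV" and I = UNIV and h = "\<lambda>v. v" and g = "\<lambda>v. v"])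
  have m: "(\<lambda>\<omega> z. len z \<omega>) \<in> N \<rightarrow>\<^sub>M path_space UNIV"
    by (rule measurable_PiM_single') (auto simp: PiE_UNIV_domain)
  show "finite_measure (distr N (path_space UNIV) (\<lambda>\<omega> z. len z \<omega>))"
    using m by (rule st.N.finite_measure_distr)
  show "sets (PiM UNIV (\<lambda>i. measure_pmf (length_pmf i))) = sets (path_space UNIV)"
    by (intro sets_PiM_cong) auto
  fix J :: "int set" assume J: "finite J"
  define m where "m = nat (\<Sum>i\<in>J. \<bar>i\<bar>)"
  have m': "int m = (\<Sum>i\<in>J. \<bar>i\<bar>)" unfolding m_def by (simp add: sum_nonneg)
  let ?W = "{- int m..int m}"
  have JW: "J \<subseteq> ?W"
  proof
    fix i assume "i \<in> J"
    then have "\<bar>i\<bar> \<le> int m" using member_le_sum[of i J abs] J m' by fastforce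
    then show "i \<in> ?W" by auto
  qed
  have "emeasure (distr N (path_space UNIV) (\<lambda>\<omega> z. len z \<omega>)) {v \<in> space (path_space UNIV). \<forall>i\<in>?W. v i = y i} =
      emeasure (PiM UNIV (\<lambda>i. measure_pmf (length_pmf i))) {v \<in> space (path_space UNIV). \<forall>i\<in>?W. v i = y i}"
    (is "emeasure _ ?E = _") for y
  proof -
    have E: "?E \<in> sets (path_space UNIV)"
    proof (intro predE pred_intros_finite(3))
      fix i :: int
      show "Measurable.pred (path_space UNIV) (\<lambda>v. v i = y i)"
        by (rule measurable_compose[OF measurable_component_singleton[of i UNIV]]) auto
    qed simp
    have "emeasure (distr N (path_space UNIV) (\<lambda>\<omega> z. len z \<omega>)) ?E = emeasure N ((\<lambda>\<omega> z. len z \<omega>) -` ?E \<inter> space N)"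
      by (rule emeasure_distr[OF m E])
    also have "(\<lambda>\<omega> z. len z \<omega>) -` ?E \<inter> space N = {\<omega> \<in> space N. \<forall>i\<in>?W. len i \<omega> = y i}" by auto
    also have "emeasure N \<dots> = ennreal (real_of_int (y 0) / \<mu> * (\<Prod>i\<in>?W. pmf p (nat (y i))))"
      unfolding st.N.emeasure_eq_measure prob_lengths_window ..
    also have "real_of_int (y 0) / \<mu> * (\<Prod>i\<in>?W. pmf p (nat (y i))) = (\<Prod>i\<in>?W. pmf (length_pmf i) (y i))"
    proof -
      have W: "(\<Prod>i\<in>?W. f i) = f 0 * (\<Prod>i\<in>?W - {0}. f i)" for f :: "int \<Rightarrow> real"
        by (rule prod.remove) auto
      have "(\<Prod>i\<in>?W - {0}. pmf (length_pmf i) (y i)) = (\<Prod>i\<in>?W - {0}. pmf p (nat (y i)))"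
        by (rule prod.cong) (auto simp: pmf_length_pmf)
      moreover have "real_of_int (y 0) / \<mu> * pmf p (nat (y 0)) = pmf (length_pmf 0) (y 0)"
        by (cases "0 \<le> y 0") (auto simp: pmf_length_pmf pmf_p_0)
      ultimately show ?thesis unfolding W[of "\<lambda>i. pmf p (nat (y i))"] W[of "\<lambda>i. pmf (length_pmf i) (y i)"]
        by (simp add: mult.assoc[symmetric])
    qed
    also have "ennreal \<dots> = (\<Prod>i\<in>?W. emeasure (measure_pmf (length_pmf i)) {y i})"
      by (simp add: prod_ennreal emeasure_pmf_single)
    also have "\<dots> = emeasure (PiM UNIV (\<lambda>i. measure_pmf (length_pmf i)))
        (prod_emb UNIV (\<lambda>i. measure_pmf (length_pmf i)) ?W (\<Pi>\<^sub>E i\<in>?W. {y i}))"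
      by (rule emeasure_PiM_emb[symmetric]) (auto intro: measure_pmf.prob_space_axioms)
    also have "prod_emb UNIV (\<lambda>i. measure_pmf (length_pmf i)) ?W (\<Pi>\<^sub>E i\<in>?W. {y i}) = ?E"
      by (auto simp: prod_emb_def PiE_iff)
    finally show ?thesis .
  qed
  then show "\<exists>J'. finite J' \<and> J \<subseteq> J' \<and> J' \<subseteq> UNIV \<and>
      (\<forall>y. emeasure (distr N (path_space UNIV) (\<lambda>\<omega> z. len z \<omega>)) {v \<in> space (path_space UNIV). \<forall>i\<in>J'. v i = y i} =
           emeasure (PiM UNIV (\<lambda>i. measure_pmf (length_pmf i))) {v \<in> space (path_space UNIV). \<forall>i\<in>J'. v i = y i})"
    using JW by (intro exI[of _ ?W] conjI allI) (simp_all only: subset_UNIV finite_atLeastAtMost_int)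
qed auto

lemma law_length: "distr N (count_space UNIV) (len i) = measure_pmf (length_pmf i)"
proof -
  have m: "(\<lambda>\<omega> z. len z \<omega>) \<in> N \<rightarrow>\<^sub>M path_space UNIV"
    by (rule measurable_PiM_single') (auto simp: PiE_UNIV_domain)
  have "distr N (count_space UNIV) (len i) = distr (distr N (path_space UNIV) (\<lambda>\<omega> z. len z \<omega>)) (count_space UNIV) (\<lambda>v. v i)"
    by (subst distr_distr[OF measurable_component_singleton m]) (auto simp: comp_def)
  also have "\<dots> = distr (PiM UNIV (\<lambda>i. measure_pmf (length_pmf i))) (measure_pmf (length_pmf i)) (\<lambda>v. v i)"
    unfolding law_lengths by (rule distr_cong) auto
  also have "\<dots> = measure_pmf (length_pmf i)"
    by (rule distr_PiM_component) (auto intro: measure_pmf.prob_space_axioms)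
  finally show ?thesis .
qed

lemma indep_lengths: "st.N.indep_vars (\<lambda>_. count_space UNIV) len UNIV"
proof (subst st.N.indep_vars_iff_distr_eq_PiM)
  show "distr N (PiM UNIV (\<lambda>_. count_space UNIV)) (\<lambda>\<omega>. \<lambda>i\<in>UNIV. len i \<omega>) =
      PiM UNIV (\<lambda>i. distr N (count_space UNIV) (len i))"
    using law_lengths by (simp add: law_length restrict_UNIV)
qed auto

lemma prob_length: "\<P>(\<omega> in N. len z \<omega> = int n) = (if z = 0 then real n / \<mu> else 1) * pmf p n"
proof -
  have "\<P>(\<omega> in N. len z \<omega> = int n) = measure (distr N (count_space UNIV) (len z)) {int n}"
    by (subst measure_distr) (auto intro!: arg_cong[where f = "measure N"])
  also have "\<dots> = pmf (length_pmf z) (int n)" by (simp add: law_length measure_pmf_single)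
  finally show ?thesis by (simp add: pmf_length_pmf)
qed

lemma cond_delay:
  "AE \<omega> in N. real_cond_exp N (lengths_algebra N R') (indicator {\<omega> \<in> space N. T 0 \<omega> = t}) \<omega> =
    pmf (pmf_of_set {0..len 0 \<omega> - 1}) t"
  unfolding lengths_algebra_def
proof (rule real_cond_exp_window[where h = "\<lambda>v. v" and g = "\<lambda>v. v" and j = 0 and \<kappa> = "\<lambda>n. pmf (pmf_of_set {0..n - 1}) t"])
  show "(\<lambda>\<omega> z. len z \<omega>) \<in> N \<rightarrow>\<^sub>M path_space UNIV"
    by (rule measurable_PiM_single') (auto simp: PiE_UNIV_domain)
  show "{\<omega> \<in> space N. T 0 \<omega> = t} \<in> sets N" by measurable
  fix m :: nat and y :: "int \<Rightarrow> int"
  let ?W = "{- int m..int m}"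
  let ?P = "\<Prod>i\<in>?W. pmf p (nat (y i))"
  have "\<P>(\<omega> in N. (\<forall>i\<in>?W. len i \<omega> = y i) \<and> \<omega> \<in> {\<omega> \<in> space N. T 0 \<omega> = t}) =
      \<P>(\<omega> in N. T 0 \<omega> = t \<and> (\<forall>i\<in>?W. len i \<omega> = y i))"
    by (intro arg_cong[where f = "measure N"]) auto
  also have "\<dots> = (if 0 \<le> t \<and> t < y 0 then ?P / \<mu> else 0)" by (rule prob_window)
  also have "\<dots> = pmf (pmf_of_set {0..y 0 - 1}) t * (real_of_int (y 0) / \<mu> * ?P)"
  proof (cases "1 \<le> y 0")
    case True
    then show ?thesis by (auto simp: pmf_of_set indicator_def)
  next
    case False
    then have "?P = 0" using pmf_p_0 by (intro prod_zero) (auto intro!: bexI[of _ 0])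
    then show ?thesis by simp
  qed
  finally show "\<P>(\<omega> in N. (\<forall>i\<in>?W. len i \<omega> = y i) \<and> \<omega> \<in> {\<omega> \<in> space N. T 0 \<omega> = t}) =
      pmf (pmf_of_set {0..y 0 - 1}) t * \<P>(\<omega> in N. \<forall>i\<in>?W. len i \<omega> = y i)"
    unfolding prob_lengths_window .
qed (auto simp: pmf_le_1 intro: st.N.prob_space_axioms)

lemma cond_block:
  "AE \<omega> in N. real_cond_exp N (lengths_delay_algebra N R') (indicator {\<omega> \<in> space N. star_block X' R' i \<omega> = \<sigma>}) \<omega> =
    pmf (Q (nat (len i \<omega>))) \<sigma>"
proof -
  let ?K = "path_space UNIV \<Otimes>\<^sub>M count_space UNIV :: ((int \<Rightarrow> int) \<times> int) measure"
  let ?h = "\<lambda>w :: (int \<Rightarrow> int) \<times> int. \<lambda>i. (fst w i, snd w)"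
  have "AE \<omega> in N. real_cond_exp N (vimage_algebra (space N) (\<lambda>\<omega>. (\<lambda>z. len z \<omega>, T 0 \<omega>)) ?K)
      (indicator {\<omega> \<in> space N. star_block X' R' i \<omega> = \<sigma>}) \<omega> =
      (\<lambda>v. pmf (Q (nat (fst v))) \<sigma>) (?h (\<lambda>z. len z \<omega>, T 0 \<omega>) i)"
  proof (rule real_cond_exp_window[where h = ?h and g = "\<lambda>v. (\<lambda>i. fst (v i), snd (v 0))"])
    show "(\<lambda>\<omega>. (\<lambda>z. len z \<omega>, T 0 \<omega>)) \<in> N \<rightarrow>\<^sub>M ?K"
      by (intro measurable_Pair measurable_PiM_single') (auto simp: PiE_UNIV_domain)
    show "?h \<in> ?K \<rightarrow>\<^sub>M path_space UNIV"
    proof (intro measurable_PiM_single')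
      fix i :: int
      have "(\<lambda>w. fst w i) \<in> ?K \<rightarrow>\<^sub>M count_space UNIV"
        by (rule measurable_compose[OF measurable_fst measurable_component_singleton]) simp
      then show "(\<lambda>w. (fst w i, snd w)) \<in> ?K \<rightarrow>\<^sub>M count_space UNIV"
        by (intro measurable_Pair_count_space) auto
    qed (auto simp: PiE_UNIV_domain)
    show "(\<lambda>v. (\<lambda>i. fst (v i), snd (v 0))) \<in> path_space UNIV \<rightarrow>\<^sub>M ?K"
      by (intro measurable_Pair measurable_PiM_single')
        (auto simp: PiE_UNIV_domain intro!: measurable_compose[OF measurable_component_singleton])
    show "{\<omega> \<in> space N. star_block X' R' i \<omega> = \<sigma>} \<in> sets N" by measurable
    fix m :: nat and y :: "int \<Rightarrow> int \<times> int"
    assume m: "\<bar>i\<bar> \<le> int m"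
    let ?W = "{- int m..int m}"
    define t where "t = snd (y 0)"
    have W0: "0 \<in> ?W" by simp
    let ?B = "{\<omega> \<in> space N. star_block X' R' i \<omega> = \<sigma>}"
    show "\<P>(\<omega> in N. (\<forall>i\<in>?W. ?h (\<lambda>z. len z \<omega>, T 0 \<omega>) i = y i) \<and> \<omega> \<in> ?B) =
        pmf (Q (nat (fst (y i)))) \<sigma> * \<P>(\<omega> in N. \<forall>i\<in>?W. ?h (\<lambda>z. len z \<omega>, T 0 \<omega>) i = y i)"
    proof (cases "\<forall>i\<in>?W. snd (y i) = t")
      case True
      have W: "(\<forall>i\<in>?W. ?h (\<lambda>z. len z \<omega>, T 0 \<omega>) i = y i) \<longleftrightarrow>
          T 0 \<omega> = t \<and> (\<forall>i\<in>?W. len i \<omega> = fst (y i))" for \<omega>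
      proof
        assume *: "\<forall>i\<in>?W. ?h (\<lambda>z. len z \<omega>, T 0 \<omega>) i = y i"
        have "len i \<omega> = fst (y i) \<and> T 0 \<omega> = snd (y i)" if "i \<in> ?W" for i
          using bspec[OF * that] by (simp add: prod_eq_iff)
        then show "T 0 \<omega> = t \<and> (\<forall>i\<in>?W. len i \<omega> = fst (y i))"
          using W0 unfolding t_def by blast
      next
        assume *: "T 0 \<omega> = t \<and> (\<forall>i\<in>?W. len i \<omega> = fst (y i))"
        then show "\<forall>i\<in>?W. ?h (\<lambda>z. len z \<omega>, T 0 \<omega>) i = y i"
          using True by (simp add: prod_eq_iff)
      qed
      have "{\<omega> \<in> space N. (\<forall>i\<in>?W. ?h (\<lambda>z. len z \<omega>, T 0 \<omega>) i = y i) \<and> \<omega> \<in> ?B} =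
          {\<omega> \<in> space N. (T 0 \<omega> = t \<and> (\<forall>i\<in>?W. len i \<omega> = fst (y i))) \<and> star_block X' R' i \<omega> = \<sigma>}"
        unfolding W by blast
      then show ?thesis
        using prob_window_block[OF m, of t "\<lambda>i. fst (y i)" \<sigma>] unfolding W by simp
    next
      case False
      then obtain k where k: "k \<in> ?W" "snd (y k) \<noteq> t" by blast
      have "\<not> (\<forall>i\<in>?W. ?h (\<lambda>z. len z \<omega>, T 0 \<omega>) i = y i)" for \<omega>
      proof
        assume *: "\<forall>i\<in>?W. ?h (\<lambda>z. len z \<omega>, T 0 \<omega>) i = y i"
        from bspec[OF * W0] bspec[OF * k(1)] k(2) show False by (simp add: prod_eq_iff t_def)
      qed
      then show ?thesis by (simp only: simp_thms Collect_empty_eq) simp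
    qed
  qed (auto simp: pmf_le_1 space_pair_measure intro: st.N.prob_space_axioms)
  then show ?thesis by (simp add: lengths_delay_algebra_def)
qed

end

theorem theorem3p2:
  fixes M :: "'a measure"
    and X :: "'a \<Rightarrow> int \<Rightarrow> int"
    and Y :: "nat \<Rightarrow> 'a \<Rightarrow> enat"
    and L :: "((int \<Rightarrow> int) \<times> (int \<Rightarrow> bool)) measure"
  assumes "regenerative M X Y L"
  shows
    "(\<forall>(p :: nat pmf) (Q :: nat \<Rightarrow> (int \<Rightarrow> int) pmf) (\<mu> :: real).
        positive_recurrent M Y \<and> governed_by M X Y p Q \<and>
        summable (\<lambda>n. real n * pmf p n) \<and> \<mu> = (\<Sum>n. real n * pmf p n) \<longrightarrow>
        (\<exists>!S. sets S = sets (path_space UNIV \<Otimes>\<^sub>M path_space UNIV) \<and>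
              stationary_version M X Y L \<mu> S fst snd) \<and>
        (\<forall>(N :: 'b measure) X' R'. stationary_version M X Y L \<mu> N X' R' \<longrightarrow>
           (AE \<omega> in N. enumerates_times (R' \<omega>) (\<lambda>z. star_time R' z \<omega>)) \<and>
           prob_space.indep_vars N (\<lambda>_. count_space UNIV) (star_length R') UNIV \<and>
           (\<forall>z n. z \<noteq> 0 \<longrightarrow> \<P>(\<omega> in N. star_length R' z \<omega> = int n) = pmf p n) \<and>
           (\<forall>n\<ge>1. \<P>(\<omega> in N. star_length R' 0 \<omega> = int n) = real n * pmf p n / \<mu>) \<and>
           (\<forall>t. AE \<omega> in N.
              real_cond_exp N (lengths_algebra N R')
                (indicator {\<omega> \<in> space N. star_time R' 0 \<omega> = t}) \<omega> =
              pmf (pmf_of_set {0..star_length R' 0 \<omega> - 1}) t) \<and>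
           (\<forall>i \<sigma>. AE \<omega> in N.
              real_cond_exp N (lengths_delay_algebra N R')
                (indicator {\<omega> \<in> space N. star_block X' R' i \<omega> = \<sigma>}) \<omega> =
              pmf (Q (nat (star_length R' i \<omega>))) \<sigma>))) \<and>
     (\<forall>(N :: 'b measure) X' R'. stationary_regenerative N X' R' L \<longrightarrow> positive_recurrent M Y)"
proof -
  interpret regenerative_perm M X Y L by standard (rule assms)
  show ?thesis
  proof (intro conjI allI impI; (elim conjE)?)
    fix p :: "nat pmf" and Q :: "nat \<Rightarrow> (int \<Rightarrow> int) pmf" and \<mu> :: real
    assume "governed_by M X Y p Q" "summable (\<lambda>n. real n * pmf p n)" "\<mu> = (\<Sum>n. real n * pmf p n)"
    then interpret governed_perm M X Y L p Q \<mu> by unfold_locales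
    show "\<exists>!S. sets S = sets (path_space UNIV \<Otimes>\<^sub>M path_space UNIV) \<and> stationary_version M X Y L \<mu> S fst snd"
      by (rule ex1_stationary_version)
    fix N :: "'b measure" and X' R'
    assume "stationary_version M X Y L \<mu> N X' R'"
    then interpret st: stationary_process N L X' R' "1 / \<mu>" by (rule stationary_process_version)
    interpret stationary_version_process M X Y L p Q \<mu> N X' R' by unfold_locales
    show "AE \<omega> in N. enumerates_times (R' \<omega>) (\<lambda>z. star_time R' z \<omega>)" by (rule AE_enumerates)
    show "prob_space.indep_vars N (\<lambda>_. count_space UNIV) (star_length R') UNIV" by (rule indep_lengths)
    show "\<P>(\<omega> in N. star_length R' z \<omega> = int n) = pmf p n" if "z \<noteq> 0" for z n
      using that by (simp add: prob_length)
    show "\<P>(\<omega> in N. star_length R' 0 \<omega> = int n) = real n * pmf p n / \<mu>" for n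
      by (simp add: prob_length)
    show "AE \<omega> in N. real_cond_exp N (lengths_algebra N R') (indicator {\<omega> \<in> space N. star_time R' 0 \<omega> = t}) \<omega> =
        pmf (pmf_of_set {0..star_length R' 0 \<omega> - 1}) t" for t
      by (rule cond_delay)
    show "AE \<omega> in N. real_cond_exp N (lengths_delay_algebra N R')
        (indicator {\<omega> \<in> space N. star_block X' R' i \<omega> = \<sigma>}) \<omega> = pmf (Q (nat (star_length R' i \<omega>))) \<sigma>" for i \<sigma>
      by (rule cond_block)
  next
    fix N :: "'b measure" and X' R'
    assume "stationary_regenerative N X' R' L"
    then show "positive_recurrent M Y" by (rule positive_recurrent_if_stationary)
  qed
qed

end
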